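(* Suppose $X_t$ is generated by the fractional model described in the context with memory parameter $d_0\in[\Delta_1,\Delta_2]$, and that Assumptions 1–4 listed in the context hold. Then, for $d_0\in(1,M]$ with $1<M<\infty$, $\widehat d\overset{p}{\to}1$ as $n\to\infty$.
   Context: Model. For real $d$ and integer $k\ge0$ let $(d)_k=d(d+1)\cdots(d+k-1)$, $(d)_0=1$. Given the true memory parameter $d_0$, $X_t=\sum_{k=0}^{t-1}\frac{(d_0)_k}{k!}u_{t-k}+X_0$, $t=0,1,2,\dots$ (equivalently $(1-L)^{d_0}(X_t-X_0)=u_t$ with $L$ the lag operator), where $X_0$ is a random variable with a certain fixed distribution, $u_t=0$ for $t\le0$, and $u_t$, $t\ge1$, is stationary with zero mean and spectral density $f_u(\lambda)$. Periodogram. For a series $a_t$, $w_a(\lambda_s)=(2\pi n)^{-1/2}\sum_{t=1}^n a_te^{it\lambda_s}$, $\lambda_s=2\pi s/n$, and $I_a(\lambda_s)=|w_a(\lambda_s)|^2$. Estimator (local Whittle). $m=m(n)$ is an integer less than $n$; $\Delta_1,\Delta_2$ are numbers with $-\tfrac12<\Delta_1<\Delta_2<\infty$. Define $\widehat G(d)=\frac1m\sum_{j=1}^m\lambda_j^{2d}I_x(\lambda_j)$ (with $I_x$ the periodogram of $X_1,\dots,X_n$), $R(d)=\log\widehat G(d)-2d\frac1m\sum_{j=1}^m\log\lambda_j$, and $\widehat d=\arg\min_{d\in[\Delta_1,\Delta_2]}R(d)$. Assumption 1. $f_u(\lambda)\sim f_u(0)\in(0,\infty)$ as $\lambda\to0+$.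 Assumption 2. In a neighborhood $(0,\delta)$ of the origin, $f_u(\lambda)$ is differentiable and $\frac{d}{d\lambda}\log f_u(\lambda)=O(\lambda^{-1})$ as $\lambda\to0+$. Assumption 3. $u_t=C(L)\varepsilon_t=\sum_{j=0}^\infty c_j\varepsilon_{t-j}$ (for $t\ge1$), $\sum_{j=0}^\infty c_j^2<\infty$, where $E(\varepsilon_t|F_{t-1})=0$, $E(\varepsilon_t^2|F_{t-1})=1$ a.s., $t=0,\pm1,\dots$, in which $F_t$ is the $\sigma$-field generated by $\varepsilon_s$, $s\le t$, and there exists a random variable $\varepsilon$ such that $E\varepsilon^2<\infty$ and for all $\eta>0$ and some $K>0$, $\Pr(|\varepsilon_t|>\eta)\le K\Pr(|\varepsilon|>\eta)$. Assumption 4. $\frac1m+\frac mn\to0$ as $n\to\infty$.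
   Formalization: The condition Δ₁ ≤ 1 is added, so that 1 lies in [Δ₁, Δ₂]; without it the estimate satisfies d̂ ≥ Δ₁ > 1 and cannot converge to 1. *)

theory Defs
  imports "HOL-Probability.Probability" "HOL-Library.Landau_Symbols"
begin

section \<open>The fractional model\<close>

text \<open>Stationarity is second-order stationarity, for the indices \<open>t \<ge> 1\<close> only, since
  \<open>u t = 0\<close> for \<open>t \<le> 0\<close>.\<close>

definition zero_mean_stationary :: "'a measure \<Rightarrow> (int \<Rightarrow> 'a \<Rightarrow> real) \<Rightarrow> bool" where
  "zero_mean_stationary P u \<longleftrightarrow>
     (\<forall>t\<ge>1. u t \<in> borel_measurable P \<and> integrable P (\<lambda>\<omega>. (u t \<omega>)\<^sup>2) \<and>
            integral\<^sup>L P (u t) = 0) \<and>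
     (\<forall>s\<ge>1. \<forall>t\<ge>1. \<forall>h\<ge>0.
        (LINT \<omega>|P. u (s + h) \<omega> * u s \<omega>) = (LINT \<omega>|P. u (t + h) \<omega> * u t \<omega>))"

definition has_spectral_density ::
    "'a measure \<Rightarrow> (int \<Rightarrow> 'a \<Rightarrow> real) \<Rightarrow> (real \<Rightarrow> real) \<Rightarrow> bool" where
  "has_spectral_density P u f \<longleftrightarrow>
     (\<forall>\<theta>\<in>{-pi..pi}. 0 \<le> f \<theta>) \<and> set_integrable lborel {-pi..pi} f \<and>
     (\<forall>s\<ge>1. \<forall>t\<ge>1. complex_of_real (LINT \<omega>|P. u s \<omega> * u t \<omega>) =
        (LINT \<theta>:{-pi..pi}|lborel. complex_of_real (f \<theta>) * cis (of_int (s - t) * \<theta>)))"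

definition fractional_model ::
    "'a measure \<Rightarrow> real \<Rightarrow> (real \<Rightarrow> real) \<Rightarrow> (int \<Rightarrow> 'a \<Rightarrow> real) \<Rightarrow> ('a \<Rightarrow> real) \<Rightarrow>
     (nat \<Rightarrow> 'a \<Rightarrow> real) \<Rightarrow> bool" where
  "fractional_model P d\<^sub>0 f u X\<^sub>0 X \<longleftrightarrow>
     X\<^sub>0 \<in> borel_measurable P \<and>
     (\<forall>t\<le>0. \<forall>\<omega>\<in>space P. u t \<omega> = 0) \<and>
     zero_mean_stationary P u \<and> has_spectral_density P u f \<and>
     (\<forall>t. \<forall>\<omega>\<in>space P.
        X t \<omega> = (\<Sum>k<t. pochhammer d\<^sub>0 k / fact k * u (int t - int k) \<omega>) + X\<^sub>0 \<omega>)"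


section \<open>The local Whittle criterion\<close>

definition fourier_freq :: "nat \<Rightarrow> nat \<Rightarrow> real" where
  "fourier_freq n s = 2 * pi * real s / real n"

definition dft :: "(nat \<Rightarrow> real) \<Rightarrow> nat \<Rightarrow> real \<Rightarrow> complex" where
  "dft a n \<theta> =
     (\<Sum>t=1..n. complex_of_real (a t) * cis (real t * \<theta>)) / complex_of_real (sqrt (2 * pi * real n))"

definition periodogram :: "(nat \<Rightarrow> real) \<Rightarrow> nat \<Rightarrow> real \<Rightarrow> real" where
  "periodogram a n \<theta> = (cmod (dft a n \<theta>))\<^sup>2"

definition G_hat :: "(nat \<Rightarrow> real) \<Rightarrow> nat \<Rightarrow> nat \<Rightarrow> real \<Rightarrow> real" where
  "G_hat x n m d =
     (1 / real m) * (\<Sum>j=1..m. fourier_freq n j powr (2 * d) * periodogram x n (fourier_freq n j))"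

text \<open>If all the periodogram ordinates vanish, then \<open>G_hat\<close> is \<open>0\<close> for every \<open>d\<close> and the
  convention \<open>ln 0 = 0\<close> applies.\<close>

definition whittle_R :: "(nat \<Rightarrow> real) \<Rightarrow> nat \<Rightarrow> nat \<Rightarrow> real \<Rightarrow> real" where
  "whittle_R x n m d =
     ln (G_hat x n m d) - 2 * d * ((1 / real m) * (\<Sum>j=1..m. ln (fourier_freq n j)))"

text \<open>Any measurable selection from the minimizers is allowed; bandwidths \<open>m n = 0\<close>, for which
  the criterion is undefined, impose no constraint.\<close>

definition local_whittle_estimator ::
    "'a measure \<Rightarrow> (nat \<Rightarrow> 'a \<Rightarrow> real) \<Rightarrow> (nat \<Rightarrow> nat) \<Rightarrow> real \<Rightarrow> real \<Rightarrow> (nat \<Rightarrow> 'a \<Rightarrow> real) \<Rightarrow> bool"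
    where
  "local_whittle_estimator P X m \<Delta>\<^sub>1 \<Delta>\<^sub>2 dhat \<longleftrightarrow>
     (\<forall>n. dhat n \<in> borel_measurable P) \<and>
     (\<forall>n. 0 < m n \<longrightarrow> (\<forall>\<omega>\<in>space P.
        is_arg_min (whittle_R (\<lambda>t. X t \<omega>) n (m n)) (\<lambda>d. d \<in> {\<Delta>\<^sub>1..\<Delta>\<^sub>2}) (dhat n \<omega>)))"


section \<open>Assumptions\<close>

definition spectral_level_at_zero :: "(real \<Rightarrow> real) \<Rightarrow> bool" where
  "spectral_level_at_zero f \<longleftrightarrow> 0 < f 0 \<and> f \<sim>[at_right 0] (\<lambda>_. f 0)"

definition spectral_log_derivative_bound :: "(real \<Rightarrow> real) \<Rightarrow> bool" where
  "spectral_log_derivative_bound f \<longleftrightarrow>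
     (\<exists>\<delta>>0. \<forall>\<theta>\<in>{0<..<\<delta>}. f differentiable at \<theta>) \<and>
     deriv (\<lambda>\<theta>. ln (f \<theta>)) \<in> O[at_right 0](\<lambda>\<theta>. inverse \<theta>)"

definition past_sigma :: "'a measure \<Rightarrow> (int \<Rightarrow> 'a \<Rightarrow> real) \<Rightarrow> int \<Rightarrow> 'a measure" where
  "past_sigma P \<epsilon> t = sigma (space P) {\<epsilon> s -` A \<inter> space P | s A. s \<le> t \<and> A \<in> sets borel}"

text \<open>The integrability requirements are implied by the tail domination below; they are
  included so that the conditional expectations are meaningful in their own right.\<close>

definition unit_martingale_differences :: "'a measure \<Rightarrow> (int \<Rightarrow> 'a \<Rightarrow> real) \<Rightarrow> bool" where
  "unit_martingale_differences P \<epsilon> \<longleftrightarrow>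
     (\<forall>t. \<epsilon> t \<in> borel_measurable P \<and> integrable P (\<epsilon> t) \<and> integrable P (\<lambda>\<omega>. (\<epsilon> t \<omega>)\<^sup>2) \<and>
        (AE \<omega> in P. real_cond_exp P (past_sigma P \<epsilon> (t - 1)) (\<epsilon> t) \<omega> = 0) \<and>
        (AE \<omega> in P. real_cond_exp P (past_sigma P \<epsilon> (t - 1)) (\<lambda>\<omega>. (\<epsilon> t \<omega>)\<^sup>2) \<omega> = 1))"

definition tail_dominated :: "'a measure \<Rightarrow> (int \<Rightarrow> 'a \<Rightarrow> real) \<Rightarrow> bool" where
  "tail_dominated P \<epsilon> \<longleftrightarrow>
     (\<exists>e K. e \<in> borel_measurable P \<and> integrable P (\<lambda>\<omega>. (e \<omega>)\<^sup>2) \<and> 0 < K \<and>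
        (\<forall>\<eta>>0. \<forall>t. measure P {\<omega>\<in>space P. \<bar>\<epsilon> t \<omega>\<bar> > \<eta>}
                      \<le> K * measure P {\<omega>\<in>space P. \<bar>e \<omega>\<bar> > \<eta>}))"

text \<open>The infinite moving average converges in mean square.\<close>

definition linear_process ::
    "'a measure \<Rightarrow> (int \<Rightarrow> 'a \<Rightarrow> real) \<Rightarrow> (nat \<Rightarrow> real) \<Rightarrow> (int \<Rightarrow> 'a \<Rightarrow> real) \<Rightarrow> bool" where
  "linear_process P u c \<epsilon> \<longleftrightarrow>
     summable (\<lambda>j. (c j)\<^sup>2) \<and>
     (\<forall>t\<ge>1. (\<lambda>N. \<integral>\<^sup>+\<omega>. ennreal ((u t \<omega> - (\<Sum>j<N. c j * \<epsilon> (t - int j) \<omega>))\<^sup>2) \<partial>P)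
               \<longlonglongrightarrow> 0)"

text \<open>In HOL \<open>1 / 0 = 0\<close>, so positivity of the bandwidth has to be required separately.\<close>

definition bandwidth :: "(nat \<Rightarrow> nat) \<Rightarrow> bool" where
  "bandwidth m \<longleftrightarrow>
     (\<forall>n\<ge>1. m n < n) \<and> (\<forall>\<^sub>F n in sequentially. 0 < m n) \<and>
     (\<lambda>n. 1 / real (m n) + real (m n) / real n) \<longlonglongrightarrow> 0"

definition converges_in_probability ::
    "'a measure \<Rightarrow> (nat \<Rightarrow> 'a \<Rightarrow> real) \<Rightarrow> real \<Rightarrow> bool" where
  "converges_in_probability P Y y \<longleftrightarrow>
     (\<forall>\<eta>>0. (\<lambda>n. measure P {\<omega>\<in>space P. \<bar>Y n \<omega> - y\<bar> > \<eta>}) \<longlonglongrightarrow> 0)"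

end

theory Submission
  imports Defs
begin

text \<open>Put \<open>d = d\<^sub>0 - 1 > 0\<close>. Summation by parts expresses the discrete Fourier transform of \<open>X\<close> at
  \<open>\<lambda>\<^sub>j\<close>, multiplied by \<open>1 - e\<^sup>i\<^sup>\<lambda>\<close>, as the transform of the differenced series minus the boundary term
  \<open>e\<^sup>i\<^sup>\<lambda> (X\<^sub>n - X\<^sub>0) / sqrt (2 \<pi> n)\<close>. The mean square of the former, averaged over \<open>j \<le> m\<close>, is
  \<open>o(n\<^sup>2\<^sup>d)\<close>, whereas the square of the latter is of exact order \<open>n\<^sup>2\<^sup>d\<close>: \<open>X\<^sub>n - X\<^sub>0\<close> is a weighted sum of
  martingale differences of variance at least \<open>c n\<^sup>2\<^sup>d\<^sup>+\<^sup>1\<close>, and by the central limit theorem its law does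
  not concentrate at the origin. So the weights \<open>\<lambda>\<^sub>j\<^sup>2 I\<^sub>x(\<lambda>\<^sub>j)\<close> are asymptotically constant in \<open>j\<close>, as
  they would be for a series with memory parameter \<open>1\<close>. As \<open>exp \<circ> R\<close> is convex, no uniformity in \<open>d\<close>
  is needed: it suffices to compare \<open>R\<close> at \<open>1\<close> and at \<open>1 \<plusminus> h\<close>, where strict Jensen inequality applies.\<close>


section \<open>The Whittle criterion with nearly constant weights\<close>

text \<open>At a Fourier frequency \<open>z ^ n = 1\<close>, so the boundary term has the same
  modulus in every ordinate, whatever \<open>d\<^sub>0 > 1\<close> is; this is why the limit forgets
  \<open>d\<^sub>0\<close>. The comparison can only be made in mean over j. For bounded j the
  differenced series may be of the same order as the boundary term, so single weights need not be
  close to a constant; only their mean absolute deviation is small. Exponentials of the centred log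
  frequencies with a negative factor are large exactly at small j, so they must be truncated at a
  fixed level before the Jensen gap can be combined with such weights. A lower bound on the variance
  of the boundary term would not keep it away from zero with probability close to one; hence the
  detour through characteristic functions. Finally, the density is controlled only to the right of
  the origin and is not assumed even, whereas second moments involve both sides; hence the
  symmetrisation.\<close>

lemma powr_tangent_bounds:
  fixes p :: real
  assumes "p > 0" "k \<ge> (1::nat)"
  shows "p \<ge> 1 \<Longrightarrow> real k powr p - (real k - 1) powr p \<le> p * real k powr (p - 1)"
    and "p \<le> 1 \<Longrightarrow> (real k + 1) powr p - real k powr p \<le> p * real k powr (p - 1)"
    and "p \<le> 1 \<Longrightarrow> p * real k powr (p - 1) \<le> real k powr p - (real k - 1) powr p"
proof -
  have mvt: "\<exists>z. a < z \<and> z < b \<and> b powr p - a powr p = (b - a) * (p * z powr (p - 1))"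
    if "0 < a" "a < b" for a b :: real
    using that by (intro MVT2) (auto intro!: derivative_eq_intros)
  show "real k powr p - (real k - 1) powr p \<le> p * real k powr (p - 1)" if "p \<ge> 1"
  \<comment> \<open>For \<open>k = 1\<close> the left endpoint is 0, outside the reach of the mean
    value argument; there \<open>0 powr p = 0\<close> settles the claim.\<close>
  proof (cases "k = 1")
    case False
    then obtain z where "real k - 1 < z" "z < real k"
        "real k powr p - (real k - 1) powr p = (p * z powr (p - 1))"
      using mvt[of "real k - 1" "real k"] assms by auto
    moreover have "z powr (p - 1) \<le> real k powr (p - 1)"
      using calculation that assms(2) by (intro powr_mono2) auto
    ultimately show ?thesis using assms by simp
  qed (use that in simp)
  show "(real k + 1) powr p - real k powr p \<le> p * real k powr (p - 1)" if "p \<le> 1"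
  proof -
    obtain z where "real k < z" "z < real k + 1"
        "(real k + 1) powr p - real k powr p = (p * z powr (p - 1))"
      using mvt[of "real k" "real k + 1"] assms by auto
    moreover have "z powr (p - 1) \<le> real k powr (p - 1)"
      using calculation that assms by (intro powr_mono2') auto
    ultimately show ?thesis using assms by simp
  qed
  show "p * real k powr (p - 1) \<le> real k powr p - (real k - 1) powr p" if "p \<le> 1"
  proof (cases "k = 1")
    case False
    then obtain z where z: "real k - 1 < z" "z < real k"
        "real k powr p - (real k - 1) powr p = (p * z powr (p - 1))"
      using mvt[of "real k - 1" "real k"] assms by auto
    moreover have "z powr (p - 1) \<ge> real k powr (p - 1)"
      using z that assms False by (intro powr_mono2') auto
    ultimately show ?thesis using assms by simp
  qed (use that in simp)
qed

text \<open>A Riemann sum for the integral of \<open>x powr s\<close> over the unit interval, which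
  is \<open>1 / (1 + s)\<close>. Increments of \<open>j powr (1 + s)\<close> telescope and are
  compared with tangents. For negative \<open>s\<close> the tangent inequalities reverse, so the
  lower bound uses forward differences; these start at 1 instead of 0, whence the defect
  \<open>real m powr - (1 + s)\<close>.\<close>

lemma power_mean_bounds:
  fixes s :: real
  assumes "s > -1" "m \<ge> (1::nat)"
  shows "(1 - real m powr - (1 + s)) / (1 + s) \<le> (1 / real m) * (\<Sum>j=1..m. (real j / real m) powr s)"
    and "(1 / real m) * (\<Sum>j=1..m. (real j / real m) powr s) \<le> max 1 (1 / (1 + s))"
proof -
  let ?p = "1 + s"
  have p: "?p > 0" using assms by simp
  have eq: "(1 / real m) * (\<Sum>j=1..m. (real j / real m) powr s) = (\<Sum>j=1..m. real j powr s) / real m powr ?p"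
    using assms by (simp add: powr_divide sum_divide_distrib[symmetric] powr_add)
  have mp: "real m powr ?p > 0" using assms by simp
  have low: "real m powr ?p - 1 \<le> ?p * (\<Sum>j=1..m. real j powr s)"
  proof (cases "s \<ge> 0")
    case True
    have "real m powr ?p = (\<Sum>j=1..m. real j powr ?p - (real j - 1) powr ?p)"
      by (induction m) auto
    also have "\<dots> \<le> (\<Sum>j=1..m. ?p * real j powr (?p - 1))"
      using True p by (intro sum_mono powr_tangent_bounds(1)) auto
    finally show ?thesis by (simp add: sum_distrib_left)
  next
    case False
    have "(real m + 1) powr ?p - 1 = (\<Sum>j=1..m. (real j + 1) powr ?p - real j powr ?p)"
      by (induction m) (auto simp: add.commute)
    also have "\<dots> \<le> (\<Sum>j=1..m. ?p * real j powr (?p - 1))"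
      using False p by (intro sum_mono powr_tangent_bounds(2)) auto
    finally have "(real m + 1) powr ?p - 1 \<le> ?p * (\<Sum>j=1..m. real j powr s)"
      by (simp add: sum_distrib_left)
    moreover have "real m powr ?p \<le> (real m + 1) powr ?p" using p by (intro powr_mono2) auto
    ultimately show ?thesis by simp
  qed
  have "(1 - real m powr - ?p) / ?p = (real m powr ?p - 1) / (?p * real m powr ?p)"
  proof -
    have "real m powr - ?p = 1 / real m powr ?p" by (rule powr_minus_divide)
    then have "1 - real m powr - ?p = (real m powr ?p - 1) / real m powr ?p" 
      using mp by (simp add: diff_divide_distrib)
    then show ?thesis by (simp add: mult.commute)
  qed
  also have "\<dots> \<le> (?p * (\<Sum>j=1..m. real j powr s)) / (?p * real m powr ?p)"
    using mp p low by (intro divide_right_mono) auto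
  also have "\<dots> = (\<Sum>j=1..m. real j powr s) / real m powr ?p" using p by simp
  finally show "(1 - real m powr - ?p) / ?p \<le> (1 / real m) * (\<Sum>j=1..m. (real j / real m) powr s)"
    using eq by simp
  show "(1 / real m) * (\<Sum>j=1..m. (real j / real m) powr s) \<le> max 1 (1 / ?p)"
  proof (cases "s \<ge> 0")
    case True
    have "(\<Sum>j=1..m. (real j / real m) powr s) \<le> (\<Sum>j=1..m. 1)"
      using True assms by (intro sum_mono powr_le1) auto
    then have "(1 / real m) * (\<Sum>j=1..m. (real j / real m) powr s) \<le> 1"
      using assms by (simp add: field_simps)
    then show ?thesis by simp
  next
    case False
    have "?p * (\<Sum>j=1..m. real j powr s) = (\<Sum>j=1..m. ?p * real j powr (?p - 1))"
      by (simp add: sum_distrib_left)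
    also have "\<dots> \<le> (\<Sum>j=1..m. real j powr ?p - (real j - 1) powr ?p)"
      using False p by (intro sum_mono powr_tangent_bounds(3)) auto
    also have "\<dots> = real m powr ?p" by (induction m) auto
    finally have "(\<Sum>j=1..m. real j powr s) / real m powr ?p \<le> 1 / ?p"
      using mp p by (simp add: field_simps)
    then show ?thesis using eq by simp
  qed
qed

text \<open>An elementary Stirling formula for \<open>ln (fact m)\<close>, by induction from the two
  one-sided bounds on \<open>ln (1 + 1 / n)\<close>. The geometric mean of 1, ..., m is thus
  asymptotically \<open>m / exp 1\<close>.\<close>

lemma mean_ln_bounds:
  assumes "m \<ge> (1::nat)"
  shows "ln (real m) - (1 / real m) * (\<Sum>j=1..m. ln (real j)) \<le> 1"
    and "1 - (1 + ln (real m)) / real m \<le> ln (real m) - (1 / real m) * (\<Sum>j=1..m. ln (real j))"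
proof -
  have low: "real m * ln (real m) - real m + 1 \<le> (\<Sum>j=1..m. ln (real j)) \<and>
      (\<Sum>j=1..m. ln (real j)) \<le> (real m + 1) * ln (real m) - real m + 1"
    using assms
  proof (induction m rule: nat_induct_at_least)
    case (Suc n)
    have n: "real n > 0" using Suc by simp
    have "ln ((real n + 1) / real n) \<le> 1 / real n"
      using ln_add_one_self_le_self[of "1 / real n"] n by (simp add: field_simps)
    then have a: "real n * (ln (real n + 1) - ln (real n)) \<le> 1"
      using n by (simp add: ln_div field_simps)
    have "ln (real n / (real n + 1)) \<le> real n / (real n + 1) - 1"
      using n by (intro ln_le_minus_one) auto
    then have b: "(real n + 1) * (ln (real n + 1) - ln (real n)) \<ge> 1"
      using n by (simp add: ln_div field_simps)
    show ?case using Suc.IH a b by (simp add: algebra_simps)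
  qed simp
  have m: "real m > 0" using assms by simp
  have "ln (real m) - (1 / real m) * (\<Sum>j=1..m. ln (real j)) = (real m * ln (real m) - (\<Sum>j=1..m. ln (real j))) / real m"
    using m by (simp add: field_simps)
  moreover have "\<dots> \<le> (real m) / real m"
    by (intro divide_right_mono) (use low in linarith)+
  moreover have "(real m - (1 + ln (real m))) / real m \<le> (real m * ln (real m) - (\<Sum>j=1..m. ln (real j))) / real m"
    using low by (intro divide_right_mono) (auto simp: algebra_simps)
  ultimately show "ln (real m) - (1 / real m) * (\<Sum>j=1..m. ln (real j)) \<le> 1"
    and "1 - (1 + ln (real m)) / real m \<le> ln (real m) - (1 / real m) * (\<Sum>j=1..m. ln (real j))"
    using m by (auto simp: field_simps)
qed

text \<open>The logarithm of the j-th Fourier frequency minus its mean over the first m frequencies: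
  the scale \<open>2 * pi / n\<close> cancels, so n does not occur.\<close>

definition centred_ln :: "nat \<Rightarrow> nat \<Rightarrow> real" where
  "centred_ln m j = ln (real j) - (1 / real m) * (\<Sum>i=1..m. ln (real i))"

text \<open>The exponential equals \<open>(j / m) powr s * exp (s * c m)\<close> with
  \<open>c m\<close> tending to 1, so its mean tends to \<open>exp s / (1 + s)\<close>, which
  exceeds 1 for nonzero \<open>s\<close>. Truncation at \<open>B\<close> costs at most the mean of
  \<open>exp (2 * s * centred_ln m j) / B\<close>, and this mean is bounded because
  \<open>2 * s > -1\<close>.\<close>

lemma jensen_gap:
  fixes s :: real
  assumes "s > -1/2" "s \<noteq> 0"
  shows "\<exists>K>1. \<exists>B>0. \<forall>\<^sub>F m in sequentially.
           K * real m \<le> (\<Sum>j=1..m. min (exp (s * centred_ln m j)) B)"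
proof -
  define c where "c m = ln (real m) - (1 / real m) * (\<Sum>j=1..m. ln (real j))" for m :: nat
  have c1: "c m \<le> 1" "1 - (1 + ln (real m)) / real m \<le> c m" if "m \<ge> 1" for m
    using mean_ln_bounds[OF that] by (auto simp: c_def)
  have clim: "c \<longlonglongrightarrow> 1"
  proof (rule tendsto_sandwich)
    show "\<forall>\<^sub>F m in sequentially. 1 - (1 + ln (real m)) / real m \<le> c m"
      using eventually_ge_at_top[of 1] by eventually_elim (rule c1)
    show "\<forall>\<^sub>F m in sequentially. c m \<le> 1"
      using eventually_ge_at_top[of 1] by eventually_elim (rule c1)
    have "(\<lambda>m. 1 - (1 / real m + ln (real m) / real m)) \<longlonglongrightarrow> 1 - (0 + 0)"
      by (intro tendsto_intros lim_1_over_n lim_ln_over_n)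
    then show "(\<lambda>m. 1 - (1 + ln (real m)) / real m) \<longlonglongrightarrow> 1" by (simp add: add_divide_distrib)
  qed simp
  have split: "exp (t * centred_ln m j) = (real j / real m) powr t * exp (t * c m)"
    if "j \<in> {1..m}" for t m j
    using that by (auto simp: centred_ln_def c_def powr_def exp_add[symmetric] ln_div algebra_simps)
  define L where "L = exp s / (1 + s)"
  have L: "L > 1"
  proof -
    have "ln (1 + s) < s"
      using ln_eq_minus_one[of "1 + s"] ln_le_minus_one[of "1 + s"] assms by fastforce
    then have "exp (ln (1 + s)) < exp s" by simp
    then show ?thesis using assms by (simp add: L_def)
  qed
  define C where "C = exp (2 * \<bar>s\<bar>) * max 1 (1 / (1 + 2 * s))"
  have C: "C > 0" by (simp add: C_def less_max_iff_disj)
  \<comment> \<open>\<open>C\<close> bounds the mean of the squared exponentials, so this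
    \<open>B\<close> limits the truncation loss to \<open>(L - 1) / 3\<close>; another third is
    spent on the limit, and the last third is the gap.\<close>
  define B where "B = 3 * C / (L - 1)"
  have B: "B > 0" using L C by (simp add: B_def)
  have lim: "(\<lambda>m. exp (s * c m) * ((1 - real m powr - (1 + s)) / (1 + s))) \<longlonglongrightarrow> exp (s * 1) * ((1 - 0) / (1 + s))"
    using assms by (intro tendsto_intros clim tendsto_neg_powr filterlim_real_sequentially) auto
  have "\<forall>\<^sub>F m in sequentially. exp (s * c m) * ((1 - real m powr - (1 + s)) / (1 + s)) > L - (L - 1) / 3"
    using L by (intro order_tendstoD(1)[OF lim]) (auto simp: L_def)
  moreover have "\<forall>\<^sub>F m in sequentially. c m > 0" by (rule order_tendstoD(1)[OF clim]) simp
  ultimately have "\<forall>\<^sub>F m in sequentially.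
     (1 + (L - 1) / 3) * real m \<le> (\<Sum>j=1..m. min (exp (s * centred_ln m j)) B)"
    using eventually_ge_at_top[of 1]
  proof eventually_elim
    case (elim m)
    have minb: "min (exp y) B \<ge> exp y - exp (2 * y) / B" for y :: real
    proof (cases "exp y \<le> B")
      case False
      have "exp y * exp y / B \<ge> exp y" using False B by (simp add: field_simps)
      then show ?thesis using False B by (simp add: exp_double power2_eq_square)
    qed (use B in auto)
    have "(\<Sum>j=1..m. min (exp (s * centred_ln m j)) B) \<ge>
        (\<Sum>j=1..m. exp (s * centred_ln m j) - exp ((2 * s) * centred_ln m j) / B)"
      using minb by (intro sum_mono) (auto simp: mult.assoc)
    moreover have "(\<Sum>j=1..m. exp (s * centred_ln m j) - exp ((2 * s) * centred_ln m j) / B)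
        = exp (s * c m) * (\<Sum>j=1..m. (real j / real m) powr s) -
          exp ((2 * s) * c m) * (\<Sum>j=1..m. (real j / real m) powr (2 * s)) / B"
    proof -
      have "(\<Sum>j=1..m. exp (t * centred_ln m j)) = exp (t * c m) * (\<Sum>j=1..m. (real j / real m) powr t)" for t
        unfolding sum_distrib_left by (intro sum.cong refl) (simp only: split mult.commute)
      then show ?thesis by (simp only: sum_subtractf sum_divide_distrib[symmetric])
    qed
    moreover have "exp (s * c m) * (\<Sum>j=1..m. (real j / real m) powr s) \<ge> (L - (L - 1) / 3) * real m"
    proof -
      have "(L - (L - 1) / 3) \<le> exp (s * c m) * ((1 / real m) * (\<Sum>j=1..m. (real j / real m) powr s))"
        using assms elim by (intro order.trans[OF less_imp_le[OF elim(1)] mult_left_mono] power_mean_bounds(1)) auto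
      then show ?thesis using elim by (simp add: field_simps)
    qed
    moreover have "exp ((2 * s) * c m) * (\<Sum>j=1..m. (real j / real m) powr (2 * s)) \<le> C * real m"
    proof -
      have "(2 * s) * c m \<le> 2 * \<bar>s\<bar>"
      proof -
        have "\<bar>(2 * s) * c m\<bar> \<le> 2 * \<bar>s\<bar>" 
          using elim c1(1)[of m] by (simp add: abs_mult mult_left_le)
        then show ?thesis by linarith
      qed
      moreover have "(1 / real m) * (\<Sum>j=1..m. (real j / real m) powr (2 * s)) \<le> max 1 (1 / (1 + 2 * s))"
        using power_mean_bounds(2)[of "2 * s" m] assms elim by simp
      ultimately have "exp ((2 * s) * c m) * ((1 / real m) * (\<Sum>j=1..m. (real j / real m) powr (2 * s))) \<le> C"
        unfolding C_def by (intro mult_mono) (auto intro!: sum_nonneg divide_nonneg_nonneg)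
      then show ?thesis using elim by (simp add: field_simps)
    qed
    then have "exp ((2 * s) * c m) * (\<Sum>j=1..m. (real j / real m) powr (2 * s)) / B \<le> C * real m / B"
      using B by (intro divide_right_mono) auto
    ultimately have "(\<Sum>j=1..m. min (exp (s * centred_ln m j)) B) \<ge> (L - (L - 1) / 3) * real m - C * real m / B"
      by linarith
    also have "C * real m / B = (L - 1) / 3 * real m" using C L by (simp add: B_def field_simps)
    finally have "(L - (L - 1) / 3 - (L - 1) / 3) * real m \<le> (\<Sum>j=1..m. min (exp (s * centred_ln m j)) B)"
      by (simp only: left_diff_distrib)
    then show ?case by (simp add: field_simps)
  qed
  then show ?thesis using L B by (intro exI[of _ "1 + (L - 1) / 3"]) auto
qed

text \<open>The weights are close to \<open>z\<close> only in mean, so a single deviation might meet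
  a huge \<open>e j\<close>; capping \<open>e\<close> at \<open>B\<close> bounds the damage by
  \<open>B * \<tau> * z\<close> per index. The gain is \<open>(K - 1) * z\<close> per index, hence
  the condition on \<open>\<tau>\<close>, in which the summand 1 pays for replacing the left-hand
  sum by its value at \<open>z\<close>.\<close>

lemma weighted_sum_gt:
  fixes W e :: "nat \<Rightarrow> real"
  assumes W: "\<And>j. j \<in> A \<Longrightarrow> W j \<ge> 0" and "finite A"
    and e: "\<And>j. j \<in> A \<Longrightarrow> 0 \<le> e j"
    and gap: "K * real (card A) \<le> (\<Sum>j\<in>A. min (e j) B)"
    and close: "(\<Sum>j\<in>A. \<bar>W j - z\<bar>) \<le> \<tau> * z * real (card A)"
    and "z > 0" "B > 0" "\<tau> * (B + 1) < K - 1" "card A > 0"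
  shows "(\<Sum>j\<in>A. W j) < (\<Sum>j\<in>A. W j * e j)"
proof -
  have "(\<Sum>j\<in>A. W j * e j) \<ge> (\<Sum>j\<in>A. z * min (e j) B - B * \<bar>W j - z\<bar>)"
  proof (rule sum_mono)
    fix j assume j: "j \<in> A"
    have "z * min (e j) B - B * \<bar>W j - z\<bar> \<le> z * min (e j) B - min (e j) B * \<bar>W j - z\<bar>"
      using assms e[OF j] by (simp add: mult_right_mono)
    also have "\<dots> \<le> min (e j) B * W j"
    proof -
      have "min (e j) B * (z - \<bar>W j - z\<bar>) \<le> min (e j) B * W j"
        using e[OF j] assms by (intro mult_left_mono) auto
      then show ?thesis by (simp add: algebra_simps)
    qed
    also have "\<dots> \<le> W j * e j" using W[OF j] by (simp add: mult.commute mult_left_mono)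
    finally show "z * min (e j) B - B * \<bar>W j - z\<bar> \<le> W j * e j" .
  qed
  moreover have "(\<Sum>j\<in>A. z * min (e j) B - B * \<bar>W j - z\<bar>) \<ge> z * (K * card A) - B * (\<tau> * z * card A)"
    unfolding sum_subtractf sum_distrib_left[symmetric]
    using assms by (intro diff_mono mult_left_mono) auto
  moreover have "(\<Sum>j\<in>A. W j) \<le> (\<Sum>j\<in>A. z + \<bar>W j - z\<bar>)" by (intro sum_mono) auto
  moreover have "(\<Sum>j\<in>A. z + \<bar>W j - z\<bar>) \<le> z * card A + \<tau> * z * card A"
    using close by (simp add: sum.distrib mult.commute)
  moreover have "z * (K * card A) - B * (\<tau> * z * card A) > z * card A + \<tau> * z * card A"
  proof -
    have "z * card A * (\<tau> * (B + 1)) < z * card A * (K - 1)" using assms by (intro mult_strict_left_mono) auto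
    then show ?thesis by (simp add: algebra_simps)
  qed
  ultimately show ?thesis by linarith
qed

text \<open>Up to a positive factor, \<open>exp \<circ> whittle_R\<close> is a nonnegative combination of exponentials of \<open>d\<close>,
  hence convex, so that comparing \<open>1\<close> with \<open>1 \<plusminus> h\<close> locates every minimizer.\<close>

lemma arg_min_whittle_close:
  fixes x :: "nat \<Rightarrow> real"
  defines "W \<equiv> \<lambda>n j. (fourier_freq n j)\<^sup>2 * periodogram x n (fourier_freq n j)"
  assumes "is_arg_min (whittle_R x n m) (\<lambda>d. d \<in> {\<Delta>\<^sub>1..\<Delta>\<^sub>2}) dh"
    and "1 \<in> {\<Delta>\<^sub>1..\<Delta>\<^sub>2}" "n > 0" "m > 0" "h > 0"
    and up: "(\<Sum>j=1..m. W n j) < (\<Sum>j=1..m. W n j * exp (2 * h * centred_ln m j))"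
    and dn: "(\<Sum>j=1..m. W n j) < (\<Sum>j=1..m. W n j * exp (- 2 * h * centred_ln m j))"
  shows "\<bar>dh - 1\<bar> \<le> h"
proof -
  define Q where "Q d = (\<Sum>j=1..m. W n j * exp (2 * (d - 1) * centred_ln m j))" for d
  have Wnn: "W n j \<ge> 0" for j by (simp add: W_def periodogram_def)
  \<comment> \<open>The strict inequality excludes vanishing ordinates, so the convention
    \<open>ln 0 = 0\<close> never comes into play.\<close>
  have ex: "\<exists>j\<in>{1..m}. W n j > 0"
  proof (rule ccontr)
    assume "\<not> ?thesis"
    then have "\<And>j. j \<in> {1..m} \<Longrightarrow> W n j = 0" using Wnn by (metis less_eq_real_def)
    then show False using up by simp
  qed
  have Qpos: "Q d > 0" for d
    using ex Wnn by (auto simp: Q_def intro!: sum_pos2)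
  define lbar where "lbar = (1 / real m) * (\<Sum>j=1..m. ln (fourier_freq n j))"
  have lam: "fourier_freq n j > 0" if "j \<in> {1..m}" for j
    using that assms(4) by (simp add: fourier_freq_def)
  have lnf: "ln (fourier_freq n j) = ln (2 * pi / real n) + ln (real j)" if "j \<in> {1..m}" for j
    using that assms(4) by (simp add: fourier_freq_def ln_mult ln_div)
  have x: "ln (fourier_freq n j) - lbar = centred_ln m j" if "j \<in> {1..m}" for j
    using that assms(5) by (simp add: lbar_def centred_ln_def lnf sum.distrib distrib_left)
  have G: "G_hat x n m d = (1 / real m) * (exp (2 * (d - 1) * lbar) * Q d)" for d
  proof -
    have "fourier_freq n j powr (2 * d) * periodogram x n (fourier_freq n j) =
        exp (2 * (d - 1) * lbar) * (W n j * exp (2 * (d - 1) * centred_ln m j))" if j: "j \<in> {1..m}" for j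
    proof -
      have "fourier_freq n j powr (2 * d) = fourier_freq n j powr (2 + 2 * (d - 1))" by (simp add: algebra_simps)
      also have "\<dots> = (fourier_freq n j)\<^sup>2 * fourier_freq n j powr (2 * (d - 1))"
        using lam[OF j] by (simp only: powr_add powr_numeral)
      also have "fourier_freq n j powr (2 * (d - 1)) = exp (2 * (d - 1) * lbar) * exp (2 * (d - 1) * centred_ln m j)"
      proof -
        have "ln (fourier_freq n j) = lbar + centred_ln m j" using x[OF j] by linarith
        then show ?thesis using lam[OF j] by (simp add: powr_def exp_add[symmetric] distrib_left)
      qed
      finally show ?thesis by (simp only: W_def mult_ac)
    qed
    then show ?thesis unfolding G_hat_def Q_def by (simp add: sum_distrib_left)
  qed
  \<comment> \<open>The factor containing \<open>lbar\<close> cancels the linear term of the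
    criterion: what remains besides \<open>ln (Q d)\<close> does not depend on
    \<open>d\<close>.\<close>
  have R: "whittle_R x n m d = ln (Q d) - ln (real m) - 2 * lbar" for d
    using Qpos[of d] assms(5) unfolding whittle_R_def G lbar_def[symmetric]
    by (simp add: ln_mult ln_div algebra_simps)
  have "dh \<in> {\<Delta>\<^sub>1..\<Delta>\<^sub>2}" "\<not> whittle_R x n m 1 < whittle_R x n m dh"
    using assms(2,3) by (auto simp: is_arg_min_def)
  then have le: "Q dh \<le> Q 1" using Qpos by (simp add: R)
  have up': "Q 1 < Q (1 + h)" "Q 1 < Q (1 - h)" using up dn by (simp_all add: Q_def)
  have conv: "Q ((1 - t) * a + t * b) \<le> (1 - t) * Q a + t * Q b" if "0 \<le> t" "t \<le> 1" for t a b
  proof -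
    have "exp (2 * (((1 - t) * a + t * b) - 1) * y) \<le>
        (1 - t) * exp (2 * (a - 1) * y) + t * exp (2 * (b - 1) * y)" for y :: real
    proof -
      have "2 * (((1 - t) * a + t * b) - 1) * y = (1 - t) * (2 * (a - 1) * y) + t * (2 * (b - 1) * y)"
        by (simp add: algebra_simps)
      then show ?thesis
        using convex_onD[OF exp_convex, of t "2 * (a - 1) * y" "2 * (b - 1) * y"] that by simp
    qed
    then have "Q ((1 - t) * a + t * b) \<le>
        (\<Sum>j=1..m. W n j * ((1 - t) * exp (2 * (a - 1) * centred_ln m j) + t * exp (2 * (b - 1) * centred_ln m j)))"
      unfolding Q_def using Wnn by (intro sum_mono mult_left_mono) auto
    also have "\<dots> = (1 - t) * Q a + t * Q b"
      unfolding Q_def sum_distrib_left sum.distrib[symmetric]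
      by (intro sum.cong refl) (simp add: algebra_simps)
    finally show ?thesis .
  qed
  \<comment> \<open>If the minimizer lay beyond \<open>1 + \<sigma> * h\<close> as seen from 1, that
    point would be a convex combination of 1 and \<open>dh\<close>, and \<open>Q\<close> is at most
    \<open>Q 1\<close> at both. The signs \<open>\<sigma> = 1\<close> and
    \<open>\<sigma> = -1\<close> treat the two sides.\<close>
  have key: False if "Q (1 + \<sigma> * h) > Q 1" "\<sigma> * (dh - 1) > h" "\<sigma> = 1 \<or> \<sigma> = -1" for \<sigma>
  proof -
    define t where "t = h / (\<sigma> * (dh - 1))"
    have t: "0 \<le> t" "t \<le> 1" using that(2) assms(6) by (simp_all add: t_def)
    have eq: "1 + \<sigma> * h = (1 - t) * 1 + t * dh"
    proof -
      have "t * (\<sigma> * (dh - 1)) = h" proof -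
        have "\<sigma> * (dh - 1) \<noteq> 0" using that(2) assms(6) by linarith
        then show ?thesis unfolding t_def by (metis times_divide_eq_left nonzero_mult_div_cancel_right)
      qed
      then have "\<sigma> * h = (\<sigma> * \<sigma>) * t * (dh - 1)" by (simp add: algebra_simps)
      moreover have "\<sigma> * \<sigma> = 1" using that(3) by auto
      ultimately show ?thesis by (simp add: algebra_simps)
    qed
    have "Q (1 + \<sigma> * h) \<le> (1 - t) * Q 1 + t * Q dh" using conv[OF t, of 1 dh] unfolding eq .
    also have "\<dots> \<le> (1 - t) * Q 1 + t * Q 1" using le t by (intro add_mono mult_left_mono) auto
    also have "\<dots> = Q 1" by (simp add: algebra_simps)
    finally show False using that(1) by linarith
  qed
  show ?thesis
  proof (rule ccontr)
    assume "\<not> \<bar>dh - 1\<bar> \<le> h"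
    then have "1 * (dh - 1) > h \<or> - 1 * (dh - 1) > h" by auto
    then consider "1 * (dh - 1) > h" | "- 1 * (dh - 1) > h" by blast
    then show False
    proof cases
      case 1
      show False by (rule key[OF _ 1]) (use up' in simp_all)
    next
      case 2
      show False by (rule key[OF _ 2]) (use up' in simp_all)
    qed
  qed
qed


section \<open>Fractional coefficients\<close>

text \<open>Power series coefficients of \<open>(1 - x) powr (- d)\<close>; the model sums the noise
  against those of order \<open>d\<^sub>0\<close>.\<close>

definition frac_coeff :: "real \<Rightarrow> nat \<Rightarrow> real" where
  "frac_coeff d k = pochhammer d k / fact k"

lemma frac_coeff_0 [simp]: "frac_coeff d 0 = 1"
  by (simp add: frac_coeff_def)

lemma frac_coeff_pos: "d > 0 \<Longrightarrow> frac_coeff d k > 0"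
  by (simp add: frac_coeff_def pochhammer_pos)

text \<open>Multiplication of the generating function \<open>(1 - x) powr (- (d + 1))\<close> by
  \<open>1 - x\<close>: differencing lowers the order by one.\<close>

lemma frac_coeff_Suc_diff: "frac_coeff (d + 1) (Suc k) - frac_coeff (d + 1) k = frac_coeff d (Suc k)"
proof -
  have "pochhammer (d + 1) (Suc k) = (d + 1 + real k) * pochhammer (d + 1) k"
    by (simp add: pochhammer_Suc mult.commute)
  moreover have "pochhammer d (Suc k) = d * pochhammer (d + 1) k" by (simp add: pochhammer_rec)
  ultimately have "pochhammer (d + 1) (Suc k) - real (Suc k) * pochhammer (d + 1) k = pochhammer d (Suc k)"
    by (simp add: algebra_simps)
  moreover have "frac_coeff (d + 1) k = real (Suc k) * pochhammer (d + 1) k / fact (Suc k)"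
    by (simp add: frac_coeff_def del: of_nat_Suc)
  ultimately show ?thesis by (simp only: frac_coeff_def[of _ "Suc k"] diff_divide_distrib[symmetric])
qed

lemma sum_frac_coeff: "(\<Sum>k\<le>N. frac_coeff d k) = frac_coeff (d + 1) N"
  by (induction N) (use frac_coeff_Suc_diff[of d] in \<open>auto simp: algebra_simps\<close>)

lemma frac_coeff_mono: "d > 0 \<Longrightarrow> j \<le> k \<Longrightarrow> frac_coeff (d + 1) j \<le> frac_coeff (d + 1) k"
  unfolding sum_frac_coeff[symmetric] by (intro sum_mono2) (auto intro: less_imp_le frac_coeff_pos)

text \<open>Euler's limit formula for the Gamma function, inverted: \<open>Gamma_series'\<close> is
  \<open>k powr d * fact (k - 1)\<close> over the Pochhammer symbol.\<close>

lemma frac_coeff_asymp: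
  assumes "d > 0"
  shows "(\<lambda>k. frac_coeff d k / real k powr (d - 1)) \<longlonglongrightarrow> 1 / Gamma d"
proof -
  have "(\<lambda>k. 1 / Gamma_series' d k) \<longlonglongrightarrow> 1 / Gamma d"
    using assms by (intro tendsto_intros Gamma_series'_LIMSEQ) (auto simp: Gamma_real_pos less_imp_neq[symmetric])
  moreover have "\<forall>\<^sub>F k in sequentially. 1 / Gamma_series' d k = frac_coeff d k / real k powr (d - 1)"
    using eventually_gt_at_top[of 0]
  proof eventually_elim
    case (elim k)
    have "(fact k :: real) = real k * fact (k - 1)" using elim by (simp add: fact_reduce)
    moreover have "real k powr (d - 1) = exp (d * ln (real k)) / real k"
      using elim by (simp add: powr_def exp_diff left_diff_distrib)
    ultimately show ?case using elim by (simp add: Gamma_series'_def frac_coeff_def field_simps)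
  qed
  ultimately show ?thesis by (rule Lim_transform_eventually)
qed

lemma frac_coeff_bounds:
  assumes "d > 0"
  shows "\<exists>c>0. \<exists>C>0. \<forall>k\<ge>1. c * real k powr (d - 1) \<le> frac_coeff d k \<and> frac_coeff d k \<le> C * real k powr (d - 1)"
proof -
  \<comment> \<open>Shifting to \<open>Suc k\<close> removes \<open>k = 0\<close>, where the power
    is 0 by convention. The ratios are then positive with positive limit, so they and their
    reciprocals are bounded.\<close>
  define r where "r k = frac_coeff d (Suc k) / real (Suc k) powr (d - 1)" for k
  have rp: "r k > 0" for k using assms by (simp add: r_def frac_coeff_pos)
  have lim: "r \<longlonglongrightarrow> 1 / Gamma d" unfolding r_def using LIMSEQ_Suc[OF frac_coeff_asymp[OF assms]] by simp
  have "Bseq r" using lim convergentI convergent_imp_Bseq by blast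
  then obtain C where C: "C > 0" "\<And>k. \<bar>r k\<bar> \<le> C" by (auto simp: Bseq_def)
  have "(\<lambda>k. inverse (r k)) \<longlonglongrightarrow> inverse (1 / Gamma d)"
    using assms by (intro tendsto_inverse lim) (auto simp: Gamma_real_pos less_imp_neq[symmetric])
  then have "Bseq (\<lambda>k. inverse (r k))" using convergentI convergent_imp_Bseq by blast
  then obtain D where D: "D > 0" "\<And>k. \<bar>inverse (r k)\<bar> \<le> D" by (auto simp: Bseq_def)
  have "(1 / D) * real k powr (d - 1) \<le> frac_coeff d k \<and> frac_coeff d k \<le> C * real k powr (d - 1)" if k1: "k \<ge> 1" for k
  proof -
    obtain i where k: "k = Suc i" using k1 by (cases k) auto
    have p: "real k powr (d - 1) > 0" using that by simp
    have "1 / D \<le> r i" using D(2)[of i] rp[of i] D(1) by (simp add: field_simps)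
    moreover have "r i \<le> C" using C(2)[of i] by simp
    ultimately show ?thesis using p unfolding r_def k[symmetric] by (simp add: field_simps)
  qed
  then show ?thesis using C(1) D(1) by (intro exI[of _ "1 / D"] conjI exI[of _ C]) auto
qed


section \<open>Second moments and the spectral density\<close>

lemma integrable_cis_mult:
  assumes "integrable M (F :: 'b \<Rightarrow> real)" "h \<in> borel_measurable M"
  shows "integrable M (\<lambda>x. complex_of_real (F x) * cis (h x))"
proof (rule Bochner_Integration.integrable_bound[OF assms(1)])
  have "(\<lambda>x. cis (h x)) \<in> borel_measurable M"
    using assms by (simp add: cis_conv_exp)
  then show "(\<lambda>x. complex_of_real (F x) * cis (h x)) \<in> borel_measurable M"
    using assms by measurable
qed (simp add: norm_mult)

lemma integral_cis_mult:
  assumes "integrable M (F :: 'b \<Rightarrow> real)" "h \<in> borel_measurable M"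
  shows "(LINT x|M. complex_of_real (F x) * cis (h x)) =
    Complex (LINT x|M. F x * cos (h x)) (LINT x|M. F x * sin (h x))"
  using integrable_cis_mult[OF assms]
  by (simp add: complex_eq_iff integral_Re[symmetric] integral_Im[symmetric] del: integral_Re integral_Im)

lemma integrable_bounded_mult:
  fixes F g :: "'b \<Rightarrow> real"
  assumes "integrable M F" "g \<in> borel_measurable M" "\<And>x. \<bar>g x\<bar> \<le> C"
  shows "integrable M (\<lambda>x. F x * g x)"
proof (rule Bochner_Integration.integrable_bound)
  show "integrable M (\<lambda>x. C * F x)" using assms by simp
  have "\<bar>F x\<bar> * \<bar>g x\<bar> \<le> \<bar>C\<bar> * \<bar>F x\<bar>" for x
  proof -
    have "\<bar>g x\<bar> \<le> \<bar>C\<bar>" using assms(3)[of x] by linarith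
    from mult_left_mono[OF this, of "\<bar>F x\<bar>"] show ?thesis by (simp add: mult.commute)
  qed
  then show "AE x in M. norm (F x * g x) \<le> norm (C * F x)" by (simp add: abs_mult)
qed (use assms in measurable)

text \<open>The restriction to the band [-pi, pi] is absorbed into \<open>F\<close>, which lives on
  the whole line, so that reflection and even extension act directly on it.\<close>

definition spectral_weight :: "'a measure \<Rightarrow> (int \<Rightarrow> 'a \<Rightarrow> real) \<Rightarrow> (real \<Rightarrow> real) \<Rightarrow> bool" where
  "spectral_weight P u F \<longleftrightarrow> integrable lborel F \<and> (\<forall>s\<ge>1. \<forall>t\<ge>1.
     complex_of_real (LINT \<omega>|P. u s \<omega> * u t \<omega>) =
       (LINT \<theta>|lborel. complex_of_real (F \<theta>) * cis (of_int (s - t) * \<theta>)))"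

lemma spectral_weight_density:
  assumes "has_spectral_density P u f"
  shows "spectral_weight P u (\<lambda>\<theta>. indicator {-pi..pi} \<theta> * f \<theta>)"
  using assms
  by (auto simp: spectral_weight_def has_spectral_density_def set_integrable_def
      set_lebesgue_integral_def scaleR_conv_of_real mult.assoc)

text \<open>Since the autocovariances are real, every odd trigonometric polynomial integrates to zero
  against the weight; \<open>sin \<theta> * p (cos \<theta>)\<close> approximates \<open>sgn \<theta>\<close> boundedly, so the weight may be
  replaced by its even extension from the positive half-line.\<close>

lemma spectral_weight_symmetrize:
  assumes w: "spectral_weight P u F" and supp: "\<And>\<theta>. \<theta> \<notin> {-pi..pi} \<Longrightarrow> F \<theta> = 0"
  shows "spectral_weight P u (\<lambda>\<theta>. F \<bar>\<theta>\<bar>)"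
proof -
  let ?S = "\<lambda>(h :: int) i \<theta>. F \<theta> * (sin (of_int h * \<theta>) * cos \<theta> ^ i)"
  have F: "integrable lborel F" using w by (simp add: spectral_weight_def)
  then have [measurable]: "F \<in> borel_measurable borel" by simp
  note ib = integrable_bounded_mult[OF F]
  have cis_split: "(LINT \<theta>|lborel. complex_of_real (G \<theta>) * cis (a * \<theta>)) =
      Complex (LINT \<theta>|lborel. G \<theta> * cos (a * \<theta>)) (LINT \<theta>|lborel. G \<theta> * sin (a * \<theta>))"
    if "integrable lborel G" for G :: "real \<Rightarrow> real" and a
    by (rule integral_cis_mult[OF that]) measurable
  have sin0: "(LINT \<theta>|lborel. F \<theta> * sin (of_int h * \<theta>)) = 0" for h :: int
  proof -
    \<comment> \<open>The spectral formula is available for times at least 1; this \<open>s\<close>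
      makes both \<open>s\<close> and \<open>s - h\<close> admissible, also for negative
      \<open>h\<close>.\<close>
    define s where "s = max 1 (1 + h)"
    have "s \<ge> 1" "s - h \<ge> 1" by (auto simp: s_def)
    then have "complex_of_real (LINT \<omega>|P. u s \<omega> * u (s - h) \<omega>) =
       (LINT \<theta>|lborel. complex_of_real (F \<theta>) * cis (of_int (s - (s - h)) * \<theta>))"
      using w unfolding spectral_weight_def by blast
    from arg_cong[OF this, of Im] show ?thesis by (simp add: cis_split[OF F])
  qed
  have intS: "integrable lborel (\<lambda>\<theta>. F \<theta> * (sin (a * \<theta>) * cos \<theta> ^ i))" for a i
  proof (rule ib[of _ 1])
    fix \<theta> :: real
    have "\<bar>sin (a * \<theta>)\<bar> * \<bar>cos \<theta>\<bar> ^ i \<le> 1 * 1"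
      by (intro mult_mono power_le_one) auto
    then show "\<bar>sin (a * \<theta>) * cos \<theta> ^ i\<bar> \<le> 1" by (simp add: abs_mult power_abs)
  qed measurable
  \<comment> \<open>Product-to-sum formula: each factor \<open>cos \<theta>\<close> replaces
    \<open>h\<close> by \<open>h + 1\<close> and \<open>h - 1\<close>, hence the generalisation over
    \<open>h\<close>.\<close>
  have sincos: "(LINT \<theta>|lborel. F \<theta> * (sin (of_int h * \<theta>) * cos \<theta> ^ i)) = 0" for h :: int and i
  proof (induction i arbitrary: h)
    case (Suc i)
    have "sin (of_int h * \<theta>) * cos \<theta> ^ Suc i =
        (1/2) * (sin (of_int (h + 1) * \<theta>) * cos \<theta> ^ i) + (1/2) * (sin (of_int (h - 1) * \<theta>) * cos \<theta> ^ i)" for \<theta> :: real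
    proof -
      have "sin (of_int h * \<theta>) * cos \<theta> = (sin (of_int (h + 1) * \<theta>) + sin (of_int (h - 1) * \<theta>)) / 2"
        by (simp add: distrib_right left_diff_distrib sin_add sin_diff)
      moreover have "sin (of_int h * \<theta>) * cos \<theta> ^ Suc i = (sin (of_int h * \<theta>) * cos \<theta>) * cos \<theta> ^ i" by simp
      ultimately show ?thesis by (simp add: add_divide_distrib distrib_right)
    qed
    then have "(LINT \<theta>|lborel. F \<theta> * (sin (of_int h * \<theta>) * cos \<theta> ^ Suc i)) =
       (LINT \<theta>|lborel. (1/2) * (?S (h + 1) i \<theta>) +
          (1/2) * (?S (h - 1) i \<theta>))"
      by (intro Bochner_Integration.integral_cong refl) (simp only: distrib_left mult.left_commute)
    also have "\<dots> = 0"
      by (subst Bochner_Integration.integral_add)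
         (simp_all only: integrable_mult_right intS integral_mult_right_zero Suc.IH mult_zero_right add_0)
    finally show ?case .
  qed (simp add: sin0)
  have poly0: "(LINT \<theta>|lborel. F \<theta> * (sin \<theta> * p (cos \<theta>) * cos (of_int h * \<theta>))) = 0"
    if pp: "real_polynomial_function p" for p and h :: int
  proof -
    obtain a n where p: "p = (\<lambda>x. \<Sum>i\<le>n. a i * x ^ i)"
      using pp by (auto simp: real_polynomial_function_iff_sum)
    have pc: "sin \<theta> * cos (of_int h * \<theta>) = (sin (of_int (h + 1) * \<theta>) - sin (of_int (h - 1) * \<theta>)) / 2" for \<theta> :: real
      by (simp add: distrib_right left_diff_distrib sin_add sin_diff)
    have "F \<theta> * (sin \<theta> * p (cos \<theta>) * cos (of_int h * \<theta>)) =
        (\<Sum>i\<le>n. (a i / 2) * (?S (h + 1) i \<theta>) -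
                (a i / 2) * (?S (h - 1) i \<theta>))" for \<theta>
    proof -
      have "F \<theta> * (sin \<theta> * p (cos \<theta>) * cos (of_int h * \<theta>)) = (\<Sum>i\<le>n. F \<theta> * (a i * cos \<theta> ^ i) * (sin \<theta> * cos (of_int h * \<theta>)))"
        by (simp add: p sum_distrib_left sum_distrib_right mult_ac)
      also have "\<dots> = (\<Sum>i\<le>n. (a i / 2) * (?S (h + 1) i \<theta>) -
                (a i / 2) * (?S (h - 1) i \<theta>))"
        by (intro sum.cong refl, simp only: pc) (simp add: field_simps)
      finally show ?thesis .
    qed
    then have "(LINT \<theta>|lborel. F \<theta> * (sin \<theta> * p (cos \<theta>) * cos (of_int h * \<theta>))) =
       (LINT \<theta>|lborel. (\<Sum>i\<le>n. (a i / 2) * (?S (h + 1) i \<theta>) -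
                (a i / 2) * (?S (h - 1) i \<theta>)))"
      by (simp only:)
    also have "\<dots> = (\<Sum>i\<le>n. 0)"
      by (subst Bochner_Integration.integral_sum)
         (simp_all only: integrable_mult_right intS Bochner_Integration.integrable_diff
            Bochner_Integration.integral_diff integral_mult_right_zero sincos mult_zero_right diff_self)
    finally show ?thesis by simp
  qed
  have sgn0: "(LINT \<theta>|lborel. F \<theta> * (sgn \<theta> * cos (of_int h * \<theta>))) = 0" for h :: int
  proof -
    \<comment> \<open>With \<open>y = cos \<theta>\<close> the square root is
      \<open>\<bar>sin \<theta>\<bar>\<close>, so \<open>sin \<theta> * q k (cos \<theta>)\<close>
      is the sign of \<open>sin \<theta>\<close> except where the sine is small. The cutoff keeps
      \<open>q k\<close> continuous, as Weierstrass approximation requires.\<close>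
    define q where "q k y = 1 / max (sqrt (1 - y\<^sup>2)) (1 / real (Suc k))" for k and y :: real
    have "\<exists>p. real_polynomial_function p \<and> (\<forall>y\<in>{-1..1}. \<bar>q k y - p y\<bar> < 1 / real (Suc k))" for k
    proof -
      have "max (sqrt (1 - y\<^sup>2)) (1 / real (Suc k)) > 0" for y :: real by (simp add: less_max_iff_disj)
      then have "max (sqrt (1 - y\<^sup>2)) (1 / real (Suc k)) \<noteq> 0" for y :: real by (metis less_irrefl)
      then have "continuous_on {-1..1} (q k)" unfolding q_def by (intro continuous_intros) auto
      from Stone_Weierstrass_real_polynomial_function[OF compact_Icc this, of "1 / real (Suc k)"]
      show ?thesis by (metis of_nat_0_less_iff zero_less_Suc zero_less_divide_1_iff)
    qed
    then obtain p where p: "\<And>k. real_polynomial_function (p k)"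
      "\<And>k y. y \<in> {-1..1} \<Longrightarrow> \<bar>q k y - p k y\<bar> < 1 / real (Suc k)" by metis
    let ?m = "\<lambda>k \<theta>. max \<bar>sin \<theta>\<bar> (1 / real (Suc k))"
    define T where "T k \<theta> = sin \<theta> * p k (cos \<theta>)" for k \<theta>
    have [measurable]: "p k \<in> borel_measurable borel" for k
      using p(1)[of k] by (auto simp: real_polynomial_function_iff_sum)
    have T: "\<bar>T k \<theta> - sin \<theta> / ?m k \<theta>\<bar> \<le> 1 / real (Suc k)" for k \<theta>
    proof -
      have "q k (cos \<theta>) = 1 / ?m k \<theta>"
        by (simp add: q_def sin_squared_eq[symmetric])
      then have "T k \<theta> - sin \<theta> / ?m k \<theta> = sin \<theta> * (p k (cos \<theta>) - q k (cos \<theta>))"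
        by (simp add: T_def right_diff_distrib)
      moreover have "\<bar>p k (cos \<theta>) - q k (cos \<theta>)\<bar> \<le> 1 / real (Suc k)"
        using p(2)[of "cos \<theta>" k] by (simp add: abs_minus_commute less_imp_le)
      ultimately show ?thesis
        by (simp only: abs_mult) (metis abs_ge_zero abs_sin_le_one mult_left_le_one_le order.trans)
    qed
    have T2: "\<bar>T k \<theta>\<bar> \<le> 2" for k \<theta>
    proof -
      have "?m k \<theta> > 0" by (simp add: less_max_iff_disj)
      then have "\<bar>sin \<theta> / ?m k \<theta>\<bar> \<le> 1" by (simp add: abs_divide)
      moreover have "1 / real (Suc k) \<le> 1" by simp
      ultimately show ?thesis using T[of k \<theta>] by linarith
    qed
    have Tlim: "(\<lambda>k. T k \<theta>) \<longlonglongrightarrow> sgn \<theta>" if th: "- pi < \<theta>" "\<theta> < pi" "\<theta> \<noteq> 0" for \<theta>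
    proof -
      have s: "sgn (sin \<theta>) = sgn \<theta>" "sin \<theta> \<noteq> 0"
        using th sin_gt_zero[of \<theta>] sin_gt_zero[of "-\<theta>"] by (cases "\<theta> > 0"; force simp: sgn_if)+
      have l0: "(\<lambda>k. 1 / real (Suc k)) \<longlonglongrightarrow> 0" using LIMSEQ_Suc[OF lim_1_over_n] by simp
      have "(\<lambda>k. sin \<theta> / ?m k \<theta>) \<longlonglongrightarrow> sin \<theta> / max \<bar>sin \<theta>\<bar> 0"
        using s by (intro tendsto_intros l0) auto
      moreover have "(\<lambda>k. T k \<theta> - sin \<theta> / ?m k \<theta>) \<longlonglongrightarrow> 0"
        by (rule Lim_null_comparison[OF _ l0]) (use T in simp)
      ultimately have "(\<lambda>k. (T k \<theta> - sin \<theta> / ?m k \<theta>) + sin \<theta> / ?m k \<theta>) \<longlonglongrightarrow> 0 + sin \<theta> / max \<bar>sin \<theta>\<bar> 0"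
        by (intro tendsto_add)
      then show ?thesis using s by (simp add: sgn_real_def abs_real_def split: if_splits)
    qed
    have "(\<lambda>k. LINT \<theta>|lborel. F \<theta> * (T k \<theta> * cos (of_int h * \<theta>))) \<longlonglongrightarrow> (LINT \<theta>|lborel. F \<theta> * (sgn \<theta> * cos (of_int h * \<theta>)))"
    proof (rule integral_dominated_convergence[where w = "\<lambda>\<theta>. 2 * \<bar>F \<theta>\<bar>"])
      show "integrable lborel (\<lambda>\<theta>. 2 * \<bar>F \<theta>\<bar>)" using F by simp
      have "AE \<theta> in lborel. \<theta> \<notin> {-pi, 0, pi}"
        by (rule AE_not_in) (auto intro!: finite_imp_null_set_lborel)
      then show "AE \<theta> in lborel. (\<lambda>k. F \<theta> * (T k \<theta> * cos (of_int h * \<theta>))) \<longlonglongrightarrow> F \<theta> * (sgn \<theta> * cos (of_int h * \<theta>))"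
      proof eventually_elim
        case (elim \<theta>)
        show ?case
        proof (cases "\<theta> \<in> {-pi..pi}")
          case True
          then show ?thesis using elim by (intro tendsto_intros Tlim) auto
        qed (simp add: supp)
      qed
      show "AE \<theta> in lborel. norm (F \<theta> * (T k \<theta> * cos (of_int h * \<theta>))) \<le> 2 * \<bar>F \<theta>\<bar>" for k
      proof (rule AE_I2)
        fix \<theta> :: real
        have "\<bar>T k \<theta>\<bar> * \<bar>cos (of_int h * \<theta>)\<bar> \<le> 2 * 1" by (intro mult_mono T2) auto
        from mult_left_mono[OF this, of "\<bar>F \<theta>\<bar>"]
        show "norm (F \<theta> * (T k \<theta> * cos (of_int h * \<theta>))) \<le> 2 * \<bar>F \<theta>\<bar>" by (simp add: abs_mult mult.commute)
      qed
    qed (auto simp: T_def)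
    moreover have "(LINT \<theta>|lborel. F \<theta> * (T k \<theta> * cos (of_int h * \<theta>))) = 0" for k
      unfolding T_def by (rule poly0[OF p(1)])
    ultimately show ?thesis by (simp add: LIMSEQ_const_iff)
  qed
  have refl_int: "integrable lborel g \<Longrightarrow> integrable lborel (\<lambda>\<theta>. g (- \<theta>))"
     "(LINT \<theta>|lborel. g (- \<theta>)) = (LINT \<theta>|lborel. g \<theta>)" for g :: "real \<Rightarrow> real"
    using lborel_integrable_real_affine[of g "-1" 0] lborel_integral_real_affine[of "-1" g 0] by auto
  define pos where "pos = (\<lambda>\<theta>::real. indicator {0<..} \<theta> :: real)"
  have [measurable]: "pos \<in> borel_measurable borel" by (simp add: pos_def)
  have posb: "\<bar>pos \<theta> * x\<bar> \<le> 1" if "\<bar>x\<bar> \<le> 1" for \<theta> x using that by (simp add: pos_def indicator_def)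
  have ne0: "AE \<theta> in lborel. \<theta> \<noteq> (0::real)" by (rule AE_lborel_singleton)
  have intp: "integrable lborel (\<lambda>\<theta>. F \<theta> * (pos \<theta> * cos (a * \<theta>)))" "integrable lborel (\<lambda>\<theta>. F \<theta> * (pos \<theta> * sin (a * \<theta>)))"
     "integrable lborel (\<lambda>\<theta>. F \<theta> * pos \<theta>)" for a
    by (auto intro!: ib[of _ 1] posb simp: pos_def indicator_def)
  have even: "integrable lborel (\<lambda>\<theta>. F \<bar>\<theta>\<bar>)"
  proof -
    have "integrable lborel (\<lambda>\<theta>. F \<theta> * pos \<theta> + F (- \<theta>) * pos (- \<theta>))"
      by (intro Bochner_Integration.integrable_add intp refl_int(1)[OF intp(3)])
    then show ?thesis
      by (rule integrable_cong_AE_imp)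
         (measurable, rule eventually_mono[OF ne0], auto simp: pos_def indicator_def abs_if)
  qed
  show ?thesis unfolding spectral_weight_def
  proof (intro conjI allI impI even)
    fix s t :: int assume st: "s \<ge> 1" "t \<ge> 1"
    define h where "h = s - t"
    \<comment> \<open>Even extension doubles the integral over the positive axis, and doubling the
      positive part amounts to the factor \<open>1 + sgn \<theta>\<close>; the sign part integrates
      to zero by \<open>sgn0\<close>.\<close>
    have "(LINT \<theta>|lborel. F \<bar>\<theta>\<bar> * cos (of_int h * \<theta>)) =
       (LINT \<theta>|lborel. F \<theta> * (pos \<theta> * cos (of_int h * \<theta>)) + F (-\<theta>) * (pos (-\<theta>) * cos (of_int h * (-\<theta>))))"
      by (rule integral_cong_AE)
         (measurable, rule eventually_mono[OF ne0], auto simp: pos_def indicator_def abs_if)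
    also have "\<dots> = (LINT \<theta>|lborel. F \<theta> * (pos \<theta> * cos (of_int h * \<theta>))) +
        (LINT \<theta>|lborel. F (-\<theta>) * (pos (-\<theta>) * cos (of_int h * (-\<theta>))))"
      by (intro Bochner_Integration.integral_add intp refl_int(1)[OF intp(1)])
    also have "\<dots> = (LINT \<theta>|lborel. F \<theta> * (pos \<theta> * cos (of_int h * \<theta>))) + (LINT \<theta>|lborel. F \<theta> * (pos \<theta> * cos (of_int h * \<theta>)))"
      by (subst refl_int(2)[of "\<lambda>\<theta>. F \<theta> * (pos \<theta> * cos (of_int h * \<theta>))"]) simp
    also have "\<dots> = (LINT \<theta>|lborel. F \<theta> * (pos \<theta> * cos (of_int h * \<theta>)) + F \<theta> * (pos \<theta> * cos (of_int h * \<theta>)))"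
      by (intro Bochner_Integration.integral_add[symmetric] intp)
    also have "\<dots> = (LINT \<theta>|lborel. F \<theta> * cos (of_int h * \<theta>) + F \<theta> * (sgn \<theta> * cos (of_int h * \<theta>)))"
      by (rule integral_cong_AE)
         (measurable, rule eventually_mono[OF ne0], auto simp: pos_def indicator_def sgn_if)
    also have "\<dots> = (LINT \<theta>|lborel. F \<theta> * cos (of_int h * \<theta>)) + (LINT \<theta>|lborel. F \<theta> * (sgn \<theta> * cos (of_int h * \<theta>)))"
      by (intro Bochner_Integration.integral_add ib[of _ 1]) (auto simp: sgn_if abs_mult)
    finally have c: "(LINT \<theta>|lborel. F \<bar>\<theta>\<bar> * cos (of_int h * \<theta>)) = (LINT \<theta>|lborel. F \<theta> * cos (of_int h * \<theta>))"
      by (simp add: sgn0)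
    have "(LINT \<theta>|lborel. F \<bar>\<theta>\<bar> * sin (of_int h * \<theta>)) = - (LINT \<theta>|lborel. F \<bar>\<theta>\<bar> * sin (of_int h * \<theta>))"
      using refl_int(2)[of "\<lambda>\<theta>. F \<bar>\<theta>\<bar> * sin (of_int h * \<theta>)"] by simp
    then have "(LINT \<theta>|lborel. F \<bar>\<theta>\<bar> * sin (of_int h * \<theta>)) = (LINT \<theta>|lborel. F \<theta> * sin (of_int h * \<theta>))"
      by (simp add: sin0)
    then show "complex_of_real (LINT \<omega>|P. u s \<omega> * u t \<omega>) =
       (LINT \<theta>|lborel. complex_of_real (F \<bar>\<theta>\<bar>) * cis (of_int (s - t) * \<theta>))"
      using w st c unfolding spectral_weight_def cis_split[OF even] cis_split[OF F] h_def by simp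
  qed
qed

lemma integral_cis_period:
  "(LINT \<theta>|lborel. complex_of_real (indicator {-pi..pi} \<theta>) * cis (of_int h * \<theta>)) = (if h = 0 then 2 * pi else 0)"
proof -
  have "((\<lambda>\<theta>. cis (of_int h * \<theta>)) has_integral (if h = 0 then 2 * pi else 0)) {-pi..pi}"
  proof (cases "h = 0")
    case True
    then show ?thesis using has_integral_const_real[of "1::complex" "-pi" pi] by (simp add: scaleR_conv_of_real)
  next
    case False
    define G where "G \<theta> = Complex (sin (of_int h * \<theta>) / of_int h) (- cos (of_int h * \<theta>) / of_int h)" for \<theta> :: real
    have "((\<lambda>\<theta>. cis (of_int h * \<theta>)) has_integral (G pi - G (-pi))) {-pi..pi}"
    proof (rule fundamental_theorem_of_calculus)
      fix x :: real
      show "(G has_vector_derivative cis (of_int h * x)) (at x within {-pi..pi})"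
        unfolding has_vector_derivative_complex_iff G_def using False
        by (auto intro!: derivative_eq_intros)
    qed simp
    moreover have "G pi - G (-pi) = 0" by (simp add: G_def complex_eq_iff sin_times_pi_eq_0)
    ultimately show ?thesis using False by simp
  qed
  moreover have "set_integrable lborel {-pi..pi} (\<lambda>\<theta>. cis (of_int h * \<theta>))"
    by (rule borel_integrable_atLeastAtMost') (auto intro!: continuous_intros simp: cis_conv_exp)
  ultimately have "(LINT \<theta>:{-pi..pi}|lborel. cis (of_int h * \<theta>)) = (if h = 0 then 2 * pi else 0)"
    by (simp add: set_borel_integral_eq_integral integral_unique)
  then show ?thesis by (simp add: set_lebesgue_integral_def scaleR_conv_of_real)
qed

section \<open>Spectral integrals of trigonometric polynomials\<close>

lemma cmod_sum_square:
  "complex_of_real ((cmod (\<Sum>s\<in>S. g s))\<^sup>2) = (\<Sum>s\<in>S. \<Sum>t\<in>S. g s * cnj (g t))"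
  unfolding complex_norm_square by (simp add: sum_product cnj_sum)

lemma lebesgue_integral_cmod_square_trig:
  fixes F :: "real \<Rightarrow> real" and g :: "nat \<Rightarrow> complex"
  assumes F: "integrable lborel F" "finite S"
  shows "integrable lborel (\<lambda>\<theta>. F \<theta> * (cmod (\<Sum>s\<in>S. g s * cis (real s * \<theta>)))\<^sup>2)"
    and "complex_of_real (LINT \<theta>|lborel. F \<theta> * (cmod (\<Sum>s\<in>S. g s * cis (real s * \<theta>)))\<^sup>2) =
      (\<Sum>s\<in>S. \<Sum>t\<in>S. g s * cnj (g t) *
         (LINT \<theta>|lborel. complex_of_real (F \<theta>) * cis (of_int (int s - int t) * \<theta>)))"
proof -
  let ?t = "\<lambda>\<theta>. (cmod (\<Sum>s\<in>S. g s * cis (real s * \<theta>)))\<^sup>2"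
  have eq: "complex_of_real (F \<theta> * ?t \<theta>) =
      (\<Sum>s\<in>S. \<Sum>t\<in>S. g s * cnj (g t) * (complex_of_real (F \<theta>) * cis (of_int (int s - int t) * \<theta>)))" for \<theta>
    unfolding of_real_mult cmod_sum_square sum_distrib_left
    by (intro sum.cong refl) (simp add: cis_cnj cis_mult left_diff_distrib right_diff_distrib mult_ac)
  have int: "integrable lborel (\<lambda>\<theta>. g s * cnj (g t) * (complex_of_real (F \<theta>) * cis (of_int (int s - int t) * \<theta>)))" for s t
    by (intro integrable_mult_right integrable_cis_mult F) measurable
  have "integrable lborel (\<lambda>\<theta>. complex_of_real (F \<theta> * ?t \<theta>))"
    unfolding eq by (intro Bochner_Integration.integrable_sum int)
  then show "integrable lborel (\<lambda>\<theta>. F \<theta> * ?t \<theta>)"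
    by (simp only: complex_of_real_integrable_eq)
  show "complex_of_real (LINT \<theta>|lborel. F \<theta> * ?t \<theta>) =
      (\<Sum>s\<in>S. \<Sum>t\<in>S. g s * cnj (g t) *
         (LINT \<theta>|lborel. complex_of_real (F \<theta>) * cis (of_int (int s - int t) * \<theta>)))"
    unfolding integral_complex_of_real[symmetric] eq
    by (simp only: Bochner_Integration.integral_sum int Bochner_Integration.integrable_sum integral_mult_right_zero)
qed

lemma integrable_mult_of_squares:
  fixes f g :: "'b \<Rightarrow> real"
  assumes [measurable]: "f \<in> borel_measurable M" "g \<in> borel_measurable M"
    and "integrable M (\<lambda>x. (f x)\<^sup>2)" "integrable M (\<lambda>x. (g x)\<^sup>2)"
  shows "integrable M (\<lambda>x. f x * g x)"
proof (rule Bochner_Integration.integrable_bound)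
  show "integrable M (\<lambda>x. (f x)\<^sup>2 + (g x)\<^sup>2)" using assms by simp
  have "\<bar>f x * g x\<bar> \<le> (f x)\<^sup>2 + (g x)\<^sup>2" for x
  proof -
    have "2 * \<bar>f x * g x\<bar> \<le> (f x)\<^sup>2 + (g x)\<^sup>2"
      using sum_squares_bound[of "\<bar>f x\<bar>" "\<bar>g x\<bar>"] by (simp add: abs_mult)
    then show ?thesis using abs_ge_zero[of "f x * g x"] by linarith
  qed
  then show "AE x in M. norm (f x * g x) \<le> norm ((f x)\<^sup>2 + (g x)\<^sup>2)" by simp
qed measurable

text \<open>The isometry between linear combinations of the noise and trigonometric polynomials
  weighted by \<open>F\<close>: both squares expand into the same quadratic form in the
  autocovariances.\<close>

lemma second_moment_spectral:
  fixes g :: "nat \<Rightarrow> complex"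
  assumes u: "zero_mean_stationary P u" and w: "spectral_weight P u F"
    and S: "finite S" "S \<subseteq> {1..}"
  shows "integrable P (\<lambda>\<omega>. (cmod (\<Sum>s\<in>S. g s * complex_of_real (u (int s) \<omega>)))\<^sup>2)"
    and "(LINT \<omega>|P. (cmod (\<Sum>s\<in>S. g s * complex_of_real (u (int s) \<omega>)))\<^sup>2) =
         (LINT \<theta>|lborel. F \<theta> * (cmod (\<Sum>s\<in>S. g s * cis (real s * \<theta>)))\<^sup>2)"
proof -
  let ?q = "\<lambda>\<omega>. (cmod (\<Sum>s\<in>S. g s * complex_of_real (u (int s) \<omega>)))\<^sup>2"
  let ?t = "\<lambda>\<theta>. (cmod (\<Sum>s\<in>S. g s * cis (real s * \<theta>)))\<^sup>2"
  have F: "integrable lborel F" using w by (simp add: spectral_weight_def)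
  have um: "u (int s) \<in> borel_measurable P" "integrable P (\<lambda>\<omega>. (u (int s) \<omega>)\<^sup>2)" if "s \<in> S" for s
    using u S that by (auto simp: zero_mean_stationary_def)
  have eq: "complex_of_real (?q \<omega>) =
      (\<Sum>s\<in>S. \<Sum>t\<in>S. g s * cnj (g t) * complex_of_real (u (int s) \<omega> * u (int t) \<omega>))" for \<omega>
    unfolding cmod_sum_square by (intro sum.cong refl) (simp add: mult_ac)
  have int: "integrable P (\<lambda>\<omega>. g s * cnj (g t) * complex_of_real (u (int s) \<omega> * u (int t) \<omega>))" if "s \<in> S" "t \<in> S" for s t
    by (intro integrable_mult_right integrable_of_real integrable_mult_of_squares um that)
  have "integrable P (\<lambda>\<omega>. complex_of_real (?q \<omega>))"
    unfolding eq by (intro Bochner_Integration.integrable_sum int)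
  then show "integrable P (\<lambda>\<omega>. ?q \<omega>)"
    by (simp only: complex_of_real_integrable_eq)
  have "complex_of_real (LINT \<omega>|P. ?q \<omega>) =
      (\<Sum>s\<in>S. \<Sum>t\<in>S. g s * cnj (g t) * complex_of_real (LINT \<omega>|P. u (int s) \<omega> * u (int t) \<omega>))"
    unfolding integral_complex_of_real[symmetric] eq
    by (subst Bochner_Integration.integral_sum, (intro Bochner_Integration.integrable_sum int; assumption),
        intro sum.cong refl, subst Bochner_Integration.integral_sum, intro int, assumption, assumption)
       (simp only: integral_mult_right_zero)
  also have "\<dots> = (\<Sum>s\<in>S. \<Sum>t\<in>S. g s * cnj (g t) *
         (LINT \<theta>|lborel. complex_of_real (F \<theta>) * cis (of_int (int s - int t) * \<theta>)))"
  proof (intro sum.cong refl arg_cong[where f = "(*) (_ :: complex)"])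
    fix s t assume "s \<in> S" "t \<in> S"
    then have "int s \<ge> 1" "int t \<ge> 1" using S by auto
    then show "complex_of_real (LINT \<omega>|P. u (int s) \<omega> * u (int t) \<omega>) =
        (LINT \<theta>|lborel. complex_of_real (F \<theta>) * cis (of_int (int s - int t) * \<theta>))"
      using w unfolding spectral_weight_def by blast
  qed
  also have "\<dots> = complex_of_real (LINT \<theta>|lborel. F \<theta> * ?t \<theta>)"
    by (rule lebesgue_integral_cmod_square_trig(2)[symmetric]) (use F S in auto)
  finally show "(LINT \<omega>|P. ?q \<omega>) =
         (LINT \<theta>|lborel. F \<theta> * ?t \<theta>)"
    by (simp only: of_real_eq_iff)
qed

lemma parseval_trig:
  fixes g :: "nat \<Rightarrow> complex"
  assumes "finite S"
  shows "(LINT \<theta>|lborel. indicator {-pi..pi} \<theta> * (cmod (\<Sum>s\<in>S. g s * cis (real s * \<theta>)))\<^sup>2) =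
      2 * pi * (\<Sum>s\<in>S. (cmod (g s))\<^sup>2)"
proof -
  have "complex_of_real (LINT \<theta>|lborel. indicator {-pi..pi} \<theta> * (cmod (\<Sum>s\<in>S. g s * cis (real s * \<theta>)))\<^sup>2) =
    (\<Sum>s\<in>S. \<Sum>t\<in>S. g s * cnj (g t) * (if s = t then 2 * pi else 0))"
    using assms by (subst lebesgue_integral_cmod_square_trig(2))
      (simp_all add: integral_cis_period integrable_real_indicator emeasure_lborel_Icc_eq del: of_int_diff)
  also have "\<dots> = (\<Sum>s\<in>S. g s * cnj (g s) * (2 * pi))"
    using assms by (intro sum.cong refl) (simp add: if_distrib[of "\<lambda>x. _ * complex_of_real x"] sum.delta' cong: if_cong)
  also have "\<dots> = complex_of_real (2 * pi * (\<Sum>s\<in>S. (cmod (g s))\<^sup>2))"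
    unfolding of_real_mult of_real_sum sum_distrib_left complex_norm_square
    by (intro sum.cong refl) simp
  finally show ?thesis by (simp only: of_real_eq_iff)
qed

text \<open>Total variation of the finite sequence \<open>g 1, ..., g n\<close> extended by zero on
  both sides; the two moduli are the jumps at the ends.\<close>

definition variation :: "nat \<Rightarrow> (nat \<Rightarrow> complex) \<Rightarrow> real" where
  "variation n g = cmod (g 1) + cmod (g n) + (\<Sum>s=1..<n. cmod (g (Suc s) - g s))"

lemma variation_nonneg: "variation n g \<ge> 0"
  by (auto simp: variation_def intro!: add_nonneg_nonneg sum_nonneg)

text \<open>Abel summation: the factor \<open>1 - z\<close> turns coefficients into increments. The
  induction carries the end term \<open>g n * z ^ Suc n\<close> on the left, since only then does
  each step add a single increment.\<close>

lemma summation_by_parts_bound: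
  fixes z :: complex
  assumes "cmod z = 1" "n \<ge> 1"
  shows "cmod (1 - z) * cmod (\<Sum>s=1..n. g s * z ^ s) \<le> variation n g"
proof -
  have "cmod ((1 - z) * (\<Sum>s=1..n. g s * z ^ s) + g n * z ^ Suc n) \<le> cmod (g 1) + (\<Sum>s=1..<n. cmod (g (Suc s) - g s))"
    using assms(2)
  proof (induction n rule: nat_induct_at_least)
    case base
    show ?case using assms by (simp add: algebra_simps norm_mult)
  next
    case (Suc n)
    have "(1 - z) * (\<Sum>s=1..Suc n. g s * z ^ s) + g (Suc n) * z ^ Suc (Suc n) =
      ((1 - z) * (\<Sum>s=1..n. g s * z ^ s) + g n * z ^ Suc n) + (g (Suc n) - g n) * z ^ Suc n"
      by (simp add: algebra_simps)
    also have "cmod \<dots> \<le> cmod ((1 - z) * (\<Sum>s=1..n. g s * z ^ s) + g n * z ^ Suc n) + cmod ((g (Suc n) - g n) * z ^ Suc n)"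
      by (rule norm_triangle_ineq)
    also have "cmod ((g (Suc n) - g n) * z ^ Suc n) = cmod (g (Suc n) - g n)"
      using assms by (simp add: norm_mult norm_power)
    finally show ?case using Suc by simp
  qed
  moreover have "cmod ((1 - z) * (\<Sum>s=1..n. g s * z ^ s)) \<le>
     cmod ((1 - z) * (\<Sum>s=1..n. g s * z ^ s) + g n * z ^ Suc n) + cmod (g n * z ^ Suc n)"
    using norm_triangle_ineq4[of "(1 - z) * (\<Sum>s=1..n. g s * z ^ s) + g n * z ^ Suc n" "g n * z ^ Suc n"] by simp
  moreover have "cmod (g n * z ^ Suc n) = cmod (g n)" using assms by (simp add: norm_mult norm_power)
  ultimately show ?thesis unfolding variation_def norm_mult[of "1 - z", symmetric] by linarith
qed

lemma cmod_one_minus_cis_square: "(cmod (1 - cis x))\<^sup>2 = 2 - 2 * cos x"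
proof -
  have "(cmod (1 - cis x))\<^sup>2 = (1 - cos x)\<^sup>2 + (sin x)\<^sup>2" by (simp add: cmod_power2)
  also have "\<dots> = 1 - 2 * cos x + ((sin x)\<^sup>2 + (cos x)\<^sup>2)" by (simp add: power2_eq_square algebra_simps)
  finally show ?thesis by simp
qed

text \<open>The range up to \<open>2 * pi - e\<close> is essential: the argument will be a point of
  [-pi, pi] shifted by a Fourier frequency, which may overstep pi but stays away from
  \<open>2 * pi\<close>.\<close>

lemma cmod_one_minus_cis_ge:
  assumes "0 < e" "e \<le> \<bar>x\<bar>" "\<bar>x\<bar> \<le> 2 * pi - e" 
  shows "2 * (1 - cos e) \<le> (cmod (1 - cis x))\<^sup>2"
proof -
  have e: "e \<le> pi" using assms by linarith
  have "cos x \<le> cos e"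
  proof (cases "\<bar>x\<bar> \<le> pi")
    case True
    then have "cos \<bar>x\<bar> \<le> cos e" using assms e by (subst cos_mono_le_eq) auto
    then show ?thesis by simp
  next
    case False
    have "cos (2 * pi - \<bar>x\<bar>) \<le> cos e" using assms e False by (subst cos_mono_le_eq) auto
    moreover have "cos (2 * pi - \<bar>x\<bar>) = cos x" by (simp add: cos_diff)
    ultimately show ?thesis by simp
  qed
  then show ?thesis by (simp add: cmod_one_minus_cis_square)
qed

text \<open>Near the origin the density is bounded and Parseval applies; away from it, summation by
  parts bounds the trigonometric polynomial itself, so that integrability of the density suffices.\<close>

lemma second_moment_upper:
  fixes F :: "real \<Rightarrow> real"
  assumes F: "integrable lborel F" "\<And>\<theta>. F \<theta> \<ge> 0" "\<And>\<theta>. \<theta> \<notin> {-pi..pi} \<Longrightarrow> F \<theta> = 0"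
    and \<delta>: "0 < \<delta>" "\<delta> \<le> 1" "\<And>\<theta>. \<bar>\<theta>\<bar> < \<delta> \<Longrightarrow> F \<theta> \<le> B"
  shows "\<exists>C>0. \<forall>n\<ge>1. \<forall>g \<nu>. \<bar>\<nu>\<bar> \<le> \<delta> / 2 \<longrightarrow>
     (LINT \<theta>|lborel. F \<theta> * (cmod (\<Sum>s=1..n. (g s * cis (real s * \<nu>)) * cis (real s * \<theta>)))\<^sup>2) \<le>
     C * ((\<Sum>s=1..n. (cmod (g s))\<^sup>2) + (variation n g)\<^sup>2)"
proof -
  \<comment> \<open>Outside \<open>\<bar>\<theta>\<bar> < \<delta>\<close>, a shift by at most
    \<open>\<delta> / 2\<close> keeps \<open>\<theta> + \<nu>\<close> at distance at least
    \<open>\<delta> / 2\<close> from the multiples of \<open>2 * pi\<close>, so \<open>k\<close>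
    bounds the squared modulus of \<open>1 - z\<close> from below there.\<close>
  define k where "k = 2 * (1 - cos (\<delta> / 2))"
  have k: "k > 0"
    using \<delta> cos_monotone_0_pi[of 0 "\<delta> / 2"] pi_gt3 by (simp add: k_def)
  define IF where "IF = (LINT \<theta>|lborel. F \<theta>)"
  have IF: "IF \<ge> 0" unfolding IF_def by (intro integral_nonneg_AE) (use F in auto)
  have B: "B \<ge> 0" using F(2)[of 0] \<delta>(3)[of 0] \<delta>(1) by simp
  define C where "C = 1 + B * 2 * pi + IF / k"
  have "B * 2 * pi \<ge> 0" "IF / k \<ge> 0" using IF k B by auto
  then have C: "C > 0" "B * 2 * pi \<le> C" "IF / k \<le> C" by (auto simp: C_def)
  show ?thesis
  proof (intro exI[of _ C] conjI allI impI C)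
    fix n :: nat and g :: "nat \<Rightarrow> complex" and \<nu> :: real
    assume n: "n \<ge> 1" and lam: "\<bar>\<nu>\<bar> \<le> \<delta> / 2"
    define G where "G \<theta> = (\<Sum>s=1..n. (g s * cis (real s * \<nu>)) * cis (real s * \<theta>))" for \<theta>
    have pw: "F \<theta> * (cmod (G \<theta>))\<^sup>2 \<le> B * (indicator {-pi..pi} \<theta> * (cmod (G \<theta>))\<^sup>2) + ((variation n g)\<^sup>2 / k) * F \<theta>" for \<theta>
    proof (cases "\<theta> \<in> {-pi..pi}")
      case True
      show ?thesis
      proof (cases "\<bar>\<theta>\<bar> < \<delta>")
        case True2: True
        have "F \<theta> * (cmod (G \<theta>))\<^sup>2 \<le> B * (cmod (G \<theta>))\<^sup>2" using \<delta>(3)[OF True2] by (intro mult_right_mono) auto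
        then show ?thesis using True F(2)[of \<theta>] k by (simp add: add_increasing2)
      next
        case False
        define z where "z = cis (\<theta> + \<nu>)"
        have Gz: "G \<theta> = (\<Sum>s=1..n. g s * z ^ s)"
          unfolding G_def z_def by (intro sum.cong refl) (simp add: Complex.DeMoivre cis_mult distrib_left mult.assoc add.commute)
        have "k \<le> (cmod (1 - z))\<^sup>2"
        proof -
          have "\<bar>\<theta>\<bar> \<le> \<bar>\<theta> + \<nu>\<bar> + \<bar>\<nu>\<bar>" "\<bar>\<theta> + \<nu>\<bar> \<le> \<bar>\<theta>\<bar> + \<bar>\<nu>\<bar>" "\<bar>\<theta>\<bar> \<le> pi"
            using True by auto
          then show ?thesis
            unfolding k_def z_def using False lam \<delta>(1,2) pi_gt3 by (intro cmod_one_minus_cis_ge) linarith+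
        qed
        then have "k * (cmod (G \<theta>))\<^sup>2 \<le> (cmod (1 - z))\<^sup>2 * (cmod (G \<theta>))\<^sup>2" by (intro mult_right_mono) auto
        also have "\<dots> = (cmod (1 - z) * cmod (G \<theta>))\<^sup>2" by (simp add: power_mult_distrib)
        also have "\<dots> \<le> (variation n g)\<^sup>2"
          unfolding Gz using n by (intro power_mono summation_by_parts_bound) (auto simp: z_def)
        finally have "(cmod (G \<theta>))\<^sup>2 \<le> (variation n g)\<^sup>2 / k" using k by (simp add: field_simps)
        then have "F \<theta> * (cmod (G \<theta>))\<^sup>2 \<le> F \<theta> * ((variation n g)\<^sup>2 / k)" using F(2) by (intro mult_left_mono) auto
        moreover have "B * (indicator {-pi..pi} \<theta> * (cmod (G \<theta>))\<^sup>2) \<ge> 0" using B by simp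
        ultimately show ?thesis by (simp add: mult.commute)
      qed
    qed (use F(3) in simp)
    have int1: "integrable lborel (\<lambda>\<theta>. indicator {-pi..pi} \<theta> * (cmod (G \<theta>))\<^sup>2)"
      unfolding G_def by (rule lebesgue_integral_cmod_square_trig) (auto intro!: integrable_real_indicator)
    have "(LINT \<theta>|lborel. F \<theta> * (cmod (G \<theta>))\<^sup>2) \<le>
        (LINT \<theta>|lborel. B * (indicator {-pi..pi} \<theta> * (cmod (G \<theta>))\<^sup>2) + ((variation n g)\<^sup>2 / k) * F \<theta>)"
    proof (rule integral_mono)
      show "integrable lborel (\<lambda>\<theta>. F \<theta> * (cmod (G \<theta>))\<^sup>2)"
        unfolding G_def by (rule lebesgue_integral_cmod_square_trig) (auto intro: F)
      show "integrable lborel (\<lambda>\<theta>. B * (indicator {-pi..pi} \<theta> * (cmod (G \<theta>))\<^sup>2) + ((variation n g)\<^sup>2 / k) * F \<theta>)"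
        by (intro Bochner_Integration.integrable_add integrable_mult_right int1 F)
    qed (rule pw)
    also have "\<dots> = B * (LINT \<theta>|lborel. indicator {-pi..pi} \<theta> * (cmod (G \<theta>))\<^sup>2) + ((variation n g)\<^sup>2 / k) * IF"
      unfolding IF_def
      by (subst Bochner_Integration.integral_add) (intro integrable_mult_right int1 F, intro integrable_mult_right int1 F, simp only: integral_mult_right_zero)
    also have "(LINT \<theta>|lborel. indicator {-pi..pi} \<theta> * (cmod (G \<theta>))\<^sup>2) = 2 * pi * (\<Sum>s=1..n. (cmod (g s))\<^sup>2)"
      unfolding G_def by (subst parseval_trig) (auto simp: norm_mult)
    also have "B * (2 * pi * (\<Sum>s=1..n. (cmod (g s))\<^sup>2)) + ((variation n g)\<^sup>2 / k) * IF \<le>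
       C * (\<Sum>s=1..n. (cmod (g s))\<^sup>2) + C * (variation n g)\<^sup>2"
    proof (rule add_mono)
      show "B * (2 * pi * (\<Sum>s=1..n. (cmod (g s))\<^sup>2)) \<le> C * (\<Sum>s=1..n. (cmod (g s))\<^sup>2)"
        using mult_right_mono[OF C(2), of "\<Sum>s=1..n. (cmod (g s))\<^sup>2"] by (simp add: sum_nonneg mult.assoc)
      show "((variation n g)\<^sup>2 / k) * IF \<le> C * (variation n g)\<^sup>2"
        using mult_right_mono[OF C(3), of "(variation n g)\<^sup>2"] by (simp add: mult.commute)
    qed
    finally show "(LINT \<theta>|lborel. F \<theta> * (cmod (\<Sum>s=1..n. (g s * cis (real s * \<nu>)) * cis (real s * \<theta>)))\<^sup>2) \<le>
     C * ((\<Sum>s=1..n. (cmod (g s))\<^sup>2) + (variation n g)\<^sup>2)"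
      by (simp add: G_def distrib_left)
  qed
qed

text \<open>For frequencies in (0, 1/n) the phases \<open>(n - s) * \<theta>\<close> stay in [0, 1],
  so after a common rotation every term has real part at least \<open>g s * cos 1\<close> and
  nothing cancels. The factor \<open>1 / n\<close> is the length of that band.\<close>

lemma second_moment_lower:
  fixes F :: "real \<Rightarrow> real" and g :: "nat \<Rightarrow> real"
  assumes F: "integrable lborel F" "\<And>\<theta>. F \<theta> \<ge> 0"
    and b: "b \<ge> 0" "\<And>\<theta>. 0 < \<theta> \<Longrightarrow> \<theta> < \<delta> \<Longrightarrow> b \<le> F \<theta>"
    and n: "n \<ge> 1" "1 / real n \<le> \<delta>" and g: "\<And>s. g s \<ge> 0"
  shows "b * (cos 1)\<^sup>2 / real n * (\<Sum>s=1..n. g s)\<^sup>2 \<le>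
     (LINT \<theta>|lborel. F \<theta> * (cmod (\<Sum>s=1..n. complex_of_real (g s) * cis (real s * \<theta>)))\<^sup>2)"
proof -
  define G where "G \<theta> = (\<Sum>s=1..n. complex_of_real (g s) * cis (real s * \<theta>))" for \<theta>
  define T where "T = (\<Sum>s=1..n. g s)"
  have T: "T \<ge> 0" using g by (simp add: T_def sum_nonneg)
  have c1: "cos 1 \<ge> (0::real)" using cos_ge_zero[of 1] pi_gt3 by simp
  have pw: "b * (cos 1)\<^sup>2 * T\<^sup>2 * indicator {0<..<1 / real n} \<theta> \<le> F \<theta> * (cmod (G \<theta>))\<^sup>2" for \<theta>
  proof (cases "\<theta> \<in> {0<..<1 / real n}")
    case True
    have "cos 1 * T \<le> Re (cis (- real n * \<theta>) * G \<theta>)"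
    proof -
      have "Re (cis (- real n * \<theta>) * G \<theta>) = (\<Sum>s=1..n. g s * cos ((real n - real s) * \<theta>))"
        unfolding G_def sum_distrib_left Re_sum
        by (intro sum.cong refl) (simp add: left_diff_distrib cos_diff algebra_simps)
      moreover have "(\<Sum>s=1..n. g s * cos 1) \<le> (\<Sum>s=1..n. g s * cos ((real n - real s) * \<theta>))"
      proof (intro sum_mono mult_left_mono g)
        fix s assume s: "s \<in> {1..n}"
        have "(real n - real s) * \<theta> \<le> real n * (1 / real n)" using True s by (intro mult_mono) auto
        then have "(real n - real s) * \<theta> \<le> 1" using n by simp
        moreover have "0 \<le> (real n - real s) * \<theta>" using True s by simp
        ultimately show "cos 1 \<le> cos ((real n - real s) * \<theta>)" using pi_gt3 by (subst cos_mono_le_eq) auto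
      qed
      ultimately show ?thesis unfolding T_def sum_distrib_right[symmetric] by (simp only: mult.commute)
    qed
    also have "\<dots> \<le> cmod (cis (- real n * \<theta>) * G \<theta>)" by (rule complex_Re_le_cmod)
    also have "\<dots> = cmod (G \<theta>)" by (simp add: norm_mult)
    finally have "(cos 1 * T)\<^sup>2 \<le> (cmod (G \<theta>))\<^sup>2" using T c1 by (intro power_mono) auto
    moreover have "b \<le> F \<theta>" using True n by (intro b) auto
    ultimately have "b * (cos 1 * T)\<^sup>2 \<le> F \<theta> * (cmod (G \<theta>))\<^sup>2" using b by (intro mult_mono) auto
    then show ?thesis using True by (simp add: power_mult_distrib mult.assoc)
  qed (use F in simp)
  have "(LINT \<theta>|lborel. b * (cos 1)\<^sup>2 * T\<^sup>2 * indicator {0<..<1 / real n} \<theta>) \<le> (LINT \<theta>|lborel. F \<theta> * (cmod (G \<theta>))\<^sup>2)"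
  proof (rule integral_mono)
    show "integrable lborel (\<lambda>\<theta>. F \<theta> * (cmod (G \<theta>))\<^sup>2)"
      unfolding G_def by (rule lebesgue_integral_cmod_square_trig) (auto intro: F)
  qed (auto intro!: pw integrable_real_indicator integrable_mult_right)
  then show ?thesis by (simp add: G_def T_def)
qed


section \<open>Fourier frequencies\<close>

lemma cis_sum_roots:
  assumes "0 < h" "h < n"
  shows "(\<Sum>j<n. cis (2 * pi * real j * real h / real n)) = 0"
proof -
  define w where "w = cis (2 * pi * real h / real n)"
  have n: "n > 0" using assms by simp
  have "w \<noteq> 1"
  proof
    assume "w = 1"
    then have "cos (2 * pi * real h / real n) = 1" by (simp add: w_def complex_eq_iff)
    then obtain i :: int where "2 * pi * real h / real n = of_int i * 2 * pi" by (auto simp: cos_one_2pi_int)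
    then have "real h = of_int i * real n" using n by (simp add: field_simps)
    then have "int h = i * int n" by (metis of_int_eq_iff of_int_mult of_int_of_nat_eq)
    then have "int n dvd int h" by simp
    then show False using assms by (auto dest: zdvd_imp_le)
  qed
  moreover have "w ^ n = 1"
    using n cis_multiple_2pi[of "real h"] by (simp add: w_def Complex.DeMoivre)
  moreover have "cis (2 * pi * real j * real h / real n) = w ^ j" for j
    by (simp add: w_def Complex.DeMoivre mult_ac)
  ultimately show ?thesis by (simp add: geometric_sum)
qed

lemma parseval_fourier_freq:
  fixes x :: "nat \<Rightarrow> complex"
  assumes "n \<ge> 1"
  shows "(\<Sum>j<n. (cmod (\<Sum>k<n. x k * cis (real k * fourier_freq n j)))\<^sup>2) = real n * (\<Sum>k<n. (cmod (x k))\<^sup>2)"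
proof -
  have orth: "(\<Sum>j<n. cis (real k * fourier_freq n j) * cnj (cis (real l * fourier_freq n j))) = (if k = l then of_nat n else 0)"
    if "k < n" "l < n" for k l
  proof -
    have e: "cis (real k * fourier_freq n j) * cnj (cis (real l * fourier_freq n j)) = cis ((real k - real l) * fourier_freq n j)" for j
      by (simp add: cis_cnj cis_mult left_diff_distrib)
    consider "k = l" | "l < k" | "k < l" by linarith
    then show ?thesis
    proof cases
      case 2
      have "(real k - real l) * fourier_freq n j = 2 * pi * real j * real (k - l) / real n" for j
        using 2 by (simp add: fourier_freq_def of_nat_diff)
      then show ?thesis unfolding e using cis_sum_roots[of "k - l" n] 2 that by simp
    next
      case 3
      have "cis ((real k - real l) * fourier_freq n j) = cnj (cis (2 * pi * real j * real (l - k) / real n))" for j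
      proof -
        have "(real k - real l) * fourier_freq n j = - ((real l - real k) * fourier_freq n j)"
          by (simp add: left_diff_distrib)
        also have "(real l - real k) * fourier_freq n j = 2 * pi * real j * real (l - k) / real n"
          using 3 by (simp add: fourier_freq_def of_nat_diff)
        finally show ?thesis by (simp only: cis_cnj)
      qed
      then show ?thesis unfolding e using arg_cong[OF cis_sum_roots[of "l - k" n], of cnj] 3 that by simp
    qed (simp add: cis_cnj cis_mult)
  qed
  have "complex_of_real (\<Sum>j<n. (cmod (\<Sum>k<n. x k * cis (real k * fourier_freq n j)))\<^sup>2) =
     (\<Sum>j<n. \<Sum>k<n. \<Sum>l<n. x k * cnj (x l) * (cis (real k * fourier_freq n j) * cnj (cis (real l * fourier_freq n j))))"
    unfolding of_real_sum complex_norm_square cnj_sum sum_product by (intro sum.cong refl) (simp add: mult_ac)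
  also have "\<dots> = (\<Sum>k<n. \<Sum>l<n. \<Sum>j<n. x k * cnj (x l) * (cis (real k * fourier_freq n j) * cnj (cis (real l * fourier_freq n j))))"
    by (subst sum.swap, rule sum.cong[OF refl], subst sum.swap, rule refl)
  also have "\<dots> = (\<Sum>k<n. \<Sum>l<n. if k = l then x k * cnj (x l) * of_nat n else 0)"
    unfolding sum_distrib_left[symmetric] by (intro sum.cong refl) (simp only: orth lessThan_iff, simp)
  also have "\<dots> = (\<Sum>k<n. x k * cnj (x k) * of_nat n)" by (intro sum.cong refl) simp
  also have "\<dots> = complex_of_real (real n * (\<Sum>k<n. (cmod (x k))\<^sup>2))"
    unfolding of_real_mult of_real_sum complex_norm_square sum_distrib_left by (intro sum.cong refl) simp
  finally show ?thesis by (simp only: of_real_eq_iff)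
qed

section \<open>Truncated fractional series at the Fourier frequencies\<close>

lemma powr_square: "((x::real) powr d)\<^sup>2 = x powr (2 * d)"
  by (simp add: power2_eq_square powr_add[symmetric])

text \<open>Partial sum of the expansion of \<open>(1 - cis \<theta>) powr (- d)\<close>; truncation
  arises because a shock at time \<open>s\<close> is followed by only \<open>n - s\<close> further
  observations.\<close>

definition frac_trig :: "real \<Rightarrow> nat \<Rightarrow> real \<Rightarrow> complex" where
  "frac_trig d N \<theta> = (\<Sum>k\<le>N. complex_of_real (frac_coeff d k) * cis (real k * \<theta>))"

lemma cmod_frac_trig_le: "d > 0 \<Longrightarrow> cmod (frac_trig d N \<theta>) \<le> frac_coeff (d + 1) N"
  unfolding frac_trig_def sum_frac_coeff[symmetric]
  by (rule order.trans[OF norm_sum]) (auto intro!: sum_mono simp: norm_mult less_imp_le[OF frac_coeff_pos])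

text \<open>The part \<open>k \<le> \<kappa> n\<close> of the sum is small in absolute value, the rest is controlled by Parseval.\<close>

lemma sum_frac_trig_le:
  assumes "d > 0"
  shows "\<exists>C>0. \<forall>n m N \<kappa>. 1 \<le> m \<longrightarrow> m < n \<longrightarrow> N < n \<longrightarrow> 0 < \<kappa> \<longrightarrow> 1 \<le> \<kappa> * real n \<longrightarrow>
     (\<Sum>j=1..m. (cmod (frac_trig d N (fourier_freq n j)))\<^sup>2) \<le>
       C * real n powr (2 * d) * (real m * \<kappa> powr (2 * d) + 1 / \<kappa>\<^sup>2)"
proof -
  obtain C1 where C1: "C1 > 0" "\<And>k. k \<ge> 1 \<Longrightarrow> frac_coeff d k \<le> C1 * real k powr (d - 1)"
    using frac_coeff_bounds[OF assms] by blast
  obtain C2 where C2: "C2 > 0" "\<And>k. k \<ge> 1 \<Longrightarrow> frac_coeff (d + 1) k \<le> C2 * real k powr d"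
    using frac_coeff_bounds[of "d + 1"] assms by auto
  define C where "C = 2 * (max 1 C2)\<^sup>2 + 2 * C1\<^sup>2"
  have "C > 0" using C1 by (simp add: C_def add_nonneg_pos)
  have nn: "frac_coeff d k \<ge> 0" for k using frac_coeff_pos[OF assms] less_imp_le by blast
  show ?thesis
  proof (intro exI[of _ C] conjI allI impI \<open>C > 0\<close>)
    fix n m N :: nat and \<kappa> :: real
    assume m: "1 \<le> m" "m < n" and N: "N < n" and \<kappa>: "0 < \<kappa>" "1 \<le> \<kappa> * real n"
    define L where "L = {k \<in> {..N}. real k \<le> \<kappa> * real n}"
    define H where "H = {k \<in> {..N}. \<not> real k \<le> \<kappa> * real n}"
    define K where "K = nat \<lfloor>\<kappa> * real n\<rfloor>"
    define x where "x k = (if k \<in> H then complex_of_real (frac_coeff d k) else 0)" for k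
    let ?lo = "\<lambda>\<theta>. \<Sum>k\<in>L. complex_of_real (frac_coeff d k) * cis (real k * \<theta>)"
    let ?hi = "\<lambda>j. \<Sum>k<n. x k * cis (real k * fourier_freq n j)"
    have split: "frac_trig d N \<theta> = ?lo \<theta> + (\<Sum>k<n. x k * cis (real k * \<theta>))" for \<theta>
    proof -
      have "{..N} = L \<union> H" "L \<inter> H = {}" "finite L" "finite H" by (auto simp: L_def H_def)
      then have "frac_trig d N \<theta> = ?lo \<theta> + (\<Sum>k\<in>H. complex_of_real (frac_coeff d k) * cis (real k * \<theta>))"
        unfolding frac_trig_def by (simp only: sum.union_disjoint)
      also have "(\<Sum>k\<in>H. complex_of_real (frac_coeff d k) * cis (real k * \<theta>)) = (\<Sum>k\<in>{..<n}. x k * cis (real k * \<theta>))"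
        using N by (intro sum.mono_neutral_cong_left) (auto simp: x_def H_def)
      finally show ?thesis .
    qed
    have K: "real K \<le> \<kappa> * real n" using \<kappa> by (simp add: K_def)
    have low: "cmod (?lo \<theta>) \<le> max 1 C2 * (\<kappa> * real n) powr d" for \<theta>
    proof -
      have "cmod (?lo \<theta>) \<le> (\<Sum>k\<in>L. frac_coeff d k)"
        by (rule order.trans[OF norm_sum]) (auto intro!: sum_mono simp: norm_mult nn)
      also have "\<dots> \<le> (\<Sum>k\<le>K. frac_coeff d k)"
      proof (rule sum_mono2)
        have "k \<le> K" if "real k \<le> \<kappa> * real n" for k
          using that unfolding K_def by (simp add: le_nat_floor)
        then show "L \<subseteq> {..K}" by (auto simp: L_def)
      qed (auto simp: nn)
      also have "\<dots> = frac_coeff (d + 1) K" by (rule sum_frac_coeff)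
      also have "\<dots> \<le> max 1 C2 * (\<kappa> * real n) powr d"
      proof (cases "K = 0")
        case True
        have "1 \<le> (\<kappa> * real n) powr d" using \<kappa> assms by (simp add: ge_one_powr_ge_zero)
        then have "1 * 1 \<le> max 1 C2 * (\<kappa> * real n) powr d" by (intro mult_mono) auto
        then show ?thesis using True by simp
      next
        case False
        then have "frac_coeff (d + 1) K \<le> C2 * real K powr d" using C2(2)[of K] by simp
        also have "\<dots> \<le> max 1 C2 * (\<kappa> * real n) powr d"
          using K assms by (intro mult_mono powr_mono2) auto
        finally show ?thesis .
      qed
      finally show ?thesis .
    qed
    have high: "(\<Sum>j=1..m. (cmod (?hi j))\<^sup>2) \<le> C1\<^sup>2 * real n powr (2 * d) * (1 / \<kappa>\<^sup>2)"
    proof -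
      have "(\<Sum>j=1..m. (cmod (?hi j))\<^sup>2) \<le>
         (\<Sum>j<n. (cmod (?hi j))\<^sup>2)"
        using m by (intro sum_mono2) auto
      also have "\<dots> = real n * (\<Sum>k<n. (cmod (x k))\<^sup>2)" using m by (intro parseval_fourier_freq) auto
      also have "\<dots> \<le> real n * (\<Sum>k<n. C1\<^sup>2 * real n powr (2 * d) * (1 / (\<kappa> * real n)\<^sup>2))"
      proof (intro mult_left_mono sum_mono)
        fix k assume k: "k \<in> {..<n}"
        show "(cmod (x k))\<^sup>2 \<le> C1\<^sup>2 * real n powr (2 * d) * (1 / (\<kappa> * real n)\<^sup>2)"
        proof (cases "k \<in> H")
          case True
          then have k2: "\<kappa> * real n < real k" by (simp add: H_def)
          then have k1: "real k > 0" using \<kappa> by linarith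
          have "(cmod (x k))\<^sup>2 = (frac_coeff d k)\<^sup>2" using True by (simp add: x_def)
          also have "\<dots> \<le> (C1 * real k powr (d - 1))\<^sup>2" using C1(2)[of k] k1 nn by (intro power_mono) auto
          \<comment> \<open>Writing the square as \<open>k powr (2 * d)\<close> over the square of
            \<open>k\<close> lets the numerator be bounded through \<open>k < n\<close> and the
            denominator through \<open>k > \<kappa> * n\<close>, whatever the sign of
            \<open>d - 1\<close>.\<close>
          also have "\<dots> = C1\<^sup>2 * (real k powr (2 * d) * (1 / (real k)\<^sup>2))"
            using k1 by (simp add: power_mult_distrib powr_diff power_divide powr_square)
          also have "\<dots> \<le> C1\<^sup>2 * (real n powr (2 * d) * (1 / (\<kappa> * real n)\<^sup>2))"
            using k k1 k2 \<kappa> assms by (intro mult_left_mono mult_mono powr_mono2 divide_left_mono power_mono) auto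
          finally show ?thesis by (simp add: mult.assoc)
        qed (simp add: x_def)
      qed simp
      also have "\<dots> = C1\<^sup>2 * real n powr (2 * d) * (1 / \<kappa>\<^sup>2)"
      proof -
        have "real n * (real n * (1 / (\<kappa> * real n)\<^sup>2)) = 1 / \<kappa>\<^sup>2"
          using m by (simp add: power_mult_distrib power2_eq_square)
        moreover have "real n * (\<Sum>k<n. C1\<^sup>2 * real n powr (2 * d) * (1 / (\<kappa> * real n)\<^sup>2)) =
            C1\<^sup>2 * real n powr (2 * d) * (real n * (real n * (1 / (\<kappa> * real n)\<^sup>2)))" by simp
        ultimately show ?thesis by (simp only:)
      qed
      finally show ?thesis .
    qed
    have "(\<Sum>j=1..m. (cmod (frac_trig d N (fourier_freq n j)))\<^sup>2) \<le>
      (\<Sum>j=1..m. 2 * (max 1 C2 * (\<kappa> * real n) powr d)\<^sup>2 + 2 * (cmod (?hi j))\<^sup>2)"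
    proof (rule sum_mono)
      fix j
      let ?a = "?lo (fourier_freq n j)"
      let ?b = "\<Sum>k<n. x k * cis (real k * fourier_freq n j)"
      have "(cmod (?a + ?b))\<^sup>2 \<le> (cmod ?a + cmod ?b)\<^sup>2" by (intro power_mono norm_triangle_ineq) auto
      also have "\<dots> \<le> 2 * (cmod ?a)\<^sup>2 + 2 * (cmod ?b)\<^sup>2"
        using sum_squares_bound[of "cmod ?a" "cmod ?b"] by (simp add: power2_sum)
      also have "(cmod ?a)\<^sup>2 \<le> (max 1 C2 * (\<kappa> * real n) powr d)\<^sup>2" by (intro power_mono low) auto
      finally show "(cmod (frac_trig d N (fourier_freq n j)))\<^sup>2 \<le> 2 * (max 1 C2 * (\<kappa> * real n) powr d)\<^sup>2 + 2 * (cmod ?b)\<^sup>2"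
        unfolding split by simp
    qed
    also have "\<dots> = real m * (2 * (max 1 C2 * (\<kappa> * real n) powr d)\<^sup>2) + 2 * (\<Sum>j=1..m. (cmod (?hi j))\<^sup>2)"
      by (simp add: sum.distrib sum_distrib_left)
    also have "\<dots> \<le> real m * (2 * (max 1 C2 * (\<kappa> * real n) powr d)\<^sup>2) + 2 * (C1\<^sup>2 * real n powr (2 * d) * (1 / \<kappa>\<^sup>2))"
      using high by simp
    also have "(max 1 C2 * (\<kappa> * real n) powr d)\<^sup>2 = (max 1 C2)\<^sup>2 * (\<kappa> powr (2 * d) * real n powr (2 * d))"
      using \<kappa> by (simp add: power_mult_distrib powr_mult powr_square)
    also have "real m * (2 * ((max 1 C2)\<^sup>2 * (\<kappa> powr (2 * d) * real n powr (2 * d)))) + 2 * (C1\<^sup>2 * real n powr (2 * d) * (1 / \<kappa>\<^sup>2)) =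
       (2 * (max 1 C2)\<^sup>2) * (real n powr (2 * d) * (real m * \<kappa> powr (2 * d))) + (2 * C1\<^sup>2) * (real n powr (2 * d) * (1 / \<kappa>\<^sup>2))"
      by (simp add: mult_ac)
    also have "\<dots> \<le> C * (real n powr (2 * d) * (real m * \<kappa> powr (2 * d))) + C * (real n powr (2 * d) * (1 / \<kappa>\<^sup>2))"
      by (intro add_mono mult_right_mono) (auto simp: C_def)
    finally show "(\<Sum>j=1..m. (cmod (frac_trig d N (fourier_freq n j)))\<^sup>2) \<le>
       C * real n powr (2 * d) * (real m * \<kappa> powr (2 * d) + 1 / \<kappa>\<^sup>2)"
      by (simp add: distrib_left mult.assoc)
  qed
qed

text \<open>Multiplying the transform by \<open>1 - z\<close> differences the series, which lowers
  the fractional order from \<open>d + 1\<close> to \<open>d\<close>; the result is then collected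
  by the time \<open>s\<close> of the shock. The end term stays on the left so that the induction on
  \<open>n\<close> closes for arbitrary \<open>z\<close>.\<close>

lemma dft_summation_by_parts:
  fixes x v :: "nat \<Rightarrow> real" and z :: complex
  assumes x: "\<And>t. x t = (\<Sum>k<t. frac_coeff (d + 1) k * v (t - k)) + x0"
  shows "(1 - z) * (\<Sum>t=1..n. complex_of_real (x t) * z ^ t) + complex_of_real (x n) * z ^ Suc n =
     (\<Sum>s=1..n. (\<Sum>k\<le>n - s. complex_of_real (frac_coeff d k) * z ^ k) * z ^ s * complex_of_real (v s)) + complex_of_real x0 * z"
proof (induction n)
  case 0
  then show ?case by (simp add: x)
next
  case (Suc n)
  have diff: "x (Suc n) - x n = (\<Sum>s=1..Suc n. frac_coeff d (Suc n - s) * v s)"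
  proof -
    have "x (Suc n) - x0 = v (Suc n) + (\<Sum>k<n. frac_coeff (d + 1) (Suc k) * v (n - k))"
      unfolding x by (subst sum.lessThan_Suc_shift) simp
    then have "x (Suc n) - x n = v (Suc n) + (\<Sum>k<n. frac_coeff d (Suc k) * v (n - k))"
      by (simp add: x[of n] frac_coeff_Suc_diff[of d, symmetric] left_diff_distrib sum_subtractf)
    also have "\<dots> = (\<Sum>k<Suc n. frac_coeff d k * v (Suc n - k))"
      by (subst sum.lessThan_Suc_shift) simp
    also have "\<dots> = (\<Sum>s=1..Suc n. frac_coeff d (Suc n - s) * v s)"
      by (rule sum.reindex_bij_witness[of _ "\<lambda>s. Suc n - s" "\<lambda>k. Suc n - k"]) auto
    finally show ?thesis .
  qed
  \<comment> \<open>Passing to \<open>Suc n\<close> lengthens each inner sum by one term, and every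
    new term carries the power \<open>z ^ Suc n\<close>; together they form the increment computed
    in \<open>diff\<close>.\<close>
  have step: "(\<Sum>s=1..Suc n. (\<Sum>k\<le>Suc n - s. complex_of_real (frac_coeff d k) * z ^ k) * z ^ s * complex_of_real (v s)) =
     (\<Sum>s=1..n. (\<Sum>k\<le>n - s. complex_of_real (frac_coeff d k) * z ^ k) * z ^ s * complex_of_real (v s)) +
     complex_of_real (x (Suc n) - x n) * z ^ Suc n"
  proof -
    have "(\<Sum>s=1..n. (\<Sum>k\<le>Suc n - s. complex_of_real (frac_coeff d k) * z ^ k) * z ^ s * complex_of_real (v s)) =
       (\<Sum>s=1..n. (\<Sum>k\<le>n - s. complex_of_real (frac_coeff d k) * z ^ k) * z ^ s * complex_of_real (v s) +
          complex_of_real (frac_coeff d (Suc n - s) * v s) * z ^ Suc n)"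
    proof (rule sum.cong)
      fix s assume s: "s \<in> {1..n}"
      have "z ^ Suc n = z ^ (Suc n - s) * z ^ s" using s by (simp add: power_add[symmetric])
      moreover have "Suc n - s = Suc (n - s)" using s by auto
      ultimately show "(\<Sum>k\<le>Suc n - s. complex_of_real (frac_coeff d k) * z ^ k) * z ^ s * complex_of_real (v s) =
        (\<Sum>k\<le>n - s. complex_of_real (frac_coeff d k) * z ^ k) * z ^ s * complex_of_real (v s) +
          complex_of_real (frac_coeff d (Suc n - s) * v s) * z ^ Suc n"
        by (simp only: sum.atMost_Suc of_real_mult) (simp add: algebra_simps)
    qed simp
    then show ?thesis unfolding diff
      by (simp add: sum.distrib sum_distrib_right distrib_right del: power_Suc)
  qed
  have "(1 - z) * (\<Sum>t=1..Suc n. complex_of_real (x t) * z ^ t) + complex_of_real (x (Suc n)) * z ^ Suc (Suc n) =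
     (1 - z) * (\<Sum>t=1..n. complex_of_real (x t) * z ^ t) + complex_of_real (x n) * z ^ Suc n + complex_of_real (x (Suc n) - x n) * z ^ Suc n"
    by (simp add: algebra_simps)
  then show ?case unfolding step Suc.IH by (simp add: algebra_simps)
qed


section \<open>Weighted sums of martingale differences\<close>

lemma past_sigma_subalgebra:
  assumes "\<And>t. \<epsilon> t \<in> borel_measurable P"
  shows "subalgebra P (past_sigma P \<epsilon> t)"
proof -
  have "{\<epsilon> s -` A \<inter> space P |s A. s \<le> t \<and> A \<in> sets borel} \<subseteq> sets P"
    using assms by (auto intro: measurable_sets)
  then show ?thesis
    unfolding subalgebra_def past_sigma_def
    by (subst sets_measure_of) (auto simp: sets.sigma_sets_subset space_measure_of_conv)
qed

lemma borel_measurable_past_sigma: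
  assumes "s \<le> t"
  shows "\<epsilon> s \<in> borel_measurable (past_sigma P \<epsilon> t)"
proof (rule measurableI)
  fix A :: "real set" assume "A \<in> sets borel"
  then have "\<epsilon> s -` A \<inter> space P \<in> {\<epsilon> s -` A \<inter> space P |s A. s \<le> t \<and> A \<in> sets borel}"
    using assms by blast
  then show "\<epsilon> s -` A \<inter> space (past_sigma P \<epsilon> t) \<in> sets (past_sigma P \<epsilon> t)"
    unfolding past_sigma_def by (subst sets_measure_of) (auto simp: space_measure_of_conv)
qed simp

locale martingale_differences = prob_space P for P :: "'a measure" +
  fixes \<epsilon> :: "int \<Rightarrow> 'a \<Rightarrow> real"
  assumes umd: "unit_martingale_differences P \<epsilon>"
begin

lemma eps_meas [measurable]: "\<epsilon> t \<in> borel_measurable P"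
  and eps_integrable: "integrable P (\<epsilon> t)"
  and eps_sq_integrable: "integrable P (\<lambda>\<omega>. (\<epsilon> t \<omega>)\<^sup>2)"
  using umd by (auto simp: unit_martingale_differences_def)

lemma past_meas:
  assumes "Z \<in> borel_measurable (past_sigma P \<epsilon> t)"
  shows "Z \<in> borel_measurable P"
  by (rule measurable_from_subalg[OF past_sigma_subalgebra assms]) simp

lemma expectation_past_mult_eps:
  assumes Z: "Z \<in> borel_measurable (past_sigma P \<epsilon> (t - 1))" and "integrable P (\<lambda>\<omega>. Z \<omega> * \<epsilon> t \<omega>)"
  shows "(LINT \<omega>|P. Z \<omega> * \<epsilon> t \<omega>) = 0"
proof -
  interpret finite_measure_subalgebra P "past_sigma P \<epsilon> (t - 1)"
    by unfold_locales (auto intro!: past_sigma_subalgebra)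
  have [measurable]: "Z \<in> borel_measurable P" using Z by (rule past_meas)
  have "(LINT \<omega>|P. Z \<omega> * \<epsilon> t \<omega>) = (LINT \<omega>|P. Z \<omega> * real_cond_exp P (past_sigma P \<epsilon> (t - 1)) (\<epsilon> t) \<omega>)"
    using assms by (intro real_cond_exp_intg(2)[symmetric]) auto
  also have "\<dots> = (LINT \<omega>|P. 0)"
    using umd by (intro integral_cong_AE) (auto simp: unit_martingale_differences_def)
  finally show ?thesis by simp
qed

lemma expectation_past_mult_eps_sq:
  assumes Z: "Z \<in> borel_measurable (past_sigma P \<epsilon> (t - 1))" and "integrable P (\<lambda>\<omega>. Z \<omega> * (\<epsilon> t \<omega>)\<^sup>2)"
  shows "(LINT \<omega>|P. Z \<omega> * (\<epsilon> t \<omega>)\<^sup>2) = (LINT \<omega>|P. Z \<omega>)"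
proof -
  interpret finite_measure_subalgebra P "past_sigma P \<epsilon> (t - 1)"
    by unfold_locales (auto intro!: past_sigma_subalgebra)
  have [measurable]: "Z \<in> borel_measurable P" using Z by (rule past_meas)
  have "(LINT \<omega>|P. Z \<omega> * (\<epsilon> t \<omega>)\<^sup>2) =
      (LINT \<omega>|P. Z \<omega> * real_cond_exp P (past_sigma P \<epsilon> (t - 1)) (\<lambda>\<omega>. (\<epsilon> t \<omega>)\<^sup>2) \<omega>)"
    using assms by (intro real_cond_exp_intg(2)[symmetric]) auto
  also have "\<dots> = (LINT \<omega>|P. Z \<omega>)"
  proof (rule integral_cong_AE)
    have "AE \<omega> in P. real_cond_exp P (past_sigma P \<epsilon> (t - 1)) (\<lambda>\<omega>. (\<epsilon> t \<omega>)\<^sup>2) \<omega> = 1"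
      using umd by (simp add: unit_martingale_differences_def)
    then show "AE \<omega> in P. Z \<omega> * real_cond_exp P (past_sigma P \<epsilon> (t - 1)) (\<lambda>\<omega>. (\<epsilon> t \<omega>)\<^sup>2) \<omega> = Z \<omega>"
      by eventually_elim simp
  qed auto
  finally show ?thesis .
qed

lemma expectation_eps_sq: "(LINT \<omega>|P. (\<epsilon> t \<omega>)\<^sup>2) = 1"
  using expectation_past_mult_eps_sq[of "\<lambda>_. 1" t] eps_sq_integrable by (simp add: prob_space)

text \<open>The window starts at an integer \<open>r\<close>, possibly negative, because moving
  averages reach back before time 1.\<close>

definition wsum :: "(nat \<Rightarrow> real) \<Rightarrow> int \<Rightarrow> nat \<Rightarrow> 'a \<Rightarrow> real" where
  "wsum b r k \<omega> = (\<Sum>i<k. b i * \<epsilon> (r + int i) \<omega>)"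

lemma wsum_past: "wsum b r k \<in> borel_measurable (past_sigma P \<epsilon> (r + int k - 1))"
  unfolding wsum_def[abs_def]
  by (intro borel_measurable_sum borel_measurable_times borel_measurable_const borel_measurable_past_sigma) auto

lemma wsum_meas [measurable]: "wsum b r k \<in> borel_measurable P"
  by (rule past_meas[OF wsum_past])

lemma wsum_second_moment:
  "integrable P (\<lambda>\<omega>. (wsum b r k \<omega>)\<^sup>2) \<and> (LINT \<omega>|P. (wsum b r k \<omega>)\<^sup>2) = (\<Sum>i<k. (b i)\<^sup>2)"
proof (induction k)
  case (Suc k)
  let ?e = "\<epsilon> (r + int k)"
  have eq: "(wsum b r (Suc k) \<omega>)\<^sup>2 = (wsum b r k \<omega>)\<^sup>2 + (2 * b k) * (wsum b r k \<omega> * ?e \<omega>) + (b k)\<^sup>2 * (?e \<omega>)\<^sup>2" for \<omega>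
    by (simp add: wsum_def power2_sum power_mult_distrib)
  have int: "integrable P (\<lambda>\<omega>. wsum b r k \<omega> * ?e \<omega>)"
    using Suc.IH eps_sq_integrable by (intro integrable_mult_of_squares) auto
  have z: "(LINT \<omega>|P. wsum b r k \<omega> * ?e \<omega>) = 0"
    by (rule expectation_past_mult_eps[OF wsum_past int])
  show ?case unfolding eq using Suc.IH int z eps_sq_integrable expectation_eps_sq by simp
qed (simp add: wsum_def)

section \<open>Characteristic functions of weighted sums\<close>

lemma cis_expectation_split:
  assumes "integrable P G" "S \<in> borel_measurable P"
  shows "(LINT \<omega>|P. complex_of_real (G \<omega>) * cis (S \<omega>)) =
      Complex (LINT \<omega>|P. cos (S \<omega>) * G \<omega>) (LINT \<omega>|P. sin (S \<omega>) * G \<omega>)"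
    and "integrable P (\<lambda>\<omega>. complex_of_real (G \<omega>) * cis (S \<omega>))"
    and "integrable P (\<lambda>\<omega>. cos (S \<omega>) * G \<omega>)" "integrable P (\<lambda>\<omega>. sin (S \<omega>) * G \<omega>)"
  using integral_cis_mult[OF assms] integrable_cis_mult[OF assms] assms
    integrable_bounded_mult[OF assms(1), of "\<lambda>\<omega>. cos (S \<omega>)" 1]
    integrable_bounded_mult[OF assms(1), of "\<lambda>\<omega>. sin (S \<omega>)" 1]
  by (simp_all add: mult.commute)

text \<open>Given the past, the innovation has mean 0 and variance 1, so the second order expansion
  of \<open>cis (b * \<epsilon> t \<omega>)\<close> averages to \<open>1 - b\<^sup>2 / 2\<close>,
  which is the Gaussian factor up to \<open>b ^ 4 / 8\<close>. As the conditional variance is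
  constant, the factor is deterministic and leaves the expectation.\<close>

lemma charfun_step:
  assumes S: "S \<in> borel_measurable (past_sigma P \<epsilon> (t - 1))"
  shows "cmod ((LINT \<omega>|P. cis (S \<omega> + b * \<epsilon> t \<omega>)) - complex_of_real (exp (- b\<^sup>2 / 2)) * (LINT \<omega>|P. cis (S \<omega>)))
     \<le> b ^ 4 / 8 + (LINT \<omega>|P. min ((b * \<epsilon> t \<omega>)\<^sup>2) (\<bar>b * \<epsilon> t \<omega>\<bar> ^ 3))"
proof -
  let ?m = "\<lambda>\<omega>. min ((b * \<epsilon> t \<omega>)\<^sup>2) (\<bar>b * \<epsilon> t \<omega>\<bar> ^ 3)"
  have [measurable]: "S \<in> borel_measurable P" using S by (rule past_meas)
  have cisS: "(\<lambda>\<omega>. cos (S \<omega>)) \<in> borel_measurable (past_sigma P \<epsilon> (t - 1))"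
     "(\<lambda>\<omega>. sin (S \<omega>)) \<in> borel_measurable (past_sigma P \<epsilon> (t - 1))"
    by (rule measurable_compose[OF S borel_measurable_continuous_onI]; intro continuous_intros)+
  define \<phi> where "\<phi> = (LINT \<omega>|P. cis (S \<omega>))"
  have bnd: "integrable P (\<lambda>\<omega>. cis (g \<omega>))" if [measurable]: "g \<in> borel_measurable P" for g
    by (rule integrable_const_bound[where B = 1]) (auto simp: cis_conv_exp)
  have e1: "(LINT \<omega>|P. complex_of_real (\<epsilon> t \<omega>) * cis (S \<omega>)) = 0"
    by (subst cis_expectation_split(1)[OF eps_integrable])
       (simp_all add: expectation_past_mult_eps cisS cis_expectation_split(3,4)[OF eps_integrable] complex_eq_iff)
  have e2: "(LINT \<omega>|P. complex_of_real ((\<epsilon> t \<omega>)\<^sup>2) * cis (S \<omega>)) = \<phi>"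
    unfolding \<phi>_def using cis_expectation_split(1)[of "\<lambda>_. 1" S]
    by (subst cis_expectation_split(1)[OF eps_sq_integrable])
       (simp_all add: expectation_past_mult_eps_sq cisS cis_expectation_split(3,4)[OF eps_sq_integrable])
  \<comment> \<open>Two Taylor bounds are kept for the remainder: the cubic one is good for small
    arguments, the quadratic one needs only second moments.\<close>
  define r where "r x = cis x - (1 + \<i> * complex_of_real x - complex_of_real (x\<^sup>2) / 2)" for x :: real
  have r: "cmod (r x) \<le> min (x\<^sup>2) (\<bar>x\<bar> ^ 3)" for x
  proof -
    have "r x = iexp x - (\<Sum>k\<le>2. (\<i> * x)^k / fact k)"
      by (simp add: r_def cis_conv_exp numeral_2_eq_2 power2_eq_square algebra_simps)
    moreover have "cmod (iexp x - (\<Sum>k\<le>2. (\<i> * x)^k / fact k)) \<le> \<bar>x\<bar> ^ 3"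
    proof -
      have "\<bar>x\<bar> ^ 3 / 6 \<le> \<bar>x\<bar> ^ 3" by simp
      then show ?thesis using iexp_approx1[of x 2] by (simp add: numeral_3_eq_3 numeral_2_eq_2)
    qed
    moreover have "cmod (iexp x - (\<Sum>k\<le>2. (\<i> * x)^k / fact k)) \<le> x\<^sup>2"
      using iexp_approx2[of x 2] by (simp add: numeral_2_eq_2)
    ultimately show ?thesis by simp
  qed
  have expand: "cis (S \<omega> + b * \<epsilon> t \<omega>) = cis (S \<omega>) + (\<i> * b) * (complex_of_real (\<epsilon> t \<omega>) * cis (S \<omega>))
       - (b\<^sup>2 / 2) * (complex_of_real ((\<epsilon> t \<omega>)\<^sup>2) * cis (S \<omega>)) + cis (S \<omega>) * r (b * \<epsilon> t \<omega>)" for \<omega>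
    by (simp add: r_def cis_mult[symmetric] power_mult_distrib algebra_simps)
  have [measurable]: "r \<in> borel_measurable borel" unfolding r_def[abs_def] cis_conv_exp by measurable
  have minint: "integrable P (\<lambda>\<omega>. ?m \<omega>)"
    by (rule Bochner_Integration.integrable_bound[of _ "\<lambda>\<omega>. b\<^sup>2 * (\<epsilon> t \<omega>)\<^sup>2"])
       (auto intro!: integrable_mult_right eps_sq_integrable simp: power_mult_distrib)
  have rint: "integrable P (\<lambda>\<omega>. cis (S \<omega>) * r (b * \<epsilon> t \<omega>))"
    by (rule Bochner_Integration.integrable_bound[OF minint])
       (use r in \<open>auto simp: norm_mult cis_conv_exp\<close>)
  have ii: "integrable P (\<lambda>\<omega>. cis (S \<omega>))" "integrable P (\<lambda>\<omega>. complex_of_real (\<epsilon> t \<omega>) * cis (S \<omega>))"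
    "integrable P (\<lambda>\<omega>. complex_of_real ((\<epsilon> t \<omega>)\<^sup>2) * cis (S \<omega>))"
    by (auto intro!: bnd cis_expectation_split(2) eps_integrable eps_sq_integrable simp del: of_real_power)
  have "(LINT \<omega>|P. cis (S \<omega> + b * \<epsilon> t \<omega>)) = \<phi> - (b\<^sup>2 / 2) * \<phi> + (LINT \<omega>|P. cis (S \<omega>) * r (b * \<epsilon> t \<omega>))"
  proof -
    have "(LINT \<omega>|P. cis (S \<omega> + b * \<epsilon> t \<omega>)) = \<phi> + (\<i> * b) * 0 - (b\<^sup>2 / 2) * \<phi> + (LINT \<omega>|P. cis (S \<omega>) * r (b * \<epsilon> t \<omega>))"
      by (simp only: expand Bochner_Integration.integral_add Bochner_Integration.integral_diff
          Bochner_Integration.integrable_add Bochner_Integration.integrable_diff integrable_mult_right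
          integral_mult_right_zero ii rint e1 e2 \<phi>_def[symmetric])
    then show ?thesis by simp
  qed
  then have eqn: "(LINT \<omega>|P. cis (S \<omega> + b * \<epsilon> t \<omega>)) - complex_of_real (exp (- b\<^sup>2 / 2)) * \<phi> =
     complex_of_real (1 - b\<^sup>2 / 2 - exp (- b\<^sup>2 / 2)) * \<phi> + (LINT \<omega>|P. cis (S \<omega>) * r (b * \<epsilon> t \<omega>))"
    by (simp add: algebra_simps)
  moreover have "cmod (complex_of_real (1 - b\<^sup>2 / 2 - exp (- b\<^sup>2 / 2)) * \<phi>) \<le> b ^ 4 / 8"
  proof -
    have "cmod \<phi> \<le> (LINT \<omega>|P. cmod (cis (S \<omega>)))" unfolding \<phi>_def by (rule integral_norm_bound)
    then have p: "cmod \<phi> \<le> 1" by (simp add: prob_space)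
    have q: "\<bar>exp (- y) - 1 + y\<bar> \<le> y\<^sup>2 / 2" if "y \<ge> 0" for y :: real
    proof -
      have "exp (- y) \<ge> 1 - y" using exp_ge_add_one_self[of "-y"] by simp
      moreover have "exp (- y) \<le> 1 - y + y\<^sup>2 / 2"
      proof -
        have "exp (- y) - (1 - y + y\<^sup>2 / 2) \<le> exp (- 0) - (1 - 0 + 0\<^sup>2 / 2)"
        proof (rule DERIV_nonpos_imp_nonincreasing[OF that])
          fix x :: real assume "0 \<le> x" "x \<le> y"
          have "((\<lambda>y. exp (- y) - (1 - y + y\<^sup>2 / 2)) has_real_derivative (- exp (- x) + 1 - x)) (at x)"
            by (auto intro!: derivative_eq_intros)
          moreover have "- exp (- x) + 1 - x \<le> 0" using exp_ge_add_one_self[of "-x"] by simp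
          ultimately show "\<exists>d. ((\<lambda>y. exp (- y) - (1 - y + y\<^sup>2 / 2)) has_real_derivative d) (at x) \<and> d \<le> 0" by blast
        qed
        then show ?thesis by simp
      qed
      ultimately show ?thesis by (simp add: abs_le_iff)
    qed
    have "\<bar>1 - b\<^sup>2 / 2 - exp (- b\<^sup>2 / 2)\<bar> \<le> b ^ 4 / 8"
    proof -
      have "\<bar>1 - b\<^sup>2 / 2 - exp (- b\<^sup>2 / 2)\<bar> = \<bar>exp (- (b\<^sup>2 / 2)) - 1 + b\<^sup>2 / 2\<bar>" by simp
      also have "\<dots> \<le> (b\<^sup>2 / 2)\<^sup>2 / 2" by (rule q) simp
      also have "\<dots> = b ^ 4 / 8" by (simp add: power_divide)
      finally show ?thesis .
    qed
    then have "\<bar>1 - b\<^sup>2 / 2 - exp (- b\<^sup>2 / 2)\<bar> * cmod \<phi> \<le> b ^ 4 / 8 * 1" using p by (intro mult_mono) auto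
    then show ?thesis by (simp only: norm_mult norm_of_real mult_1_right)
  qed
  moreover have "cmod (LINT \<omega>|P. cis (S \<omega>) * r (b * \<epsilon> t \<omega>)) \<le> (LINT \<omega>|P. ?m \<omega>)"
  proof -
    have "cmod (LINT \<omega>|P. cis (S \<omega>) * r (b * \<epsilon> t \<omega>)) \<le> (LINT \<omega>|P. cmod (cis (S \<omega>) * r (b * \<epsilon> t \<omega>)))"
      by (rule integral_norm_bound)
    also have "\<dots> \<le> (LINT \<omega>|P. ?m \<omega>)"
      by (rule integral_mono[OF integrable_norm[OF rint] minint]) (use r in \<open>simp add: norm_mult\<close>)
    finally show ?thesis .
  qed
  ultimately show ?thesis
    unfolding \<phi>_def[symmetric] eqn
    using norm_triangle_ineq[of "complex_of_real (1 - b\<^sup>2 / 2 - exp (- b\<^sup>2 / 2)) * \<phi>" "LINT \<omega>|P. cis (S \<omega>) * r (b * \<epsilon> t \<omega>)"]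
    by linarith
qed

text \<open>The last summand is replaced by its Gaussian factor; as that factor lies between 0 and
  1, earlier errors do not grow, and the one-step errors add up.\<close>

lemma charfun_wsum:
  "cmod ((LINT \<omega>|P. cis (wsum b r k \<omega>)) - complex_of_real (exp (- (\<Sum>i<k. (b i)\<^sup>2) / 2)))
     \<le> (\<Sum>i<k. (b i) ^ 4 / 8 + (LINT \<omega>|P. min ((b i * \<epsilon> (r + int i) \<omega>)\<^sup>2) (\<bar>b i * \<epsilon> (r + int i) \<omega>\<bar> ^ 3)))"
proof (induction k)
  case (Suc k)
  define A where "A = (LINT \<omega>|P. cis (wsum b r k \<omega>))"
  define q where "q = exp (- (b k)\<^sup>2 / 2)"
  define E0 where "E0 = exp (- (\<Sum>i<k. (b i)\<^sup>2) / 2)"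
  have q: "0 \<le> q" "q \<le> 1" by (auto simp: q_def)
  have e: "exp (- (\<Sum>i<Suc k. (b i)\<^sup>2) / 2) = q * E0"
    by (simp add: q_def E0_def exp_add[symmetric] add_divide_distrib diff_divide_distrib)
  have "(LINT \<omega>|P. cis (wsum b r (Suc k) \<omega>)) = (LINT \<omega>|P. cis (wsum b r k \<omega> + b k * \<epsilon> (r + int k) \<omega>))"
    by (simp add: wsum_def)
  then have 1: "cmod ((LINT \<omega>|P. cis (wsum b r (Suc k) \<omega>)) - q * A) \<le> (b k) ^ 4 / 8 + (LINT \<omega>|P. min ((b k * \<epsilon> (r + int k) \<omega>)\<^sup>2) (\<bar>b k * \<epsilon> (r + int k) \<omega>\<bar> ^ 3))"
    using charfun_step[OF wsum_past, of b r k "b k"] by (simp add: A_def q_def)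
  have "cmod (q * A - q * E0) = q * cmod (A - E0)"
  proof -
    have "complex_of_real q * A - complex_of_real (q * E0) = complex_of_real q * (A - complex_of_real E0)"
      by (simp add: right_diff_distrib)
    then show ?thesis using q by (simp only: norm_mult norm_of_real abs_of_nonneg)
  qed
  also have "\<dots> \<le> 1 * cmod (A - E0)" using q by (intro mult_right_mono) auto
  finally have 2: "cmod (q * A - q * E0) \<le> cmod (A - E0)" by simp
  have "cmod ((LINT \<omega>|P. cis (wsum b r (Suc k) \<omega>)) - complex_of_real (exp (- (\<Sum>i<Suc k. (b i)\<^sup>2) / 2))) \<le>
     cmod ((LINT \<omega>|P. cis (wsum b r (Suc k) \<omega>)) - q * A) + cmod (q * A - q * E0)"
    unfolding e of_real_mult by (rule norm_diff_triangle_ineq[of _ "q * A" "q * A", simplified])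
  then show ?case using 1 2 Suc.IH[folded A_def E0_def] unfolding sum.lessThan_Suc by linarith
qed (simp add: wsum_def prob_space)

end

section \<open>Uniform integrability from tail domination\<close>

lemma nn_integral_layer_cake:
  fixes f :: "'b \<Rightarrow> real"
  assumes "sigma_finite_measure M" and [measurable]: "f \<in> borel_measurable M"
  shows "(\<integral>\<^sup>+x. ennreal (f x) \<partial>M) = (\<integral>\<^sup>+t. indicator {0..} t * emeasure M {x\<in>space M. t < f x} \<partial>lborel)"
proof -
  let ?k = "\<lambda>x t. indicator {0..} t * indicator {x\<in>space M. t < f x} x :: ennreal"
  interpret M: sigma_finite_measure M by fact
  interpret pair_sigma_finite M lborel by unfold_locales
  have "(\<integral>\<^sup>+x. ennreal (f x) \<partial>M) = (\<integral>\<^sup>+x. (\<integral>\<^sup>+t. ?k x t \<partial>lborel) \<partial>M)"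
  proof (rule nn_integral_cong)
    fix x assume x: "x \<in> space M"
    have "(\<integral>\<^sup>+t. ?k x t \<partial>lborel) = (\<integral>\<^sup>+t. indicator {0..<f x} t \<partial>lborel)"
      using x by (intro nn_integral_cong) (auto simp: indicator_def)
    \<comment> \<open>Where \<open>f x\<close> is negative both sides are 0: \<open>ennreal\<close>
      cuts it off, and the interval of levels is empty.\<close>
    also have "\<dots> = ennreal (f x)" 
      by (cases "f x \<ge> 0") (auto simp: ennreal_neg)
    finally show "ennreal (f x) = (\<integral>\<^sup>+t. ?k x t \<partial>lborel)" ..
  qed
  also have "\<dots> = (\<integral>\<^sup>+t. (\<integral>\<^sup>+x. ?k x t \<partial>M) \<partial>lborel)"
  proof (rule Fubini'[symmetric])
    have "(\<lambda>(x, t). ?k x t) \<in> borel_measurable (M \<Otimes>\<^sub>M lborel)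
        \<longleftrightarrow> (\<lambda>p. indicator {p \<in> space (M \<Otimes>\<^sub>M lborel). 0 \<le> snd p \<and> snd p < f (fst p)} p :: ennreal) \<in> borel_measurable (M \<Otimes>\<^sub>M lborel)"
      by (intro measurable_cong) (auto simp: indicator_def space_pair_measure)
    moreover have "(\<lambda>p. indicator {p \<in> space (M \<Otimes>\<^sub>M lborel). 0 \<le> snd p \<and> snd p < f (fst p)} p :: ennreal) \<in> borel_measurable (M \<Otimes>\<^sub>M lborel)"
      by measurable
    ultimately show "(\<lambda>(x, t). ?k x t) \<in> borel_measurable (M \<Otimes>\<^sub>M lborel)" by simp
  qed
  also have "\<dots> = (\<integral>\<^sup>+t. indicator {0..} t * emeasure M {x\<in>space M. t < f x} \<partial>lborel)"
    by (intro nn_integral_cong) (simp add: nn_integral_cmult)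
  finally show ?thesis .
qed

text \<open>Truncated second moments are integrals of tail probabilities, so the domination passes
  to them with the same factor \<open>K\<close>. The truncated second moment of the single variable
  \<open>e\<close> tends to 0, which gives one \<open>L\<close> for all \<open>t\<close>.\<close>

lemma tail_dominated_uniformly_integrable:
  assumes "prob_space P" and [measurable]: "\<And>t. \<epsilon> t \<in> borel_measurable P"
    and sq: "\<And>t. integrable P (\<lambda>\<omega>. (\<epsilon> t \<omega>)\<^sup>2)"
    and td: "tail_dominated P \<epsilon>" and \<eta>: "\<eta> > 0"
  shows "\<exists>L>0. \<forall>t. (LINT \<omega>|P. (\<epsilon> t \<omega>)\<^sup>2 * indicator {L<..} \<bar>\<epsilon> t \<omega>\<bar>) \<le> \<eta>"
proof -
  interpret prob_space P by fact
  obtain e K where e[measurable]: "e \<in> borel_measurable P" and e2: "integrable P (\<lambda>\<omega>. (e \<omega>)\<^sup>2)" and K: "0 < K"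
    and dom: "\<And>x t. x > 0 \<Longrightarrow> measure P {\<omega>\<in>space P. \<bar>\<epsilon> t \<omega>\<bar> > x} \<le> K * measure P {\<omega>\<in>space P. \<bar>e \<omega>\<bar> > x}"
    using td unfolding tail_dominated_def by blast
  define h where "h L x = x\<^sup>2 * indicator {L<..} \<bar>x\<bar>" for L x :: real
  have [measurable]: "h L \<in> borel_measurable borel" for L unfolding h_def[abs_def] by measurable
  \<comment> \<open>The level sets of the truncated square are again tails of the modulus, at level
    \<open>max L (sqrt s)\<close>. For positive \<open>L\<close> this level is positive even at
    \<open>s = 0\<close>, as the domination hypothesis demands.\<close>
  have hlevel: "s < h L x \<longleftrightarrow> max L (sqrt s) < \<bar>x\<bar>" if "s \<ge> 0" for s L x
  proof (cases "L < \<bar>x\<bar>")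
    case True
    have "s < x\<^sup>2 \<longleftrightarrow> sqrt s < \<bar>x\<bar>" using that by (metis abs_ge_zero real_sqrt_abs real_sqrt_less_iff)
    then show ?thesis using True by (simp add: h_def)
  qed (use that in \<open>simp add: h_def\<close>)
  have hint: "integrable P (\<lambda>\<omega>. h L (Y \<omega>))" if "integrable P (\<lambda>\<omega>. (Y \<omega>)\<^sup>2)" "Y \<in> borel_measurable P" for Y L
    by (rule Bochner_Integration.integrable_bound[OF that(1)]) (use that in \<open>auto simp: h_def indicator_def\<close>)
  have hn: "h L x \<ge> 0" for L x by (simp add: h_def)
  have comp: "(LINT \<omega>|P. h L (\<epsilon> t \<omega>)) \<le> K * (LINT \<omega>|P. h L (e \<omega>))" if L: "L > 0" for L t
  proof -
    have "(\<integral>\<^sup>+\<omega>. ennreal (h L (\<epsilon> t \<omega>)) \<partial>P) = (\<integral>\<^sup>+s. indicator {0..} s * emeasure P {\<omega>\<in>space P. s < h L (\<epsilon> t \<omega>)} \<partial>lborel)"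
      by (intro nn_integral_layer_cake) (auto intro: sigma_finite_measure_axioms)
    also have "\<dots> \<le> (\<integral>\<^sup>+s. ennreal K * (indicator {0..} s * emeasure P {\<omega>\<in>space P. s < h L (e \<omega>)}) \<partial>lborel)"
    proof (rule nn_integral_mono)
      fix s :: real
      show "indicator {0..} s * emeasure P {\<omega>\<in>space P. s < h L (\<epsilon> t \<omega>)} \<le>
        ennreal K * (indicator {0..} s * emeasure P {\<omega>\<in>space P. s < h L (e \<omega>)})"
      proof (cases "s \<ge> 0")
        case True
        have "max L (sqrt s) > 0" using L by simp
        from dom[OF this, of t] K have "emeasure P {\<omega>\<in>space P. max L (sqrt s) < \<bar>\<epsilon> t \<omega>\<bar>} \<le> ennreal K * emeasure P {\<omega>\<in>space P. max L (sqrt s) < \<bar>e \<omega>\<bar>}"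
          by (simp add: emeasure_eq_measure ennreal_mult[symmetric] ennreal_leI)
        then show ?thesis using True by (simp only: hlevel) simp
      qed simp
    qed
    also have "\<dots> = ennreal K * (\<integral>\<^sup>+s. indicator {0..} s * emeasure P {\<omega>\<in>space P. s < h L (e \<omega>)} \<partial>lborel)"
    proof (rule nn_integral_cmult)
      have "(\<lambda>s. emeasure P {\<omega>\<in>space P. s < h L (e \<omega>)}) \<in> borel_measurable lborel"
        by measurable
      then show "(\<lambda>s. indicator {0..} s * emeasure P {\<omega>\<in>space P. s < h L (e \<omega>)}) \<in> borel_measurable lborel"
        by measurable
    qed
    also have "(\<integral>\<^sup>+s. indicator {0..} s * emeasure P {\<omega>\<in>space P. s < h L (e \<omega>)} \<partial>lborel) = (\<integral>\<^sup>+\<omega>. ennreal (h L (e \<omega>)) \<partial>P)"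
      by (intro nn_integral_layer_cake[symmetric]) (auto intro: sigma_finite_measure_axioms)
    also have "(\<integral>\<^sup>+\<omega>. ennreal (h L (e \<omega>)) \<partial>P) = ennreal (LINT \<omega>|P. h L (e \<omega>))"
      by (rule nn_integral_eq_integral) (auto intro!: hint e2 simp: hn)
    also have "(\<integral>\<^sup>+\<omega>. ennreal (h L (\<epsilon> t \<omega>)) \<partial>P) = ennreal (LINT \<omega>|P. h L (\<epsilon> t \<omega>))"
      by (rule nn_integral_eq_integral) (auto intro!: hint sq simp: hn)
    finally show ?thesis using K by (simp add: ennreal_mult[symmetric] hn)
  qed
  have "(\<lambda>k. LINT \<omega>|P. h (real k) (e \<omega>)) \<longlonglongrightarrow> (LINT \<omega>|P. 0)"
  proof (rule integral_dominated_convergence[OF _ _ e2])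
    show "AE \<omega> in P. (\<lambda>k. h (real k) (e \<omega>)) \<longlonglongrightarrow> 0"
    proof (rule AE_I2, rule tendsto_eventually)
      fix \<omega>
      obtain k0 where "\<bar>e \<omega>\<bar> \<le> real k0" using real_arch_simple by blast
      then show "\<forall>\<^sub>F k in sequentially. h (real k) (e \<omega>) = 0"
        by (auto simp: h_def eventually_sequentially intro!: exI[of _ k0])
    qed
  qed (auto simp: h_def indicator_def)
  then have "(\<lambda>k. K * (LINT \<omega>|P. h (real k) (e \<omega>))) \<longlonglongrightarrow> K * 0" by (intro tendsto_intros) simp
  then have "\<forall>\<^sub>F k in sequentially. K * (LINT \<omega>|P. h (real k) (e \<omega>)) < \<eta>" using \<eta> by (intro order_tendstoD(2)) auto
  moreover have "\<forall>\<^sub>F k in sequentially. (1::nat) \<le> k" by (rule eventually_ge_at_top)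
  ultimately have "\<forall>\<^sub>F k in sequentially. K * (LINT \<omega>|P. h (real k) (e \<omega>)) < \<eta> \<and> 1 \<le> k" by eventually_elim simp
  then obtain k where k: "K * (LINT \<omega>|P. h (real k) (e \<omega>)) < \<eta>" "1 \<le> k"
    using eventually_happens'[OF sequentially_bot] by blast
  show ?thesis
  proof (intro exI[of _ "real k"] conjI allI)
    fix t
    show "(LINT \<omega>|P. (\<epsilon> t \<omega>)\<^sup>2 * indicator {real k<..} \<bar>\<epsilon> t \<omega>\<bar>) \<le> \<eta>"
      using comp[of "real k" t] k unfolding h_def by simp
  qed (use k in simp)
qed

context martingale_differences
begin

text \<open>Where the innovation is at most \<open>L\<close> in modulus, the cubic bound gains a
  factor \<open>\<bar>b\<bar> * L\<close>; beyond \<open>L\<close> the quadratic bound leaves a tail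
  of the second moment, at most \<open>\<eta> / 2\<close> by uniform integrability. The witness
  \<open>\<eta> / (2 * L)\<close> gives the first part the other half.\<close>

lemma third_order_error_small:
  assumes td: "tail_dominated P \<epsilon>" and \<eta>: "\<eta> > 0"
  shows "\<exists>\<beta>>0. \<forall>t b. \<bar>b\<bar> \<le> \<beta> \<longrightarrow> (LINT \<omega>|P. min ((b * \<epsilon> t \<omega>)\<^sup>2) (\<bar>b * \<epsilon> t \<omega>\<bar> ^ 3)) \<le> \<eta> * b\<^sup>2"
proof -
  let ?m = "\<lambda>t b \<omega>. min ((b * \<epsilon> t \<omega>)\<^sup>2) (\<bar>b * \<epsilon> t \<omega>\<bar> ^ 3)"
  let ?q = "\<lambda>L t \<omega>. (\<epsilon> t \<omega>)\<^sup>2 * indicator {L<..} \<bar>\<epsilon> t \<omega>\<bar>"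
  have "\<eta> / 2 > 0" using \<eta> by simp
  from tail_dominated_uniformly_integrable[OF prob_space_axioms eps_meas eps_sq_integrable td this]
  obtain L where L: "L > 0" "\<And>t. (LINT \<omega>|P. ?q L t \<omega>) \<le> \<eta> / 2" by blast
  show ?thesis
  proof (intro exI[of _ "\<eta> / (2 * L)"] conjI allI impI)
    show "\<eta> / (2 * L) > 0" using \<eta> L by simp
    fix t b assume b: "\<bar>b\<bar> \<le> \<eta> / (2 * L)"
    have ii: "integrable P (\<lambda>\<omega>. ?q L t \<omega>)"
      by (rule Bochner_Integration.integrable_bound[OF eps_sq_integrable[of t]]) (auto simp: indicator_def)
    have pw: "?m t b \<omega> \<le>
       (b\<^sup>2 * (\<bar>b\<bar> * L)) * (\<epsilon> t \<omega>)\<^sup>2 + b\<^sup>2 * ?q L t \<omega>" for \<omega>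
    proof (cases "\<bar>\<epsilon> t \<omega>\<bar> \<le> L")
      case True
      have "\<bar>b * \<epsilon> t \<omega>\<bar> ^ 3 = (b\<^sup>2 * (\<epsilon> t \<omega>)\<^sup>2) * (\<bar>b\<bar> * \<bar>\<epsilon> t \<omega>\<bar>)"
      proof -
        have "\<bar>y\<bar> ^ 3 = y\<^sup>2 * \<bar>y\<bar>" for y :: real by (simp add: power3_eq_cube power2_eq_square)
        then show ?thesis by (simp add: power_mult_distrib abs_mult)
      qed
      also have "\<dots> \<le> (b\<^sup>2 * (\<epsilon> t \<omega>)\<^sup>2) * (\<bar>b\<bar> * L)" using True by (intro mult_left_mono) auto
      finally show ?thesis using True by (simp add: mult_ac)
    next
      case False
      have "0 \<le> (b\<^sup>2 * (\<bar>b\<bar> * L)) * (\<epsilon> t \<omega>)\<^sup>2" using L(1) by simp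
      then have "(b * \<epsilon> t \<omega>)\<^sup>2 \<le> (b\<^sup>2 * (\<bar>b\<bar> * L)) * (\<epsilon> t \<omega>)\<^sup>2 + b\<^sup>2 * ?q L t \<omega>"
        using False by (simp add: power_mult_distrib)
      then show ?thesis by (rule min.coboundedI1)
    qed
    have "(LINT \<omega>|P. ?m t b \<omega>) \<le>
      (LINT \<omega>|P. (b\<^sup>2 * (\<bar>b\<bar> * L)) * (\<epsilon> t \<omega>)\<^sup>2 + b\<^sup>2 * ?q L t \<omega>)"
    proof (rule integral_mono[OF _ _ pw])
      show "integrable P (\<lambda>\<omega>. ?m t b \<omega>)"
        by (rule Bochner_Integration.integrable_bound[of _ "\<lambda>\<omega>. b\<^sup>2 * (\<epsilon> t \<omega>)\<^sup>2"])
           (auto intro!: integrable_mult_right eps_sq_integrable simp: power_mult_distrib)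
    qed (intro Bochner_Integration.integrable_add integrable_mult_right eps_sq_integrable ii)
    also have "\<dots> = (b\<^sup>2 * (\<bar>b\<bar> * L)) * 1 + b\<^sup>2 * (LINT \<omega>|P. ?q L t \<omega>)"
      by (simp only: Bochner_Integration.integral_add integrable_mult_right eps_sq_integrable ii
          integral_mult_right_zero expectation_eps_sq)
    also have "\<dots> \<le> b\<^sup>2 * (\<eta> / 2) + b\<^sup>2 * (\<eta> / 2)"
    proof (rule add_mono)
      have "\<bar>b\<bar> * L \<le> \<eta> / 2" using b L by (simp add: field_simps)
      then show "(b\<^sup>2 * (\<bar>b\<bar> * L)) * 1 \<le> b\<^sup>2 * (\<eta> / 2)" unfolding mult_1_right by (intro mult_left_mono) auto
      show "b\<^sup>2 * (LINT \<omega>|P. ?q L t \<omega>) \<le> b\<^sup>2 * (\<eta> / 2)"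
        by (intro mult_left_mono L) simp
    qed
    finally show "(LINT \<omega>|P. ?m t b \<omega>) \<le> \<eta> * b\<^sup>2" by (simp add: mult.commute)
  qed
qed

text \<open>A Lindeberg type central limit theorem: with uniformly small weights, each one-step
  error is at most a small multiple of \<open>(b n i)\<^sup>2\<close>, and these squares have
  bounded sum.\<close>

lemma charfun_wsum_limit:
  assumes td: "tail_dominated P \<epsilon>"
    and small: "\<And>\<beta>. \<beta> > 0 \<Longrightarrow> \<forall>\<^sub>F n in sequentially. \<forall>i<k n. \<bar>b n i\<bar> \<le> \<beta>"
    and lim: "(\<lambda>n. \<Sum>i<k n. (b n i)\<^sup>2) \<longlonglongrightarrow> v"
  shows "(\<lambda>n. LINT \<omega>|P. cis (wsum (b n) (r n) (k n) \<omega>)) \<longlonglongrightarrow> complex_of_real (exp (- v / 2))"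
proof -
  let ?m = "\<lambda>n i \<omega>. min ((b n i * \<epsilon> (r n + int i) \<omega>)\<^sup>2) (\<bar>b n i * \<epsilon> (r n + int i) \<omega>\<bar> ^ 3)"
  have v: "v \<ge> 0" using lim by (rule LIMSEQ_le_const) (auto intro!: sum_nonneg)
  define A where "A n = (LINT \<omega>|P. cis (wsum (b n) (r n) (k n) \<omega>)) - complex_of_real (exp (- (\<Sum>i<k n. (b n i)\<^sup>2) / 2))" for n
  have "A \<longlonglongrightarrow> 0"
  proof (rule LIMSEQ_I)
    fix e :: real assume e: "e > 0"
    \<comment> \<open>Each error will be at most \<open>2 * \<eta> * (b n i)\<^sup>2\<close> and the
      squares sum to less than \<open>v + 1\<close>, so the total is at most \<open>e / 2\<close>.
      The cap at 1 serves to derive \<open>(b n i)\<^sup>2 \<le> \<eta>\<close> from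
      \<open>\<bar>b n i\<bar> \<le> \<eta>\<close>.\<close>
    define \<eta> where "\<eta> = min 1 (e / (4 * (v + 1)))"
    have \<eta>: "\<eta> > 0" "\<eta> \<le> 1" "\<eta> * (v + 1) \<le> e / 4"
    proof -
      show "\<eta> > 0" "\<eta> \<le> 1" using e v by (auto simp: \<eta>_def)
      have "\<eta> * (v + 1) \<le> (e / (4 * (v + 1))) * (v + 1)" using v by (intro mult_right_mono) (auto simp: \<eta>_def)
      also have "\<dots> = e / 4" using v by (simp add: field_simps)
      finally show "\<eta> * (v + 1) \<le> e / 4" .
    qed
    obtain \<beta> where \<beta>: "\<beta> > 0" "\<And>t x. \<bar>x\<bar> \<le> \<beta> \<Longrightarrow> (LINT \<omega>|P. min ((x * \<epsilon> t \<omega>)\<^sup>2) (\<bar>x * \<epsilon> t \<omega>\<bar> ^ 3)) \<le> \<eta> * x\<^sup>2"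
      using third_order_error_small[OF td \<eta>(1)] by blast
    have "\<forall>\<^sub>F n in sequentially. \<forall>i<k n. \<bar>b n i\<bar> \<le> min \<beta> \<eta>" using \<beta> \<eta> by (intro small) auto
    moreover have "\<forall>\<^sub>F n in sequentially. (\<Sum>i<k n. (b n i)\<^sup>2) < v + 1" by (rule order_tendstoD(2)[OF lim]) simp
    ultimately have "\<forall>\<^sub>F n in sequentially. norm (A n - 0) < e"
    proof eventually_elim
      case (elim n)
      have "cmod (A n) \<le> (\<Sum>i<k n. (b n i) ^ 4 / 8 + (LINT \<omega>|P. ?m n i \<omega>))"
        unfolding A_def by (rule charfun_wsum)
      also have "\<dots> \<le> (\<Sum>i<k n. 2 * \<eta> * (b n i)\<^sup>2)"
      proof (rule sum_mono)
        fix i assume i: "i \<in> {..<k n}"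
        have bi: "\<bar>b n i\<bar> \<le> \<beta>" "\<bar>b n i\<bar> \<le> \<eta>" using elim i by auto
        have "(b n i)\<^sup>2 \<le> \<eta>"
        proof -
          have "\<bar>b n i\<bar> * \<bar>b n i\<bar> \<le> \<eta> * 1" using bi \<eta> by (intro mult_mono) auto
          then show ?thesis by (simp add: power2_eq_square)
        qed
        then have *: "(b n i)\<^sup>2 * (b n i)\<^sup>2 \<le> \<eta> * (b n i)\<^sup>2" by (intro mult_right_mono) auto
        have "(b n i) ^ 4 / 8 \<le> \<eta> * (b n i)\<^sup>2"
        proof -
          have "(b n i) ^ 4 = (b n i)\<^sup>2 * (b n i)\<^sup>2" by (simp add: power2_eq_square power4_eq_xxxx mult.assoc)
          moreover have "0 \<le> (b n i)\<^sup>2 * (b n i)\<^sup>2" by simp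
          ultimately show ?thesis using * by linarith
        qed
        moreover have "(LINT \<omega>|P. ?m n i \<omega>) \<le> \<eta> * (b n i)\<^sup>2"
          by (rule \<beta>(2)[OF bi(1)])
        ultimately show "(b n i) ^ 4 / 8 + (LINT \<omega>|P. ?m n i \<omega>) \<le> 2 * \<eta> * (b n i)\<^sup>2"
          by linarith
      qed
      also have "\<dots> = 2 * (\<eta> * (\<Sum>i<k n. (b n i)\<^sup>2))" by (simp add: sum_distrib_left mult.assoc)
      also have "\<dots> \<le> 2 * (\<eta> * (v + 1))" using elim \<eta> by (intro mult_left_mono) auto
      also have "\<dots> < e" using \<eta>(3) e by linarith
      finally show ?case by simp
    qed
    then show "\<exists>no. \<forall>n\<ge>no. norm (A n - 0) < e" by (simp add: eventually_sequentially)
  qed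
  moreover have "(\<lambda>n. complex_of_real (exp (- (\<Sum>i<k n. (b n i)\<^sup>2) / 2))) \<longlonglongrightarrow> complex_of_real (exp (- v / 2))"
    by (intro tendsto_intros lim) auto
  ultimately have "(\<lambda>n. A n + complex_of_real (exp (- (\<Sum>i<k n. (b n i)\<^sup>2) / 2))) \<longlonglongrightarrow> 0 + complex_of_real (exp (- v / 2))"
    by (rule tendsto_add)
  then show ?thesis by (simp add: A_def)
qed

section \<open>Linear processes as weighted sums of innovations\<close>

definition ma_trunc :: "(nat \<Rightarrow> real) \<Rightarrow> nat \<Rightarrow> int \<Rightarrow> 'a \<Rightarrow> real" where
  "ma_trunc c N s \<omega> = (\<Sum>j<N. c j * \<epsilon> (s - int j) \<omega>)"

text \<open>Coefficient of the innovation at time \<open>1 - int N + int i\<close> once the double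
  sum over times and lags is ordered by innovations; the filter keeps the lags from 0 to
  \<open>N - 1\<close>.\<close>

definition ma_coeff :: "(nat \<Rightarrow> real) \<Rightarrow> nat \<Rightarrow> (nat \<Rightarrow> real) \<Rightarrow> nat \<Rightarrow> nat \<Rightarrow> real" where
  "ma_coeff c N w n i = (\<Sum>s\<in>{s\<in>{1..n}. 0 \<le> int s - (1 - int N + int i) \<and> int s - (1 - int N + int i) < int N}.
      w s * c (nat (int s - (1 - int N + int i))))"

lemma ma_trunc_meas [measurable]: "ma_trunc c N s \<in> borel_measurable P"
  unfolding ma_trunc_def[abs_def] by measurable

text \<open>The \<open>n + N\<close> times from \<open>1 - N\<close> to \<open>n\<close> cover all
  innovations involved. The earliest has lag at least \<open>N\<close> from every \<open>s\<close>,
  so its coefficient is an empty sum.\<close>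

lemma weighted_ma_trunc:
  "(\<Sum>s=1..n. w s * ma_trunc c N (int s) \<omega>) = wsum (ma_coeff c N w n) (1 - int N) (n + N) \<omega>"
proof -
  define q where "q i = 1 - int N + int i" for i
  define A where "A s i \<longleftrightarrow> 0 \<le> int s - q i \<and> int s - q i < int N" for s i
  have "wsum (ma_coeff c N w n) (1 - int N) (n + N) \<omega> =
     (\<Sum>i<n+N. (\<Sum>s=1..n. if A s i then w s * c (nat (int s - q i)) * \<epsilon> (q i) \<omega> else 0))"
    unfolding wsum_def ma_coeff_def q_def[symmetric] A_def[symmetric] sum_distrib_right
    by (rule sum.cong[OF refl], subst sum.inter_filter) simp_all
  also have "\<dots> = (\<Sum>s=1..n. (\<Sum>i<n+N. if A s i then w s * c (nat (int s - q i)) * \<epsilon> (q i) \<omega> else 0))"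
    by (rule sum.swap)
  also have "\<dots> = (\<Sum>s=1..n. w s * ma_trunc c N (int s) \<omega>)"
  proof (rule sum.cong[OF refl])
    fix s assume s: "s \<in> {1..n}"
    have "(\<Sum>i<n+N. if A s i then w s * c (nat (int s - q i)) * \<epsilon> (q i) \<omega> else 0) =
       (\<Sum>i\<in>{i\<in>{..<n+N}. A s i}. w s * c (nat (int s - q i)) * \<epsilon> (q i) \<omega>)"
      by (rule sum.inter_filter[symmetric]) simp
    also have "\<dots> = (\<Sum>j<N. w s * c j * \<epsilon> (int s - int j) \<omega>)"
      by (rule sum.reindex_bij_witness[of _ "\<lambda>j. nat (int s - int j - 1 + int N)" "\<lambda>i. nat (int s - q i)"])
         (use s in \<open>auto simp: A_def q_def algebra_simps\<close>)
    finally show "(\<Sum>i<n+N. if A s i then w s * c (nat (int s - q i)) * \<epsilon> (q i) \<omega> else 0) = w s * ma_trunc c N (int s) \<omega>"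
      by (simp add: ma_trunc_def sum_distrib_left mult.assoc)
  qed
  finally show ?thesis ..
qed

text \<open>The sequence \<open>c\<close> is square summable but perhaps not absolutely summable, so
  the uniform bound \<open>\<rho>\<close> on the weights helps for finitely many lags only; lags
  from \<open>J\<close> on are handled by Cauchy-Schwarz. The bound depends neither on
  \<open>N\<close> nor on \<open>i\<close>.\<close>

lemma ma_coeff_bound:
  assumes w: "\<And>s. s \<in> {1..n} \<Longrightarrow> \<bar>w s\<bar> \<le> \<rho>" and "\<rho> \<ge> 0" and c: "summable (\<lambda>j. (c j)\<^sup>2)"
  shows "\<bar>ma_coeff c N w n i\<bar> \<le> \<rho> * (\<Sum>j<J. \<bar>c j\<bar>) + sqrt (\<Sum>s=1..n. (w s)\<^sup>2) * sqrt (\<Sum>j. (c (j + J))\<^sup>2)"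
proof -
  define z where "z s = int s - (1 - int N + int i)" for s :: nat
  define S where "S = {s\<in>{1..n}. 0 \<le> z s \<and> z s < int N}"
  define A where "A = {s\<in>S. z s < int J}"
  define B where "B = {s\<in>S. \<not> z s < int J}"
  have fin: "finite A" "finite B" by (auto simp: A_def B_def S_def)
  have inj: "inj_on (\<lambda>s. nat (z s)) A" "inj_on (\<lambda>s. nat (z s) - J) B"
    by (auto simp: inj_on_def A_def B_def S_def z_def)
  have "ma_coeff c N w n i = (\<Sum>s\<in>S. w s * c (nat (z s)))" by (simp add: ma_coeff_def S_def z_def)
  also have "S = A \<union> B" by (auto simp: A_def B_def)
  also have "(\<Sum>s\<in>A \<union> B. w s * c (nat (z s))) = (\<Sum>s\<in>A. w s * c (nat (z s))) + (\<Sum>s\<in>B. w s * c (nat (z s)))"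
    using fin by (intro sum.union_disjoint) (auto simp: A_def B_def)
  finally have split: "ma_coeff c N w n i = (\<Sum>s\<in>A. w s * c (nat (z s))) + (\<Sum>s\<in>B. w s * c (nat (z s)))" .
  have "\<bar>\<Sum>s\<in>A. w s * c (nat (z s))\<bar> \<le> (\<Sum>s\<in>A. \<rho> * \<bar>c (nat (z s))\<bar>)"
    by (rule order.trans[OF sum_abs]) (auto intro!: sum_mono mult_right_mono w simp: abs_mult A_def S_def)
  also have "\<dots> = \<rho> * (\<Sum>j\<in>(\<lambda>s. nat (z s)) ` A. \<bar>c j\<bar>)"
    by (simp add: sum.reindex[OF inj(1)] sum_distrib_left)
  also have "\<dots> \<le> \<rho> * (\<Sum>j<J. \<bar>c j\<bar>)"
    using assms(2) by (intro mult_left_mono sum_mono2) (auto simp: A_def S_def)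
  finally have a: "\<bar>\<Sum>s\<in>A. w s * c (nat (z s))\<bar> \<le> \<rho> * (\<Sum>j<J. \<bar>c j\<bar>)" .
  have "(\<Sum>s\<in>B. w s * c (nat (z s)))\<^sup>2 \<le> (\<Sum>s\<in>B. (w s)\<^sup>2) * (\<Sum>s\<in>B. (c (nat (z s)))\<^sup>2)"
    by (rule Cauchy_Schwarz_ineq_sum)
  also have "\<dots> \<le> (\<Sum>s=1..n. (w s)\<^sup>2) * (\<Sum>j. (c (j + J))\<^sup>2)"
  proof (intro mult_mono)
    show "(\<Sum>s\<in>B. (w s)\<^sup>2) \<le> (\<Sum>s=1..n. (w s)\<^sup>2)" by (rule sum_mono2) (auto simp: B_def S_def)
    have "(\<Sum>s\<in>B. (c (nat (z s)))\<^sup>2) = (\<Sum>j\<in>(\<lambda>s. nat (z s) - J) ` B. (c (j + J))\<^sup>2)"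
      unfolding sum.reindex[OF inj(2)] by (intro sum.cong refl) (auto simp: B_def)
    also have "\<dots> \<le> (\<Sum>j. (c (j + J))\<^sup>2)"
      using fin c by (intro sum_le_suminf summable_ignore_initial_segment[of "\<lambda>j. (c j)\<^sup>2"]) auto
    finally show "(\<Sum>s\<in>B. (c (nat (z s)))\<^sup>2) \<le> (\<Sum>j. (c (j + J))\<^sup>2)" .
  qed (auto intro!: sum_nonneg)
  finally have "sqrt ((\<Sum>s\<in>B. w s * c (nat (z s)))\<^sup>2) \<le> sqrt ((\<Sum>s=1..n. (w s)\<^sup>2) * (\<Sum>j. (c (j + J))\<^sup>2))"
    by (rule real_sqrt_le_mono)
  then have b: "\<bar>\<Sum>s\<in>B. w s * c (nat (z s))\<bar> \<le> sqrt (\<Sum>s=1..n. (w s)\<^sup>2) * sqrt (\<Sum>j. (c (j + J))\<^sup>2)"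
    by (simp add: real_sqrt_mult)
  show ?thesis unfolding split using a b by linarith
qed

text \<open>Mean square convergence is given for each time separately; Cauchy-Schwarz over finitely
  many times carries it to the weighted sum. Working with nonnegative integrals yields integrability
  of the squared error along the way.\<close>

lemma ma_trunc_approx:
  assumes lp: "linear_process P u c \<epsilon>" and um: "\<And>s. s \<ge> 1 \<Longrightarrow> u s \<in> borel_measurable P" and \<eta>: "\<eta> > 0"
  shows "\<exists>N. integrable P (\<lambda>\<omega>. (\<Sum>s=1..n. w s * (u (int s) \<omega> - ma_trunc c N (int s) \<omega>))\<^sup>2) \<and>
    (LINT \<omega>|P. (\<Sum>s=1..n. w s * (u (int s) \<omega> - ma_trunc c N (int s) \<omega>))\<^sup>2) \<le> \<eta>"
proof -
  let ?e = "\<lambda>N s \<omega>. ennreal ((u (int s) \<omega> - ma_trunc c N (int s) \<omega>)\<^sup>2)"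
  define W where "W = (\<Sum>s=1..n. (w s)\<^sup>2)"
  have W: "W \<ge> 0" by (simp add: W_def sum_nonneg)
  define D where "D N \<omega> = (\<Sum>s=1..n. w s * (u (int s) \<omega> - ma_trunc c N (int s) \<omega>))" for N \<omega>
  have um': "u (int s) \<in> borel_measurable P" if "s \<in> {1..n}" for s using that by (intro um) auto
  have [measurable]: "D N \<in> borel_measurable P" for N
    unfolding D_def[abs_def] by (intro borel_measurable_sum borel_measurable_times borel_measurable_diff um') auto
  have bound: "(\<integral>\<^sup>+\<omega>. ennreal ((D N \<omega>)\<^sup>2) \<partial>P) \<le> ennreal W * (\<Sum>s=1..n. \<integral>\<^sup>+\<omega>. ?e N s \<omega> \<partial>P)" for N
  proof -
    have "(\<integral>\<^sup>+\<omega>. ennreal ((D N \<omega>)\<^sup>2) \<partial>P) \<le> (\<integral>\<^sup>+\<omega>. ennreal W * (\<Sum>s=1..n. ?e N s \<omega>) \<partial>P)"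
    proof (rule nn_integral_mono)
      fix \<omega>
      have "(D N \<omega>)\<^sup>2 \<le> W * (\<Sum>s=1..n. (u (int s) \<omega> - ma_trunc c N (int s) \<omega>)\<^sup>2)"
        unfolding D_def W_def by (rule Cauchy_Schwarz_ineq_sum)
      then have "ennreal ((D N \<omega>)\<^sup>2) \<le> ennreal (W * (\<Sum>s=1..n. (u (int s) \<omega> - ma_trunc c N (int s) \<omega>)\<^sup>2))"
        by (rule ennreal_leI)
      also have "\<dots> = ennreal W * (\<Sum>s=1..n. ?e N s \<omega>)"
        using W by (simp add: ennreal_mult sum_nonneg)
      finally show "ennreal ((D N \<omega>)\<^sup>2) \<le> ennreal W * (\<Sum>s=1..n. ?e N s \<omega>)" .
    qed
    also have "\<dots> = ennreal W * (\<Sum>s=1..n. \<integral>\<^sup>+\<omega>. ?e N s \<omega> \<partial>P)"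
      using um' by (subst nn_integral_cmult, measurable, subst nn_integral_sum) auto
    finally show ?thesis .
  qed
  have "(\<lambda>N. ennreal W * (\<Sum>s=1..n. \<integral>\<^sup>+\<omega>. ?e N s \<omega> \<partial>P)) \<longlonglongrightarrow> ennreal W * (\<Sum>s=1..n. 0)"
    using lp unfolding linear_process_def ma_trunc_def
    by (intro tendsto_mult_ennreal tendsto_sum tendsto_const) auto
  then have "\<forall>\<^sub>F N in sequentially. ennreal W * (\<Sum>s=1..n. \<integral>\<^sup>+\<omega>. ?e N s \<omega> \<partial>P) < ennreal \<eta>"
    using \<eta> by (intro order_tendstoD(2)) auto
  then obtain N where N: "ennreal W * (\<Sum>s=1..n. \<integral>\<^sup>+\<omega>. ?e N s \<omega> \<partial>P) < ennreal \<eta>"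
    using eventually_happens'[OF sequentially_bot] by blast
  then have fin: "(\<integral>\<^sup>+\<omega>. ennreal ((D N \<omega>)\<^sup>2) \<partial>P) < ennreal \<eta>" using bound[of N] by (rule le_less_trans[rotated])
  then have int: "integrable P (\<lambda>\<omega>. (D N \<omega>)\<^sup>2)"
    by (intro integrableI_bounded) (auto intro: less_le_trans simp: less_top[symmetric])
  moreover have "(LINT \<omega>|P. (D N \<omega>)\<^sup>2) \<le> \<eta>"
    using fin \<eta> nn_integral_eq_integral[OF int] by (simp add: ennreal_less_iff)
  ultimately show ?thesis unfolding D_def by blast
qed

end

lemma cmod_cis_diff_le: "cmod (cis x - cis y) \<le> \<bar>x - y\<bar>"
proof -
  have "cis x - cis y = cis y * (cis (x - y) - 1)" by (simp add: right_diff_distrib cis_mult)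
  then have "cmod (cis x - cis y) = cmod (cis (x - y) - 1)" by (simp add: norm_mult)
  also have "\<dots> \<le> \<bar>x - y\<bar>" using iexp_approx1[of "x - y" 0] by (simp add: cis_conv_exp)
  finally show ?thesis .
qed

context martingale_differences
begin

text \<open>The truncation length is chosen anew for each \<open>n\<close>, with mean square error
  at most \<open>(h n)\<^sup>2\<close>. The truncated sums are finite combinations of innovations,
  with variances tending to 1 and coefficients uniformly small by \<open>ma_coeff_bound\<close>; the
  characteristic functions differ by at most \<open>\<bar>\<theta>\<bar> * h n\<close>.\<close>

lemma charfun_linear_process:
  fixes w :: "nat \<Rightarrow> nat \<Rightarrow> real" and l :: "nat \<Rightarrow> nat"
  assumes td: "tail_dominated P \<epsilon>" and lp: "linear_process P u c \<epsilon>"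
    and um: "\<And>s. s \<ge> 1 \<Longrightarrow> u s \<in> borel_measurable P"
    and w: "\<And>n s. s \<in> {1..l n} \<Longrightarrow> \<bar>w n s\<bar> \<le> \<rho> n" "\<And>n. \<rho> n \<ge> 0" and \<rho>: "\<rho> \<longlonglongrightarrow> 0"
    and C: "\<And>n. (\<Sum>s=1..l n. (w n s)\<^sup>2) \<le> C"
  defines "Y \<equiv> \<lambda>n \<omega>. \<Sum>s=1..l n. w n s * u (int s) \<omega>"
  assumes Y: "\<And>n. integrable P (\<lambda>\<omega>. (Y n \<omega>)\<^sup>2)" "\<And>n. (LINT \<omega>|P. (Y n \<omega>)\<^sup>2) = 1"
  shows "(\<lambda>n. LINT \<omega>|P. cis (\<theta> * Y n \<omega>)) \<longlonglongrightarrow> complex_of_real (exp (- \<theta>\<^sup>2 / 2))"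
proof -
  let ?D = "\<lambda>n N \<omega>. (\<Sum>s=1..l n. w n s * (u (int s) \<omega> - ma_trunc c N (int s) \<omega>))"
  define h where "h n = 1 / real (Suc n)" for n
  have h: "h n > 0" "h n \<le> 1" for n by (auto simp: h_def)
  have hlim: "h \<longlonglongrightarrow> 0" unfolding h_def by (rule LIMSEQ_Suc[OF lim_1_over_n])
  have summ: "summable (\<lambda>j. (c j)\<^sup>2)" using lp by (simp add: linear_process_def)
  have Ym [measurable]: "Y n \<in> borel_measurable P" for n
    unfolding Y_def by (intro borel_measurable_sum borel_measurable_times um) auto
  have "\<forall>n. \<exists>N. integrable P (\<lambda>\<omega>. (?D n N \<omega>)\<^sup>2) \<and>
    (LINT \<omega>|P. (?D n N \<omega>)\<^sup>2) \<le> (h n)\<^sup>2"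
    by (intro allI ma_trunc_approx[OF lp um]) (use h(1) in \<open>simp_all add: less_imp_neq[symmetric]\<close>)
  from choice[OF this] obtain N where N: "\<And>n. integrable P (\<lambda>\<omega>. (?D n (N n) \<omega>)\<^sup>2)"
    "\<And>n. (LINT \<omega>|P. (?D n (N n) \<omega>)\<^sup>2) \<le> (h n)\<^sup>2"
    by blast
  define b where "b n = ma_coeff c (N n) (w n) (l n)" for n
  define r where "r n = 1 - int (N n)" for n
  define k where "k n = l n + N n" for n
  define Z where "Z n = wsum (b n) (r n) (k n)" for n
  have Z: "Z n \<omega> = (\<Sum>s=1..l n. w n s * ma_trunc c (N n) (int s) \<omega>)" for n \<omega>
    unfolding Z_def b_def r_def k_def by (rule weighted_ma_trunc[symmetric])
  have [measurable]: "Z n \<in> borel_measurable P" for n unfolding Z_def by measurable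
  have D: "integrable P (\<lambda>\<omega>. (Y n \<omega> - Z n \<omega>)\<^sup>2)" "(LINT \<omega>|P. (Y n \<omega> - Z n \<omega>)\<^sup>2) \<le> (h n)\<^sup>2" for n
    using N[of n] by (simp_all add: Y_def Z sum_subtractf right_diff_distrib)
  have Z2: "integrable P (\<lambda>\<omega>. (Z n \<omega>)\<^sup>2)" "(LINT \<omega>|P. (Z n \<omega>)\<^sup>2) = (\<Sum>i<k n. (b n i)\<^sup>2)" for n
    using wsum_second_moment[of "b n" "r n" "k n"] by (auto simp: Z_def)
  have "(\<lambda>n. (LINT \<omega>|P. (Z n \<omega>)\<^sup>2) - 1) \<longlonglongrightarrow> 0"
  proof (rule Lim_null_comparison)
    show "(\<lambda>n. 3 * h n) \<longlonglongrightarrow> 0" using tendsto_mult[OF tendsto_const[of 3] hlim] by simp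
    show "\<forall>\<^sub>F n in sequentially. norm ((LINT \<omega>|P. (Z n \<omega>)\<^sup>2) - 1) \<le> 3 * h n"
    proof (rule always_eventually, rule allI)
      fix n
      \<comment> \<open>The weight \<open>h n\<close> balances the two errors: in mean, the first
        term is at most \<open>(1 + 1 / h n) * (h n)\<^sup>2\<close> and the second is
        \<open>h n\<close>, so both vanish.\<close>
      have pw: "\<bar>z\<^sup>2 - y\<^sup>2\<bar> \<le> (1 + 1 / h n) * (y - z)\<^sup>2 + h n * y\<^sup>2" for y z :: real
      proof -
        have "0 \<le> (\<bar>y - z\<bar> / sqrt (h n) - sqrt (h n) * \<bar>y\<bar>)\<^sup>2" by simp
        also have "\<dots> = (y - z)\<^sup>2 / h n + h n * y\<^sup>2 - 2 * \<bar>y - z\<bar> * \<bar>y\<bar>"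
          using h(1)[of n] by (simp add: power2_diff power_divide power_mult_distrib)
        finally have "2 * \<bar>(y - z) * y\<bar> \<le> (y - z)\<^sup>2 / h n + h n * y\<^sup>2" by (simp add: abs_mult)
        moreover have "z\<^sup>2 - y\<^sup>2 = (y - z)\<^sup>2 - 2 * ((y - z) * y)" by (simp add: power2_eq_square algebra_simps)
        then have "\<bar>z\<^sup>2 - y\<^sup>2\<bar> \<le> (y - z)\<^sup>2 + 2 * \<bar>(y - z) * y\<bar>"
          using abs_triangle_ineq4[of "(y - z)\<^sup>2" "2 * ((y - z) * y)"] by (simp add: abs_mult)
        ultimately have "\<bar>z\<^sup>2 - y\<^sup>2\<bar> \<le> (y - z)\<^sup>2 + ((y - z)\<^sup>2 / h n + h n * y\<^sup>2)" by linarith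
        then show ?thesis by (simp add: distrib_right)
      qed
      have "(LINT \<omega>|P. (Z n \<omega>)\<^sup>2) - 1 = (LINT \<omega>|P. (Z n \<omega>)\<^sup>2 - (Y n \<omega>)\<^sup>2)"
        using Y Z2 by simp
      also have "\<bar>\<dots>\<bar> \<le> (LINT \<omega>|P. \<bar>(Z n \<omega>)\<^sup>2 - (Y n \<omega>)\<^sup>2\<bar>)" by (rule integral_abs_bound)
      also have "\<dots> \<le> (LINT \<omega>|P. (1 + 1 / h n) * (Y n \<omega> - Z n \<omega>)\<^sup>2 + h n * (Y n \<omega>)\<^sup>2)"
      proof (rule integral_mono)
        show "integrable P (\<lambda>\<omega>. \<bar>(Z n \<omega>)\<^sup>2 - (Y n \<omega>)\<^sup>2\<bar>)" using Y Z2 by simp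
        show "integrable P (\<lambda>\<omega>. (1 + 1 / h n) * (Y n \<omega> - Z n \<omega>)\<^sup>2 + h n * (Y n \<omega>)\<^sup>2)"
          by (intro Bochner_Integration.integrable_add integrable_mult_right D Y)
      qed (rule pw)
      also have "\<dots> = (1 + 1 / h n) * (LINT \<omega>|P. (Y n \<omega> - Z n \<omega>)\<^sup>2) + h n * 1"
        by (simp only: Bochner_Integration.integral_add integrable_mult_right D(1) Y integral_mult_right_zero)
      also have "\<dots> \<le> (1 + 1 / h n) * (h n)\<^sup>2 + h n * 1"
        using D(2)[of n] h(1)[of n] by (intro add_mono mult_left_mono) auto
      also have "\<dots> = (h n)\<^sup>2 + 2 * h n" using h(1)[of n] by (simp add: power2_eq_square distrib_right)
      also have "\<dots> \<le> 3 * h n"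
      proof -
        have "h n * h n \<le> 1 * h n" using h[of n] by (intro mult_right_mono) auto
        then show ?thesis by (simp add: power2_eq_square)
      qed
      finally show "norm ((LINT \<omega>|P. (Z n \<omega>)\<^sup>2) - 1) \<le> 3 * h n" by simp
    qed
  qed
  then have vlim: "(\<lambda>n. (LINT \<omega>|P. (Z n \<omega>)\<^sup>2)) \<longlonglongrightarrow> 1" by (rule LIM_zero_cancel)
  have "(\<lambda>n. LINT \<omega>|P. cis (wsum (\<lambda>i. \<theta> * b n i) (r n) (k n) \<omega>)) \<longlonglongrightarrow> complex_of_real (exp (- (\<theta>\<^sup>2) / 2))"
  proof (rule charfun_wsum_limit[OF td])
    have "(\<lambda>n. \<theta>\<^sup>2 * (\<Sum>i<k n. (b n i)\<^sup>2)) \<longlonglongrightarrow> \<theta>\<^sup>2 * 1"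
      using vlim unfolding Z2 by (intro tendsto_intros)
    then show "(\<lambda>n. \<Sum>i<k n. (\<theta> * b n i)\<^sup>2) \<longlonglongrightarrow> \<theta>\<^sup>2"
      by (simp add: power_mult_distrib sum_distrib_left)
    fix \<beta> :: real assume \<beta>: "\<beta> > 0"
    \<comment> \<open>The summand 1 in the denominator covers \<open>\<theta> = 0\<close>.\<close>
    define \<beta>' where "\<beta>' = \<beta> / (1 + \<bar>\<theta>\<bar>)"
    have \<beta>': "\<beta>' > 0" using \<beta> by (auto simp: \<beta>'_def intro!: divide_pos_pos)
    \<comment> \<open>\<open>J\<close> is fixed first, making the tail of \<open>c\<close> small for
      all \<open>n\<close> at once; only then does \<open>n\<close> grow, making
      \<open>\<rho> n\<close> small against the finitely many remaining lags.\<close>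
    have "(\<lambda>J. sqrt C * sqrt (\<Sum>j. (c (j + J))\<^sup>2)) \<longlonglongrightarrow> sqrt C * sqrt 0"
      using suminf_exist_split2[OF summ] by (intro tendsto_intros) auto
    then have "\<forall>\<^sub>F J in sequentially. sqrt C * sqrt (\<Sum>j. (c (j + J))\<^sup>2) < \<beta>' / 2"
      using \<beta>' by (intro order_tendstoD(2)) auto
    then obtain J where J: "sqrt C * sqrt (\<Sum>j. (c (j + J))\<^sup>2) < \<beta>' / 2"
      using eventually_happens'[OF sequentially_bot] by blast
    have "(\<lambda>n. \<rho> n * (\<Sum>j<J. \<bar>c j\<bar>)) \<longlonglongrightarrow> 0 * (\<Sum>j<J. \<bar>c j\<bar>)" by (intro tendsto_intros \<rho>)
    then have "\<forall>\<^sub>F n in sequentially. \<rho> n * (\<Sum>j<J. \<bar>c j\<bar>) < \<beta>' / 2"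
      using \<beta>' by (intro order_tendstoD(2)) auto
    then show "\<forall>\<^sub>F n in sequentially. \<forall>i<k n. \<bar>\<theta> * b n i\<bar> \<le> \<beta>"
    proof eventually_elim
      case (elim n)
      show ?case
      proof (intro allI impI)
        fix i assume "i < k n"
        have "\<bar>b n i\<bar> \<le> \<rho> n * (\<Sum>j<J. \<bar>c j\<bar>) + sqrt (\<Sum>s=1..l n. (w n s)\<^sup>2) * sqrt (\<Sum>j. (c (j + J))\<^sup>2)"
          unfolding b_def by (rule ma_coeff_bound[OF w(1) w(2) summ])
        also have "\<dots> \<le> \<beta>' / 2 + sqrt C * sqrt (\<Sum>j. (c (j + J))\<^sup>2)"
          using elim C[of n] summ
          by (intro add_mono mult_right_mono) (auto intro!: suminf_nonneg summable_ignore_initial_segment[of "\<lambda>j. (c j)\<^sup>2"])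
        finally have "\<bar>b n i\<bar> \<le> \<beta>'" using J by linarith
        then have "\<bar>\<theta>\<bar> * \<bar>b n i\<bar> \<le> (1 + \<bar>\<theta>\<bar>) * \<beta>'" by (intro mult_mono) auto
        also have "\<dots> = \<beta>" by (simp add: \<beta>'_def add_pos_nonneg less_imp_neq[symmetric])
        finally show "\<bar>\<theta> * b n i\<bar> \<le> \<beta>" by (simp add: abs_mult)
      qed
    qed
  qed
  moreover have "wsum (\<lambda>i. \<theta> * b n i) (r n) (k n) \<omega> = \<theta> * Z n \<omega>" for n \<omega>
    by (simp add: Z_def wsum_def sum_distrib_left mult.assoc)
  ultimately have Zlim: "(\<lambda>n. LINT \<omega>|P. cis (\<theta> * Z n \<omega>)) \<longlonglongrightarrow> complex_of_real (exp (- (\<theta>\<^sup>2) / 2))" by simp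
  have "(\<lambda>n. (LINT \<omega>|P. cis (\<theta> * Y n \<omega>)) - (LINT \<omega>|P. cis (\<theta> * Z n \<omega>))) \<longlonglongrightarrow> 0"
  proof (rule Lim_null_comparison)
    show "(\<lambda>n. \<bar>\<theta>\<bar> * h n) \<longlonglongrightarrow> 0" using tendsto_mult[OF tendsto_const[of "\<bar>\<theta>\<bar>"] hlim] by simp
    show "\<forall>\<^sub>F n in sequentially. norm ((LINT \<omega>|P. cis (\<theta> * Y n \<omega>)) - (LINT \<omega>|P. cis (\<theta> * Z n \<omega>))) \<le> \<bar>\<theta>\<bar> * h n"
    proof (rule always_eventually, rule allI)
      fix n
      have ci: "integrable P (\<lambda>\<omega>. cis (\<theta> * g \<omega>))" if [measurable]: "g \<in> borel_measurable P" for g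
        by (rule integrable_const_bound[where B = 1]) (auto simp: cis_conv_exp)
      have "(LINT \<omega>|P. cis (\<theta> * Y n \<omega>)) - (LINT \<omega>|P. cis (\<theta> * Z n \<omega>)) = (LINT \<omega>|P. cis (\<theta> * Y n \<omega>) - cis (\<theta> * Z n \<omega>))"
        by (rule Bochner_Integration.integral_diff[symmetric]; rule ci) measurable
      also have "norm \<dots> \<le> (LINT \<omega>|P. norm (cis (\<theta> * Y n \<omega>) - cis (\<theta> * Z n \<omega>)))" by (rule integral_norm_bound)
      also have "\<dots> \<le> (LINT \<omega>|P. (\<bar>\<theta>\<bar> / (2 * h n)) * (Y n \<omega> - Z n \<omega>)\<^sup>2 + \<bar>\<theta>\<bar> * h n / 2)"
      proof (rule integral_mono)
        show "integrable P (\<lambda>\<omega>. norm (cis (\<theta> * Y n \<omega>) - cis (\<theta> * Z n \<omega>)))"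
          by (intro integrable_norm Bochner_Integration.integrable_diff ci) measurable
        show "integrable P (\<lambda>\<omega>. (\<bar>\<theta>\<bar> / (2 * h n)) * (Y n \<omega> - Z n \<omega>)\<^sup>2 + \<bar>\<theta>\<bar> * h n / 2)"
          using D by (intro Bochner_Integration.integrable_add integrable_mult_right) auto
        fix \<omega>
        have "norm (cis (\<theta> * Y n \<omega>) - cis (\<theta> * Z n \<omega>)) \<le> \<bar>\<theta>\<bar> * \<bar>Y n \<omega> - Z n \<omega>\<bar>"
          using cmod_cis_diff_le[of "\<theta> * Y n \<omega>" "\<theta> * Z n \<omega>"] by (simp add: abs_mult flip: right_diff_distrib)
        also have "\<bar>Y n \<omega> - Z n \<omega>\<bar> \<le> (Y n \<omega> - Z n \<omega>)\<^sup>2 / (2 * h n) + h n / 2"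
        proof -
          have "2 * h n * \<bar>Y n \<omega> - Z n \<omega>\<bar> \<le> (Y n \<omega> - Z n \<omega>)\<^sup>2 + h n * h n"
            using sum_squares_bound[of "\<bar>Y n \<omega> - Z n \<omega>\<bar>" "h n"]
            by (simp add: power2_eq_square[of "h n"] mult_ac)
          then have "\<bar>Y n \<omega> - Z n \<omega>\<bar> \<le> ((Y n \<omega> - Z n \<omega>)\<^sup>2 + h n * h n) / (2 * h n)"
            using h(1)[of n] by (simp add: pos_le_divide_eq mult.commute)
          also have "\<dots> = (Y n \<omega> - Z n \<omega>)\<^sup>2 / (2 * h n) + h n / 2"
            using h(1)[of n] by (simp add: add_divide_distrib)
          finally show ?thesis .
        qed
        finally show "norm (cis (\<theta> * Y n \<omega>) - cis (\<theta> * Z n \<omega>)) \<le> (\<bar>\<theta>\<bar> / (2 * h n)) * (Y n \<omega> - Z n \<omega>)\<^sup>2 + \<bar>\<theta>\<bar> * h n / 2"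
          by (simp add: distrib_left mult_left_mono)
      qed
      also have "\<dots> = (\<bar>\<theta>\<bar> / (2 * h n)) * (LINT \<omega>|P. (Y n \<omega> - Z n \<omega>)\<^sup>2) + \<bar>\<theta>\<bar> * h n / 2"
        using D by (subst Bochner_Integration.integral_add) (auto simp: prob_space)
      also have "\<dots> \<le> (\<bar>\<theta>\<bar> / (2 * h n)) * (h n)\<^sup>2 + \<bar>\<theta>\<bar> * h n / 2"
        using D(2)[of n] h(1)[of n] by (intro add_mono mult_left_mono) auto
      also have "\<dots> = \<bar>\<theta>\<bar> * h n" using h(1)[of n] by (simp add: power2_eq_square)
      finally show "norm ((LINT \<omega>|P. cis (\<theta> * Y n \<omega>)) - (LINT \<omega>|P. cis (\<theta> * Z n \<omega>))) \<le> \<bar>\<theta>\<bar> * h n" .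
    qed
  qed
  from tendsto_add[OF this Zlim] show ?thesis by simp
qed

text \<open>By Levy continuity the laws converge to the standard normal law. Its density is at most
  1, so the symmetric interval of radius \<open>\<eta> / 4\<close> has normal mass at most
  \<open>\<eta> / 2\<close>.\<close>

lemma anti_concentration:
  assumes Ym: "\<And>n. Y n \<in> borel_measurable P"
    and char: "\<And>\<theta>. (\<lambda>n. LINT \<omega>|P. cis (\<theta> * Y n \<omega>)) \<longlonglongrightarrow> complex_of_real (exp (- \<theta>\<^sup>2 / 2))"
    and \<eta>: "\<eta> > 0"
  shows "\<exists>\<delta>>0. \<forall>\<^sub>F n in sequentially. measure P {\<omega>\<in>space P. \<bar>Y n \<omega>\<bar> \<le> \<delta>} \<le> \<eta>"
proof -
  note [measurable] = Ym
  let ?M = "\<lambda>n. distr P borel (Y n)"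
  have rd: "real_distribution (?M n)" for n by (rule real_distribution_distr) simp
  have wc: "weak_conv_m ?M std_normal_distribution"
  proof (rule levy_continuity[OF rd real_dist_normal_dist])
    fix t
    have "char (?M n) t = (LINT \<omega>|P. cis (t * Y n \<omega>))" for n
      unfolding char_def cis_conv_exp by (subst integral_distr) auto
    then show "(\<lambda>n. char (?M n) t) \<longlonglongrightarrow> char std_normal_distribution t"
      using char[of t] by (simp add: char_std_normal_distribution)
  qed
  define \<delta> where "\<delta> = \<eta> / 4"
  have \<delta>: "\<delta> > 0" using \<eta> by (simp add: \<delta>_def)
  interpret N: real_distribution std_normal_distribution by (rule real_dist_normal_dist)
  have ems: "emeasure std_normal_distribution A \<le> emeasure lborel A" if A: "A \<in> sets borel" for A
  proof -
    have "std_normal_density x \<le> 1" for x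
    proof -
      have "1 / sqrt (2 * pi) \<le> 1" using pi_gt3 by simp
      then have "1 / sqrt (2 * pi) * exp (- x\<^sup>2 / 2) \<le> 1 * 1" by (intro mult_mono) auto
      then show ?thesis by (simp add: std_normal_density_def)
    qed
    then have "(\<integral>\<^sup>+x\<in>A. ennreal (std_normal_density x) \<partial>lborel) \<le> (\<integral>\<^sup>+x. indicator A x \<partial>lborel)"
      by (intro nn_integral_mono) (auto simp: indicator_def)
    then show ?thesis using A by (simp add: emeasure_density)
  qed
  have fr: "emeasure std_normal_distribution (frontier {-\<delta>..\<delta>}) = 0"
  proof -
    have "frontier {-\<delta>..\<delta>} = {-\<delta>, \<delta>}" using \<delta> by (simp add: frontier_def interior_atLeastAtMost_real)
    moreover have "emeasure lborel {-\<delta>, \<delta>} = 0" by (rule emeasure_lborel_countable) simp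
    ultimately show ?thesis using ems[of "{-\<delta>, \<delta>}"] by simp
  qed
  have "(\<lambda>n. measure (?M n) {-\<delta>..\<delta>}) \<longlonglongrightarrow> measure std_normal_distribution {-\<delta>..\<delta>}"
    by (rule weak_conv_imp_continuity_set_conv[OF rd real_dist_normal_dist wc]) (use fr in auto)
  moreover have "measure std_normal_distribution {-\<delta>..\<delta>} < \<eta>"
  proof -
    have "ennreal (measure std_normal_distribution {-\<delta>..\<delta>}) \<le> ennreal (2 * \<delta>)"
      using ems[of "{-\<delta>..\<delta>}"] \<delta> by (simp add: N.emeasure_eq_measure)
    then have "measure std_normal_distribution {-\<delta>..\<delta>} \<le> 2 * \<delta>" using \<delta> by simp
    then show ?thesis using \<eta> by (simp add: \<delta>_def)
  qed
  ultimately have "\<forall>\<^sub>F n in sequentially. measure (?M n) {-\<delta>..\<delta>} < \<eta>" by (intro order_tendstoD(2))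
  then have "\<forall>\<^sub>F n in sequentially. measure P {\<omega>\<in>space P. \<bar>Y n \<omega>\<bar> \<le> \<delta>} \<le> \<eta>"
  proof eventually_elim
    case (elim n)
    have "measure (?M n) {-\<delta>..\<delta>} = measure P {\<omega>\<in>space P. \<bar>Y n \<omega>\<bar> \<le> \<delta>}"
      by (subst measure_distr) (auto intro!: arg_cong[where f = "measure P"] simp: abs_le_iff)
    then show ?case using elim by simp
  qed
  then show ?thesis using \<delta> by blast
qed

end


section \<open>Size of the differenced series and of the boundary term\<close>

text \<open>The hypothesis describes \<open>f\<close> only at 0 and to the right of it; even
  extension turns this into a bound on both sides. The limit at 0 provides \<open>2 * f 0\<close>
  and \<open>f 0 / 2\<close> as upper and lower bounds.\<close>

lemma spectral_weight_exists:
  assumes sd: "has_spectral_density P u f" and lev: "spectral_level_at_zero f"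
  obtains F \<delta> B b where "spectral_weight P u F" "\<And>\<theta>. F \<theta> \<ge> 0" "\<And>\<theta>. \<theta> \<notin> {-pi..pi} \<Longrightarrow> F \<theta> = 0"
    "0 < \<delta>" "\<delta> \<le> 1" "\<And>\<theta>. \<bar>\<theta>\<bar> < \<delta> \<Longrightarrow> F \<theta> \<le> B" "0 < b" "\<And>\<theta>. 0 < \<theta> \<Longrightarrow> \<theta> < \<delta> \<Longrightarrow> b \<le> F \<theta>"
proof -
  define F0 where "F0 \<theta> = indicator {-pi..pi} \<theta> * f \<theta>" for \<theta>
  define F where "F \<theta> = F0 \<bar>\<theta>\<bar>" for \<theta>
  have w: "spectral_weight P u F"
    unfolding F_def F0_def by (rule spectral_weight_symmetrize[OF spectral_weight_density[OF sd]]) simp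
  have f0: "0 < f 0" "f \<sim>[at_right 0] (\<lambda>_. f 0)" using lev by (auto simp: spectral_level_at_zero_def)
  have lim: "(f \<longlongrightarrow> f 0) (at_right 0)" using tendsto_asymp_equiv_cong[OF f0(2), of "f 0"] by simp
  have "\<forall>\<^sub>F \<theta> in at_right 0. f 0 / 2 < f \<theta> \<and> f \<theta> < 2 * f 0"
    using f0(1) by (intro eventually_conj order_tendstoD[OF lim]) auto
  then obtain e where e: "e > 0" "\<And>\<theta>. 0 < \<theta> \<Longrightarrow> \<theta> < e \<Longrightarrow> f 0 / 2 < f \<theta> \<and> f \<theta> < 2 * f 0"
    by (auto simp: eventually_at_right_field)
  define \<delta> where "\<delta> = min e 1"
  have nn: "\<And>\<theta>. \<theta> \<in> {-pi..pi} \<Longrightarrow> 0 \<le> f \<theta>" using sd by (auto simp: has_spectral_density_def)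
  have Ff: "F \<theta> = f \<bar>\<theta>\<bar>" if "\<bar>\<theta>\<bar> < \<delta>" for \<theta>
    using that pi_gt3 by (simp add: F_def F0_def \<delta>_def)
  show thesis
  proof (rule that[of F \<delta> "2 * f 0" "f 0 / 2"])
    show "F \<theta> \<ge> 0" for \<theta> using nn by (auto simp: F_def F0_def indicator_def)
    show "F \<theta> = 0" if "\<theta> \<notin> {-pi..pi}" for \<theta> using that by (auto simp: F_def F0_def indicator_def abs_if split: if_splits)
    show "F \<theta> \<le> 2 * f 0" if "\<bar>\<theta>\<bar> < \<delta>" for \<theta>
      using e(2)[of "\<bar>\<theta>\<bar>"] that f0(1) by (cases "\<theta> = 0") (auto simp: Ff \<delta>_def)
    show "f 0 / 2 \<le> F \<theta>" if "0 < \<theta>" "\<theta> < \<delta>" for \<theta>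
      using e(2)[of "\<theta>"] that by (auto simp: Ff \<delta>_def)
  qed (use w e f0 in \<open>auto simp: \<delta>_def\<close>)
qed

section \<open>The differenced series\<close>

lemma frac_trig_Suc_diff: "frac_trig d (Suc N) \<theta> - frac_trig d N \<theta> = complex_of_real (frac_coeff d (Suc N)) * cis (real (Suc N) * \<theta>)"
  by (simp add: frac_trig_def)

text \<open>Consecutive values differ by one term of modulus \<open>frac_coeff d k\<close>, so the
  increments add up to at most \<open>frac_coeff (d + 1) (n - 1)\<close>. This also bounds each end
  value, hence the factor 3.\<close>

lemma variation_frac_trig:
  assumes "d > 0" "n \<ge> 1"
  shows "variation n (\<lambda>s. frac_trig d (n - s) \<theta>) \<le> 3 * frac_coeff (d + 1) (n - 1)"
proof -
  have nn: "frac_coeff d k \<ge> 0" for k using frac_coeff_pos[OF assms(1)] less_imp_le by blast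
  have "(\<Sum>s=1..<n. cmod (frac_trig d (n - Suc s) \<theta> - frac_trig d (n - s) \<theta>)) = (\<Sum>s=1..<n. frac_coeff d (n - s))"
  proof (rule sum.cong[OF refl])
    fix s assume "s \<in> {1..<n}"
    then have "n - s = Suc (n - Suc s)" by auto
    then show "cmod (frac_trig d (n - Suc s) \<theta> - frac_trig d (n - s) \<theta>) = frac_coeff d (n - s)"
      by (subst norm_minus_commute, simp only: frac_trig_Suc_diff) (simp add: norm_mult nn)
  qed
  also have "\<dots> = (\<Sum>k=1..<n. frac_coeff d k)"
    by (rule sum.reindex_bij_witness[of _ "\<lambda>k. n - k" "\<lambda>s. n - s"]) auto
  also have "\<dots> \<le> (\<Sum>k\<le>n - 1. frac_coeff d k)" by (rule sum_mono2) (auto simp: nn)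
  also have "\<dots> = frac_coeff (d + 1) (n - 1)" by (rule sum_frac_coeff)
  finally have 1: "(\<Sum>s=1..<n. cmod (frac_trig d (n - Suc s) \<theta> - frac_trig d (n - s) \<theta>)) \<le> frac_coeff (d + 1) (n - 1)" .
  have 2: "cmod (frac_trig d (n - 1) \<theta>) \<le> frac_coeff (d + 1) (n - 1)" by (rule cmod_frac_trig_le[OF assms(1)])
  have 3: "cmod (frac_trig d (n - n) \<theta>) \<le> frac_coeff (d + 1) (n - 1)"
    using cmod_frac_trig_le[OF assms(1), of "n - n" \<theta>] frac_coeff_mono[OF assms(1), of 0 "n - 1"] by simp
  show ?thesis using 1 2 3 unfolding variation_def by linarith
qed

text \<open>The Fourier transform of the order \<open>d\<close> fractional sum of the noise, with
  the two summations exchanged so that it is an explicit linear form in \<open>u\<close>.\<close>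

definition frac_dft :: "real \<Rightarrow> (int \<Rightarrow> 'a \<Rightarrow> real) \<Rightarrow> nat \<Rightarrow> nat \<Rightarrow> 'a \<Rightarrow> complex" where
  "frac_dft d u n j \<omega> = (\<Sum>s=1..n. frac_trig d (n - s) (fourier_freq n j) * cis (real s * fourier_freq n j) * complex_of_real (u (int s) \<omega>))
     / complex_of_real (sqrt (2 * pi * real n))"

text \<open>At a single frequency the bound is an average over \<open>s\<close> of squared
  \<open>frac_trig\<close> values plus a variation term of relative size \<open>1 / n\<close>. The
  average need not be small against \<open>n powr (2 * d)\<close> at each frequency; summing over
  \<open>j\<close> is what makes Parseval effective.\<close>

lemma frac_dft_second_moment:
  assumes u: "zero_mean_stationary P u" and w: "spectral_weight P u F"
    and F: "\<And>\<theta>. F \<theta> \<ge> 0" "\<And>\<theta>. \<theta> \<notin> {-pi..pi} \<Longrightarrow> F \<theta> = 0"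
    and \<delta>: "0 < \<delta>" "\<delta> \<le> 1" "\<And>\<theta>. \<bar>\<theta>\<bar> < \<delta> \<Longrightarrow> F \<theta> \<le> B" and d: "d > 0"
  shows "\<And>n j. integrable P (\<lambda>\<omega>. (cmod (frac_dft d u n j \<omega>))\<^sup>2)"
    and "\<exists>C>0. \<forall>n m. 1 \<le> m \<longrightarrow> m < n \<longrightarrow> fourier_freq n m \<le> \<delta> / 2 \<longrightarrow>
       (LINT \<omega>|P. (\<Sum>j=1..m. (cmod (frac_dft d u n j \<omega>))\<^sup>2)) \<le>
         C * (real m * real n powr (2 * d)) * (real m powr - (d / 2) + real m powr - (1 / 2) + 1 / real n)"
proof -
  let ?D = "\<lambda>n j \<omega>. (cmod (frac_dft d u n j \<omega>))\<^sup>2"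
  define g where "g n j s = frac_trig d (n - s) (fourier_freq n j) * cis (real s * fourier_freq n j)" for n j s
  have eq: "?D n j \<omega> = (1 / (2 * pi * real n)) * (cmod (\<Sum>s=1..n. g n j s * complex_of_real (u (int s) \<omega>)))\<^sup>2" for n j \<omega>
    by (simp add: frac_dft_def g_def norm_divide power_divide)
  have sub: "{1..n} \<subseteq> {1..}" for n :: nat by auto
  note sm = second_moment_spectral[OF u w finite_atLeastAtMost sub]
  show int: "integrable P (\<lambda>\<omega>. ?D n j \<omega>)" for n j
    unfolding eq by (intro integrable_mult_right sm(1))
  have Fi: "integrable lborel F" using w by (simp add: spectral_weight_def)
  obtain C1 where C1: "C1 > 0" "\<And>n h \<nu>. n \<ge> 1 \<Longrightarrow> \<bar>\<nu>\<bar> \<le> \<delta> / 2 \<Longrightarrow>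
     (LINT \<theta>|lborel. F \<theta> * (cmod (\<Sum>s=1..n. (h s * cis (real s * \<nu>)) * cis (real s * \<theta>)))\<^sup>2) \<le>
     C1 * ((\<Sum>s=1..n. (cmod (h s))\<^sup>2) + (variation n h)\<^sup>2)"
    using second_moment_upper[OF Fi F \<delta>] by blast
  obtain C2 where C2: "C2 > 0" "\<And>k. k \<ge> 1 \<Longrightarrow> frac_coeff (d + 1) k \<le> C2 * real k powr d"
    using frac_coeff_bounds[of "d + 1"] d by auto
  obtain C3 where C3: "C3 > 0" "\<And>n m N \<kappa>. 1 \<le> m \<Longrightarrow> m < n \<Longrightarrow> N < n \<Longrightarrow> 0 < \<kappa> \<Longrightarrow> 1 \<le> \<kappa> * real n \<Longrightarrow>
     (\<Sum>j=1..m. (cmod (frac_trig d N (fourier_freq n j)))\<^sup>2) \<le>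
       C3 * real n powr (2 * d) * (real m * \<kappa> powr (2 * d) + 1 / \<kappa>\<^sup>2)"
    using sum_frac_trig_le[OF d] by blast
  define C where "C = C1 * (C3 + 9 * C2\<^sup>2)"
  have C: "C > 0" using C1 C2 C3 by (simp add: C_def add_pos_nonneg)
  show "\<exists>C>0. \<forall>n m. 1 \<le> m \<longrightarrow> m < n \<longrightarrow> fourier_freq n m \<le> \<delta> / 2 \<longrightarrow>
       (LINT \<omega>|P. (\<Sum>j=1..m. ?D n j \<omega>)) \<le>
         C * (real m * real n powr (2 * d)) * (real m powr - (d / 2) + real m powr - (1 / 2) + 1 / real n)"
  proof (intro exI[of _ C] conjI allI impI C)
    fix n m :: nat assume m: "1 \<le> m" "m < n" and fm: "fourier_freq n m \<le> \<delta> / 2"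
    let ?A = "\<lambda>s j. (cmod (frac_trig d (n - s) (fourier_freq n j)))\<^sup>2"
    let ?p = "1 / (2 * pi * real n)"
    \<comment> \<open>Any power \<open>m powr (- a)\<close> with \<open>0 < a < 1 / 2\<close> would
      do: \<open>\<kappa>\<close> has to tend to 0 while \<open>1 / (m * \<kappa>\<^sup>2)\<close>
      tends to 0 as well.\<close>
    define \<kappa> where "\<kappa> = real m powr - (1 / 4)"
    define T where "T = real n powr (2 * d)"
    have \<kappa>: "\<kappa> > 0" using m by (simp add: \<kappa>_def)
    have \<kappa>n: "1 \<le> \<kappa> * real n"
    proof -
      have "1 \<le> real n powr (3 / 4)" using m by (intro ge_one_powr_ge_zero) auto
      also have "\<dots> = real n powr - (1 / 4) * real n powr 1" using powr_add[of "real n" "- (1 / 4)" 1] by simp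
      also have "\<dots> \<le> \<kappa> * real n" unfolding \<kappa>_def using m by (intro mult_mono powr_mono2') auto
      finally show ?thesis .
    qed
    have \<kappa>1: "\<kappa> powr (2 * d) = real m powr - (d / 2)" by (simp add: \<kappa>_def powr_powr)
    have \<kappa>2: "1 / \<kappa>\<^sup>2 = real m * real m powr - (1 / 2)"
    proof -
      have "\<kappa>\<^sup>2 = real m powr - (1 / 2)" unfolding \<kappa>_def powr_square by simp
      moreover have "real m powr - (1 / 2) * real m powr - (1 / 2) = 1 / real m"
        using m by (simp add: powr_add[symmetric] powr_minus_divide)
      ultimately show ?thesis using m by (simp add: field_simps)
    qed
    have T: "T \<ge> 0" by (simp add: T_def)
    have each: "(LINT \<omega>|P. ?D n j \<omega>) \<le>
        ?p * (C1 * ((\<Sum>s=1..n. ?A s j) + 9 * C2\<^sup>2 * T))"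
      if j: "j \<in> {1..m}" for j
    proof -
      have fj: "\<bar>fourier_freq n j\<bar> \<le> \<delta> / 2"
      proof -
        have "fourier_freq n j \<le> fourier_freq n m"
          unfolding fourier_freq_def using j by (intro divide_right_mono mult_left_mono) auto
        moreover have "fourier_freq n j \<ge> 0" by (simp add: fourier_freq_def)
        ultimately show ?thesis using fm by linarith
      qed
      have "(LINT \<omega>|P. ?D n j \<omega>) =
          ?p * (LINT \<theta>|lborel. F \<theta> * (cmod (\<Sum>s=1..n. g n j s * cis (real s * \<theta>)))\<^sup>2)"
        unfolding eq integral_mult_right_zero sm(2) by (rule refl)
      also have "\<dots> \<le> ?p * (C1 * ((\<Sum>s=1..n. ?A s j)
          + (variation n (\<lambda>s. frac_trig d (n - s) (fourier_freq n j)))\<^sup>2))"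
        unfolding g_def using m fj by (intro mult_left_mono C1(2)) auto
      also have "\<dots> \<le> ?p * (C1 * ((\<Sum>s=1..n. ?A s j) + 9 * C2\<^sup>2 * T))"
      proof (intro mult_left_mono add_left_mono)
        have "variation n (\<lambda>s. frac_trig d (n - s) (fourier_freq n j)) \<le> 3 * frac_coeff (d + 1) (n - 1)"
          using m by (intro variation_frac_trig d) auto
        also have "frac_coeff (d + 1) (n - 1) \<le> C2 * real (n - 1) powr d" using m by (intro C2) auto
        also have "\<dots> \<le> C2 * real n powr d" using d C2 by (intro mult_left_mono powr_mono2) auto
        finally have "(variation n (\<lambda>s. frac_trig d (n - s) (fourier_freq n j)))\<^sup>2 \<le> (3 * (C2 * real n powr d))\<^sup>2"
          by (intro power_mono variation_nonneg) simp
        also have "\<dots> = 9 * C2\<^sup>2 * T" by (simp add: power_mult_distrib T_def powr_square)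
        finally show "(variation n (\<lambda>s. frac_trig d (n - s) (fourier_freq n j)))\<^sup>2 \<le> 9 * C2\<^sup>2 * T" .
      qed (use C1 in auto)
      finally show ?thesis .
    qed
    have "(LINT \<omega>|P. (\<Sum>j=1..m. ?D n j \<omega>)) = (\<Sum>j=1..m. LINT \<omega>|P. ?D n j \<omega>)"
      by (rule Bochner_Integration.integral_sum) (rule int)
    also have "\<dots> \<le> (\<Sum>j=1..m. ?p * (C1 * ((\<Sum>s=1..n. ?A s j) + 9 * C2\<^sup>2 * T)))"
      by (intro sum_mono each)
    also have "\<dots> = ?p * (C1 * ((\<Sum>j=1..m. \<Sum>s=1..n. ?A s j) + real m * (9 * C2\<^sup>2 * T)))"
      by (simp only: sum_distrib_left[symmetric] sum.distrib) simp
    also have "(\<Sum>j=1..m. \<Sum>s=1..n. ?A s j) = (\<Sum>s=1..n. \<Sum>j=1..m. ?A s j)"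
      by (rule sum.swap)
    also have "?p * (C1 * ((\<Sum>s=1..n. \<Sum>j=1..m. ?A s j) + real m * (9 * C2\<^sup>2 * T))) \<le>
       ?p * (C1 * ((\<Sum>s=1..n. C3 * T * (real m * \<kappa> powr (2 * d) + 1 / \<kappa>\<^sup>2)) + real m * (9 * C2\<^sup>2 * T)))"
    proof (intro mult_left_mono add_right_mono sum_mono)
      fix s assume "s \<in> {1..n}"
      then show "(\<Sum>j=1..m. ?A s j) \<le> C3 * T * (real m * \<kappa> powr (2 * d) + 1 / \<kappa>\<^sup>2)"
        unfolding T_def using m \<kappa> \<kappa>n by (intro C3) auto
    qed (use C1 in auto)
    also have "\<dots> = ?p * (C1 * (real n * (C3 * T * (real m * (real m powr - (d / 2) + real m powr - (1 / 2)))) + real m * (9 * C2\<^sup>2 * T)))"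
      unfolding \<kappa>1 \<kappa>2 distrib_left[symmetric] by simp
    also have "\<dots> = (1 / (2 * pi)) * (C1 * (real m * T) * (C3 * (real m powr - (d / 2) + real m powr - (1 / 2)) + 9 * C2\<^sup>2 * (1 / real n)))"
    proof -
      have "(1 / (2 * p * y)) * (c * (y * (k * t * (x * q)) + x * (r * t))) = (1 / (2 * p)) * (c * (x * t) * (k * q + r * (1 / y)))"
        if "y \<noteq> 0" "p \<noteq> 0" for p y c k t x q r :: real using that by (simp add: field_simps)
      then show ?thesis using m by simp
    qed
    also have "\<dots> \<le> 1 * (C1 * (real m * T) * ((C3 + 9 * C2\<^sup>2) * (real m powr - (d / 2) + real m powr - (1 / 2)) + (C3 + 9 * C2\<^sup>2) * (1 / real n)))"
      using C1 C3 T pi_gt3 by (intro mult_mono mult_left_mono add_mono mult_right_mono) auto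
    also have "\<dots> = C * (real m * real n powr (2 * d)) * (real m powr - (d / 2) + real m powr - (1 / 2) + 1 / real n)"
      by (simp add: C_def T_def distrib_left mult_ac)
    finally show "(LINT \<omega>|P. (\<Sum>j=1..m. ?D n j \<omega>)) \<le>
         C * (real m * real n powr (2 * d)) * (real m powr - (d / 2) + real m powr - (1 / 2) + 1 / real n)" .
  qed
qed

section \<open>The boundary term\<close>

definition frac_sum :: "real \<Rightarrow> (int \<Rightarrow> 'a \<Rightarrow> real) \<Rightarrow> nat \<Rightarrow> 'a \<Rightarrow> real" where
  "frac_sum d u n \<omega> = (\<Sum>s=1..n. frac_coeff d (n - s) * u (int s) \<omega>)"

text \<open>The coefficients are positive with sum \<open>frac_coeff (d + 2) (n - 1)\<close>, of
  order \<open>n powr (d + 1)\<close>. Near frequency zero they add up without cancellation on a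
  band of length \<open>1 / n\<close>, which gives the exponent
  \<open>2 * (d + 1) - 1\<close>.\<close>

lemma frac_sum_variance_lower:
  assumes u: "zero_mean_stationary P u" and w: "spectral_weight P u F" and F: "\<And>\<theta>. F \<theta> \<ge> 0"
    and b: "0 < \<delta>" "0 < b" "\<And>\<theta>. 0 < \<theta> \<Longrightarrow> \<theta> < \<delta> \<Longrightarrow> b \<le> F \<theta>" and d: "d > 0"
  shows "\<And>n. integrable P (\<lambda>\<omega>. (frac_sum (d + 1) u n \<omega>)\<^sup>2)"
    and "\<exists>c>0. \<forall>\<^sub>F n in sequentially. c * real n powr (2 * d + 1) \<le> (LINT \<omega>|P. (frac_sum (d + 1) u n \<omega>)\<^sup>2)"
proof -
  have Fi: "integrable lborel F" using w by (simp add: spectral_weight_def)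
  have eq: "(frac_sum (d + 1) u n \<omega>)\<^sup>2 = (cmod (\<Sum>s=1..n. complex_of_real (frac_coeff (d + 1) (n - s)) * complex_of_real (u (int s) \<omega>)))\<^sup>2" for n \<omega>
    unfolding frac_sum_def of_real_mult[symmetric] of_real_sum[symmetric] norm_of_real by simp
  have sub: "{1..n} \<subseteq> {1..}" for n :: nat by auto
  note sm = second_moment_spectral[OF u w finite_atLeastAtMost sub]
  show "integrable P (\<lambda>\<omega>. (frac_sum (d + 1) u n \<omega>)\<^sup>2)" for n unfolding eq by (rule sm(1))
  obtain c where c: "c > 0" "\<And>k. k \<ge> 1 \<Longrightarrow> c * real k powr (d + 1) \<le> frac_coeff (d + 2) k"
    using frac_coeff_bounds[of "d + 2"] d by (auto simp: algebra_simps)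
  have nn: "frac_coeff (d + 1) k \<ge> 0" for k using frac_coeff_pos[of "d + 1"] d less_imp_le by auto
  \<comment> \<open>The factor \<open>(1 / 2) powr (d + 1)\<close> pays for passing from
    \<open>n - 1\<close> to \<open>n\<close>, as \<open>n - 1 \<ge> n / 2\<close> for
    \<open>n \<ge> 2\<close>.\<close>
  define c' where "c' = b * (cos 1)\<^sup>2 * (c * (1 / 2) powr (d + 1))\<^sup>2"
  have "cos (1::real) > 0" using pi_gt3 by (intro cos_gt_zero) auto
  then have c': "c' > 0" using b c by (simp add: c'_def)
  have "\<forall>\<^sub>F n in sequentially. 1 / real n < \<delta>" using b by (intro order_tendstoD(2)[OF lim_1_over_n]) auto
  then have "\<forall>\<^sub>F n in sequentially. c' * real n powr (2 * d + 1) \<le> (LINT \<omega>|P. (frac_sum (d + 1) u n \<omega>)\<^sup>2)"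
    using eventually_ge_at_top[of 2]
  proof eventually_elim
    case (elim n)
    define S where "S = (\<Sum>s=1..n. frac_coeff (d + 1) (n - s))"
    have "S = (\<Sum>k\<le>n - 1. frac_coeff (d + 1) k)"
      unfolding S_def using elim by (intro sum.reindex_bij_witness[of _ "\<lambda>k. n - k" "\<lambda>s. n - s"]) auto
    also have "\<dots> = frac_coeff (d + 1 + 1) (n - 1)" by (rule sum_frac_coeff)
    finally have S: "S = frac_coeff (d + 2) (n - 1)" by (simp add: add.assoc)
    have "(1 / 2) powr (d + 1) * real n powr (d + 1) = (real n / 2) powr (d + 1)"
      by (simp add: powr_mult[symmetric])
    also have "\<dots> \<le> real (n - 1) powr (d + 1)" using d elim by (intro powr_mono2) (auto simp: of_nat_diff)
    finally have "c * ((1 / 2) powr (d + 1) * real n powr (d + 1)) \<le> c * real (n - 1) powr (d + 1)" using c by simp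
    also have "\<dots> \<le> S" unfolding S using elim by (intro c) auto
    finally have "(c * ((1 / 2) powr (d + 1) * real n powr (d + 1)))\<^sup>2 \<le> S\<^sup>2" using c by (intro power_mono) auto
    then have le: "b * (cos 1)\<^sup>2 / real n * (c * ((1 / 2) powr (d + 1) * real n powr (d + 1)))\<^sup>2 \<le> b * (cos 1)\<^sup>2 / real n * S\<^sup>2"
      using b by (intro mult_left_mono) auto
    have "c' * real n powr (2 * d + 1) = b * (cos 1)\<^sup>2 / real n * (c * ((1 / 2) powr (d + 1) * real n powr (d + 1)))\<^sup>2"
    proof -
      have "(real n powr (d + 1))\<^sup>2 = real n powr (2 * d + 1) * real n"
      proof -
        have "(real n powr (d + 1))\<^sup>2 = real n powr ((2 * d + 1) + 1)" by (simp add: powr_square algebra_simps)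
        also have "\<dots> = real n powr (2 * d + 1) * real n powr 1" by (rule powr_add)
        finally show ?thesis by simp
      qed
      then show ?thesis using elim by (simp add: c'_def power_mult_distrib)
    qed
    also note le
    also have "b * (cos 1)\<^sup>2 / real n * S\<^sup>2 \<le>
       (LINT \<theta>|lborel. F \<theta> * (cmod (\<Sum>s=1..n. complex_of_real (frac_coeff (d + 1) (n - s)) * cis (real s * \<theta>)))\<^sup>2)"
      unfolding S_def using elim b by (intro second_moment_lower[where \<delta> = \<delta>] Fi F nn) auto
    also have "\<dots> = (LINT \<omega>|P. (frac_sum (d + 1) u n \<omega>)\<^sup>2)" unfolding eq sm(2) by (rule refl)
    finally show ?case .
  qed
  then show "\<exists>c>0. \<forall>\<^sub>F n in sequentially. c * real n powr (2 * d + 1) \<le> (LINT \<omega>|P. (frac_sum (d + 1) u n \<omega>)\<^sup>2)"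
    using c' by blast
qed

text \<open>After scaling to unit variance, each weight is at most of order
  \<open>n powr d / n powr (d + 1 / 2)\<close>, that is \<open>n powr (- 1 / 2)\<close>. So the
  weights vanish uniformly while their squares have bounded sum, as
  \<open>charfun_linear_process\<close> requires.\<close>

lemma (in martingale_differences) frac_sum_anti_concentration:
  assumes td: "tail_dominated P \<epsilon>" and lp: "linear_process P u c \<epsilon>"
    and u: "zero_mean_stationary P u" and w: "spectral_weight P u F" and F: "\<And>\<theta>. F \<theta> \<ge> 0"
    and b: "0 < \<delta>" "0 < b" "\<And>\<theta>. 0 < \<theta> \<Longrightarrow> \<theta> < \<delta> \<Longrightarrow> b \<le> F \<theta>" and d: "d > 0"
    and \<eta>: "\<eta> > 0"
  shows "\<exists>e>0. \<forall>\<^sub>F n in sequentially.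
    measure P {\<omega>\<in>space P. \<bar>frac_sum (d + 1) u n \<omega>\<bar> \<le> e * real n powr (d + 1 / 2)} \<le> \<eta>"
proof -
  define V where "V n = (LINT \<omega>|P. (frac_sum (d + 1) u n \<omega>)\<^sup>2)" for n
  obtain q where q: "q > 0" "\<forall>\<^sub>F n in sequentially. q * real n powr (2 * d + 1) \<le> V n"
    using frac_sum_variance_lower(2)[OF u w F b d] by (auto simp: V_def)
  then obtain n0 where n0: "\<And>n. n \<ge> n0 \<Longrightarrow> q * real n powr (2 * d + 1) \<le> V n" by (auto simp: eventually_sequentially)
  \<comment> \<open>The limit theorem asks for its conditions at every index, whereas the variance
    bound holds only from \<open>n0\<close> on; the length \<open>l n\<close> always exceeds
    \<open>n0\<close>, and is at least 2 so that \<open>l n - 1\<close> is positive.\<close>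
  define l where "l n = n + (n0 + 2)" for n
  obtain C2 where C2: "C2 > 0" "\<And>k. k \<ge> 1 \<Longrightarrow> frac_coeff (d + 1) k \<le> C2 * real k powr d"
    using frac_coeff_bounds[of "d + 1"] d by auto
  have nn: "frac_coeff (d + 1) k \<ge> 0" for k using frac_coeff_pos[of "d + 1"] d less_imp_le by auto
  have l: "l n \<ge> 2" "l n \<ge> n0" "real (l n) > 0" for n by (auto simp: l_def)
  have Vl: "sqrt q * real (l n) powr (d + 1 / 2) \<le> sqrt (V (l n))" for n
  proof -
    have "sqrt (q * real (l n) powr (2 * d + 1)) \<le> sqrt (V (l n))" using n0[OF l(2)] by simp
    moreover have "sqrt (real (l n) powr (2 * d + 1)) = real (l n) powr (d + 1 / 2)"
      by (rule real_sqrt_unique) (simp_all add: powr_square distrib_left)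
    ultimately show ?thesis by (simp add: real_sqrt_mult)
  qed
  have pos: "sqrt q * real (l n) powr (d + 1 / 2) > 0" for n using q l(3)[of n] by simp
  have Vp: "sqrt (V (l n)) > 0" "V (l n) > 0" for n using less_le_trans[OF pos Vl] by (auto simp: real_sqrt_gt_0_iff)
  define wt where "wt n s = frac_coeff (d + 1) (l n - s) / sqrt (V (l n))" for n s
  define \<rho> where "\<rho> n = (C2 / sqrt q) * real (l n) powr - (1 / 2)" for n
  have \<rho>nn: "\<rho> n \<ge> 0" for n using C2 q by (simp add: \<rho>_def)
  have wb: "\<bar>wt n s\<bar> \<le> \<rho> n" if "s \<in> {1..l n}" for n s
  proof -
    have "frac_coeff (d + 1) (l n - s) \<le> frac_coeff (d + 1) (l n - 1)" using d that by (intro frac_coeff_mono) auto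
    also have "\<dots> \<le> C2 * real (l n - 1) powr d" using l(1)[of n] by (intro C2) auto
    also have "\<dots> \<le> C2 * real (l n) powr d" using d C2 by (intro mult_left_mono powr_mono2) auto
    finally have "frac_coeff (d + 1) (l n - s) \<le> C2 * real (l n) powr d" .
    then have "frac_coeff (d + 1) (l n - s) / sqrt (V (l n)) \<le> (C2 * real (l n) powr d) / (sqrt q * real (l n) powr (d + 1 / 2))"
      using nn Vl pos C2(1) by (intro frac_le) auto
    also have "\<dots> = \<rho> n"
      using l(3)[of n] by (simp add: \<rho>_def powr_add powr_minus_divide)
    finally show ?thesis using nn[of "l n - s"] Vp[of n] by (simp add: wt_def)
  qed
  have "filterlim (\<lambda>n. real (l n)) at_top sequentially"
    unfolding l_def by (rule filterlim_compose[OF filterlim_real_sequentially filterlim_add_const_nat_at_top])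
  then have "(\<lambda>n. (C2 / sqrt q) * real (l n) powr - (1 / 2)) \<longlonglongrightarrow> (C2 / sqrt q) * 0"
    by (intro tendsto_intros tendsto_neg_powr) auto
  then have \<rho>lim: "\<rho> \<longlonglongrightarrow> 0" by (simp add: \<rho>_def[abs_def])
  have sumw: "(\<Sum>s=1..l n. (wt n s)\<^sup>2) \<le> (C2 / sqrt q)\<^sup>2" for n
  proof -
    have "(\<Sum>s=1..l n. (wt n s)\<^sup>2) \<le> (\<Sum>s=1..l n. (\<rho> n)\<^sup>2)"
    proof (rule sum_mono)
      fix s assume "s \<in> {1..l n}"
      from power_mono[OF wb[OF this], of 2] show "(wt n s)\<^sup>2 \<le> (\<rho> n)\<^sup>2" by simp
    qed
    also have "\<dots> = (C2 / sqrt q)\<^sup>2 * (real (l n) * (real (l n) powr - (1 / 2))\<^sup>2)"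
      unfolding \<rho>_def power_mult_distrib by simp
    also have "(real (l n) powr - (1 / 2))\<^sup>2 = 1 / real (l n)"
    proof -
      have "(real (l n) powr - (1 / 2))\<^sup>2 = real (l n) powr - 1" unfolding powr_square by simp
      then show ?thesis using l(3)[of n] by (simp add: powr_minus_divide)
    qed
    finally show ?thesis using l(3)[of n] by simp
  qed
  have um: "\<And>s. s \<ge> 1 \<Longrightarrow> u s \<in> borel_measurable P" using u by (auto simp: zero_mean_stationary_def)
  define Y where "Y n \<omega> = (\<Sum>s=1..l n. wt n s * u (int s) \<omega>)" for n \<omega>
  have YX: "Y n \<omega> = frac_sum (d + 1) u (l n) \<omega> / sqrt (V (l n))" for n \<omega>
    by (simp add: Y_def wt_def frac_sum_def sum_divide_distrib)
  have Yint: "integrable P (\<lambda>\<omega>. (Y n \<omega>)\<^sup>2)" for n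
    unfolding YX power_divide using frac_sum_variance_lower(1)[OF u w F b d] by simp
  have Yvar: "(LINT \<omega>|P. (Y n \<omega>)\<^sup>2) = 1" for n
    unfolding YX power_divide using Vp[of n] by (simp add: V_def[symmetric])
  have Ym: "Y n \<in> borel_measurable P" for n
    unfolding Y_def by (intro borel_measurable_sum borel_measurable_times um) auto
  have ch: "(\<lambda>n. LINT \<omega>|P. cis (\<theta> * Y n \<omega>)) \<longlonglongrightarrow> complex_of_real (exp (- \<theta>\<^sup>2 / 2))" for \<theta>
    using charfun_linear_process[OF td lp um, where w = wt and l = l and \<rho> = \<rho> and C = "(C2 / sqrt q)\<^sup>2" and \<theta> = \<theta>,
        folded Y_def, OF _ wb \<rho>nn \<rho>lim sumw Yint Yvar] by blast
  obtain e where e: "e > 0" "\<forall>\<^sub>F n in sequentially. measure P {\<omega>\<in>space P. \<bar>Y n \<omega>\<bar> \<le> e} \<le> \<eta>"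
    using anti_concentration[OF Ym ch \<eta>] by blast
  have "\<forall>\<^sub>F n in sequentially. measure P {\<omega>\<in>space P. \<bar>frac_sum (d + 1) u (n + (n0 + 2)) \<omega>\<bar> \<le> (e * sqrt q) * real (n + (n0 + 2)) powr (d + 1 / 2)} \<le> \<eta>"
    using e(2)
  proof eventually_elim
    case (elim n)
    have [measurable]: "Y n \<in> borel_measurable P" by (rule Ym)
    have "measure P {\<omega>\<in>space P. \<bar>frac_sum (d + 1) u (l n) \<omega>\<bar> \<le> (e * sqrt q) * real (l n) powr (d + 1 / 2)} \<le>
        measure P {\<omega>\<in>space P. \<bar>Y n \<omega>\<bar> \<le> e}"
    proof (rule finite_measure_mono)
      show "{\<omega>\<in>space P. \<bar>frac_sum (d + 1) u (l n) \<omega>\<bar> \<le> (e * sqrt q) * real (l n) powr (d + 1 / 2)} \<subseteq> {\<omega>\<in>space P. \<bar>Y n \<omega>\<bar> \<le> e}"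
      proof safe
        fix \<omega> assume "\<bar>frac_sum (d + 1) u (l n) \<omega>\<bar> \<le> (e * sqrt q) * real (l n) powr (d + 1 / 2)"
        also have "\<dots> \<le> e * sqrt (V (l n))" using mult_left_mono[OF Vl[of n], of e] e(1) by (simp add: mult.assoc)
        finally show "\<bar>Y n \<omega>\<bar> \<le> e" unfolding YX using Vp[of n] by (simp add: abs_divide pos_divide_le_eq)
      qed
    qed measurable
    then show ?case using elim by (simp add: l_def)
  qed
  then have "\<forall>\<^sub>F n in sequentially. measure P {\<omega>\<in>space P. \<bar>frac_sum (d + 1) u n \<omega>\<bar> \<le> (e * sqrt q) * real n powr (d + 1 / 2)} \<le> \<eta>"
    by (rule eventually_sequentially_seg[THEN iffD1])
  then show ?thesis using e q by (intro exI[of _ "e * sqrt q"]) simp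
qed


section \<open>Convergence of the estimator\<close>

text \<open>The ratio is the square of \<open>(x / 2) / sin (x / 2)\<close>, which is at least 1 and
  tends to 1. It compares the factor \<open>x\<^sup>2\<close> of the criterion at
  \<open>d = 1\<close> with the factor that summation by parts produces.\<close>

lemma freq_ratio_bounds:
  assumes "\<tau> > 0"
  shows "\<exists>x0>0. \<forall>x. 0 < x \<and> x < x0 \<longrightarrow> 1 - cis x \<noteq> 0 \<and>
     1 \<le> x\<^sup>2 / (cmod (1 - cis x))\<^sup>2 \<and> x\<^sup>2 / (cmod (1 - cis x))\<^sup>2 \<le> 1 + \<tau>"
proof -
  have eq: "(cmod (1 - cis x))\<^sup>2 = 4 * (sin (x / 2))\<^sup>2" for x
    unfolding cmod_one_minus_cis_square using cos_double_sin[of "x / 2"] by simp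
  have "((\<lambda>x::real. sin x / x) \<longlongrightarrow> 1) (at 0)"
    using DERIV_sin[of "0::real"] by (simp add: DERIV_def)
  then have "((\<lambda>x::real. (1 / (sin x / x))\<^sup>2) \<longlongrightarrow> (1 / 1)\<^sup>2) (at 0)" by (intro tendsto_intros) auto
  then have "\<forall>\<^sub>F x in at (0::real). (1 / (sin x / x))\<^sup>2 < 1 + \<tau>" using assms by (intro order_tendstoD(2)) auto
  then obtain e where e: "e > 0" "\<And>x::real. x \<noteq> 0 \<Longrightarrow> \<bar>x\<bar> < e \<Longrightarrow> (1 / (sin x / x))\<^sup>2 < 1 + \<tau>"
    by (auto simp: eventually_at dist_real_def)
  show ?thesis
  proof (intro exI[of _ "min e 1"] conjI allI impI)
    fix x :: real assume "0 < x \<and> x < min e 1"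
    then have x: "0 < x" "x < e" "x < 1" by auto
    have s: "sin (x / 2) > 0" using x pi_gt3 by (intro sin_gt_zero) auto
    then have c: "(cmod (1 - cis x))\<^sup>2 > 0" unfolding eq by simp
    then show "1 - cis x \<noteq> 0" by auto
    have "sin (x / 2) \<le> x / 2" using x by (intro sin_x_le_x) auto
    then have "(2 * sin (x / 2))\<^sup>2 \<le> x\<^sup>2" using s by (intro power_mono) auto
    then show "1 \<le> x\<^sup>2 / (cmod (1 - cis x))\<^sup>2" using c by (simp add: eq power_mult_distrib)
    have "x\<^sup>2 / (cmod (1 - cis x))\<^sup>2 = (1 / (sin (x / 2) / (x / 2)))\<^sup>2"
      using s by (simp add: eq power_divide power_mult_distrib)
    also have "\<dots> \<le> 1 + \<tau>" using e(2)[of "x / 2"] x by simp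
    finally show "x\<^sup>2 / (cmod (1 - cis x))\<^sup>2 \<le> 1 + \<tau>" .
  qed (use e in simp)
qed

text \<open>The periodogram of a fractional sum of order \<open>d + 1\<close> is, up to the contribution of the
  differenced series, that of the boundary term \<open>x n - x 0\<close>, whose size does not depend on \<open>j\<close>.\<close>

lemma dft_boundary_identity:
  fixes v :: "int \<Rightarrow> 'a \<Rightarrow> real"
  assumes x: "\<And>t. x t = (\<Sum>k<t. frac_coeff (d + 1) k * v (int (t - k)) \<omega>) + x0" and n: "n \<ge> 1"
  shows "(1 - cis (fourier_freq n j)) * dft x n (fourier_freq n j) =
    frac_dft d v n j \<omega> - complex_of_real (frac_sum (d + 1) v n \<omega> / sqrt (2 * pi * real n)) * cis (fourier_freq n j)"
proof -
  define z where "z = cis (fourier_freq n j)"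
  define R where "R = complex_of_real (sqrt (2 * pi * real n))"
  have zp: "z ^ t = cis (real t * fourier_freq n j)" for t by (simp add: z_def Complex.DeMoivre)
  \<comment> \<open>The point of using Fourier frequencies: \<open>z ^ Suc n\<close> reduces to
    \<open>z\<close>, so the end term and the constant \<open>x0\<close> merge into
    \<open>x n - x0\<close>.\<close>
  have zn: "z ^ n = 1"
  proof -
    have "real n * fourier_freq n j = 2 * pi * real j" using n by (simp add: fourier_freq_def)
    then show ?thesis using cis_multiple_2pi[of "real j"] by (simp add: zp)
  qed
  have xn: "x n - x0 = frac_sum (d + 1) v n \<omega>"
  proof -
    have "(\<Sum>k<n. frac_coeff (d + 1) k * v (int (n - k)) \<omega>) = (\<Sum>s=1..n. frac_coeff (d + 1) (n - s) * v (int s) \<omega>)"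
      by (rule sum.reindex_bij_witness[of _ "\<lambda>s. n - s" "\<lambda>k. n - k"]) auto
    then show ?thesis by (simp add: x[of n] frac_sum_def)
  qed
  have "(1 - z) * (\<Sum>t=1..n. complex_of_real (x t) * z ^ t) + complex_of_real (x n) * z ^ Suc n =
     (\<Sum>s=1..n. (\<Sum>k\<le>n - s. complex_of_real (frac_coeff d k) * z ^ k) * z ^ s * complex_of_real (v (int s) \<omega>)) + complex_of_real x0 * z"
    by (rule dft_summation_by_parts) (rule x)
  then have "(1 - z) * (\<Sum>t=1..n. complex_of_real (x t) * z ^ t) =
     (\<Sum>s=1..n. (\<Sum>k\<le>n - s. complex_of_real (frac_coeff d k) * z ^ k) * z ^ s * complex_of_real (v (int s) \<omega>)) - complex_of_real (x n - x0) * z"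
    using zn by (simp add: algebra_simps)
  then have "(1 - z) * (\<Sum>t=1..n. complex_of_real (x t) * z ^ t) / R =
     (\<Sum>s=1..n. (\<Sum>k\<le>n - s. complex_of_real (frac_coeff d k) * z ^ k) * z ^ s * complex_of_real (v (int s) \<omega>)) / R - complex_of_real (x n - x0) / R * z"
    by (simp only: diff_divide_distrib times_divide_eq_left)
  then show ?thesis
    unfolding xn zp by (simp add: dft_def frac_dft_def frac_trig_def R_def z_def)
qed

text \<open>The cross term \<open>2 * \<bar>\<zeta>\<bar> * cmod D\<close> is split by the weighted
  arithmetic-geometric inequality into \<open>\<tau> * \<zeta>\<^sup>2\<close> and
  \<open>(1 / \<tau>) * (cmod D)\<^sup>2\<close>. Since \<open>\<psi> \<le> 2\<close>,
  multiplication by \<open>\<psi>\<close> at most doubles the error, and \<open>\<psi> - 1\<close>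
  adds one more \<open>\<tau> * \<zeta>\<^sup>2\<close>: hence the constants 3 and 2.\<close>

lemma ordinates_close_to_boundary_term:
  assumes \<tau>: "0 < \<tau>" "\<tau> \<le> 1" and z: "cmod z = 1"
    and \<psi>: "1 \<le> \<psi>" "\<psi> \<le> 1 + \<tau>"
  shows "\<bar>\<psi> * (cmod (D - complex_of_real \<zeta> * z))\<^sup>2 - \<zeta>\<^sup>2\<bar> \<le> 3 * \<tau> * \<zeta>\<^sup>2 + 2 * (1 + 1 / \<tau>) * (cmod D)\<^sup>2"
proof -
  have zz: "cmod (complex_of_real \<zeta> * z) = \<bar>\<zeta>\<bar>" using z by (simp add: norm_mult)
  define a where "a = cmod (D - complex_of_real \<zeta> * z)"
  have tri: "a \<le> cmod D + \<bar>\<zeta>\<bar>" "\<bar>\<zeta>\<bar> - cmod D \<le> a"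
    using norm_triangle_ineq4[of D "complex_of_real \<zeta> * z"] norm_triangle_ineq3[of "complex_of_real \<zeta> * z" D]
    by (auto simp: a_def zz norm_minus_commute)
  have "\<bar>a\<^sup>2 - \<zeta>\<^sup>2\<bar> \<le> (cmod D)\<^sup>2 + 2 * (\<bar>\<zeta>\<bar> * cmod D)"
  proof -
    have "a\<^sup>2 \<le> (cmod D + \<bar>\<zeta>\<bar>)\<^sup>2" using tri by (intro power_mono) (auto simp: a_def)
    then have 1: "a\<^sup>2 - \<zeta>\<^sup>2 \<le> (cmod D)\<^sup>2 + 2 * (\<bar>\<zeta>\<bar> * cmod D)" by (simp add: power2_sum mult_ac)
    show ?thesis
    proof (cases "\<bar>\<zeta>\<bar> \<ge> cmod D")
      case True
      then have "(\<bar>\<zeta>\<bar> - cmod D)\<^sup>2 \<le> a\<^sup>2" using tri by (intro power_mono) auto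
      moreover have "(\<bar>\<zeta>\<bar> - cmod D)\<^sup>2 = \<zeta>\<^sup>2 - 2 * (\<bar>\<zeta>\<bar> * cmod D) + (cmod D)\<^sup>2"
        by (simp add: power2_diff)
      moreover have "0 \<le> (cmod D)\<^sup>2" by simp
      ultimately have "\<zeta>\<^sup>2 - a\<^sup>2 \<le> (cmod D)\<^sup>2 + 2 * (\<bar>\<zeta>\<bar> * cmod D)" by linarith
      then show ?thesis using 1 by (simp add: abs_le_iff)
    next
      case False
      then have "\<bar>\<zeta>\<bar> * \<bar>\<zeta>\<bar> \<le> \<bar>\<zeta>\<bar> * cmod D" by (intro mult_left_mono) auto
      then have "\<zeta>\<^sup>2 \<le> \<bar>\<zeta>\<bar> * cmod D" by (simp add: power2_eq_square)
      moreover have "0 \<le> a\<^sup>2" by simp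
      moreover have "0 \<le> \<bar>\<zeta>\<bar> * cmod D" "0 \<le> (cmod D)\<^sup>2" by auto
      ultimately have "\<zeta>\<^sup>2 - a\<^sup>2 \<le> (cmod D)\<^sup>2 + 2 * (\<bar>\<zeta>\<bar> * cmod D)" by linarith
      then show ?thesis using 1 by (simp add: abs_le_iff)
    qed
  qed
  also have "2 * (\<bar>\<zeta>\<bar> * cmod D) \<le> \<tau> * \<zeta>\<^sup>2 + (1 / \<tau>) * (cmod D)\<^sup>2"
  proof -
    have "2 * (sqrt \<tau> * \<bar>\<zeta>\<bar>) * (cmod D / sqrt \<tau>) \<le> (sqrt \<tau> * \<bar>\<zeta>\<bar>)\<^sup>2 + (cmod D / sqrt \<tau>)\<^sup>2" by (rule sum_squares_bound)
    then show ?thesis using \<tau> by (simp add: power_mult_distrib power_divide)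
  qed
  finally have A: "\<bar>a\<^sup>2 - \<zeta>\<^sup>2\<bar> \<le> \<tau> * \<zeta>\<^sup>2 + (1 + 1 / \<tau>) * (cmod D)\<^sup>2" by (simp add: distrib_right)
  have "\<psi> * a\<^sup>2 - \<zeta>\<^sup>2 = \<psi> * (a\<^sup>2 - \<zeta>\<^sup>2) + (\<psi> - 1) * \<zeta>\<^sup>2" by (simp add: algebra_simps)
  also have "\<bar>\<dots>\<bar> \<le> \<bar>\<psi> * (a\<^sup>2 - \<zeta>\<^sup>2)\<bar> + \<bar>(\<psi> - 1) * \<zeta>\<^sup>2\<bar>" by (rule abs_triangle_ineq)
  also have "\<bar>\<psi> * (a\<^sup>2 - \<zeta>\<^sup>2)\<bar> \<le> 2 * (\<tau> * \<zeta>\<^sup>2 + (1 + 1 / \<tau>) * (cmod D)\<^sup>2)"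
    unfolding abs_mult using A \<psi> \<tau> by (intro mult_mono) auto
  also have "\<bar>(\<psi> - 1) * \<zeta>\<^sup>2\<bar> \<le> \<tau> * \<zeta>\<^sup>2"
    unfolding abs_mult using \<psi> by (intro mult_mono) auto
  finally show ?thesis by (simp add: a_def algebra_simps)
qed

theorem theorem3p2:
  fixes P :: "'a measure"
    and d\<^sub>0 \<Delta>\<^sub>1 \<Delta>\<^sub>2 M :: real
    and f :: "real \<Rightarrow> real"
    and u \<epsilon> :: "int \<Rightarrow> 'a \<Rightarrow> real"
    and c :: "nat \<Rightarrow> real"
    and X\<^sub>0 :: "'a \<Rightarrow> real"
    and X dhat :: "nat \<Rightarrow> 'a \<Rightarrow> real"
    and m :: "nat \<Rightarrow> nat"
  assumes "prob_space P"
    and "- 1 / 2 < \<Delta>\<^sub>1" and "\<Delta>\<^sub>1 < \<Delta>\<^sub>2"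
    and "\<Delta>\<^sub>1 \<le> 1"
    and "d\<^sub>0 \<in> {\<Delta>\<^sub>1..\<Delta>\<^sub>2}"
    and "fractional_model P d\<^sub>0 f u X\<^sub>0 X"
    and "spectral_level_at_zero f"
    and "spectral_log_derivative_bound f"
    and "linear_process P u c \<epsilon>"
    and "unit_martingale_differences P \<epsilon>"
    and "tail_dominated P \<epsilon>"
    and "bandwidth m"
    and "local_whittle_estimator P X m \<Delta>\<^sub>1 \<Delta>\<^sub>2 dhat"
    and "1 < M" and "d\<^sub>0 \<in> {1<..M}"
  shows "converges_in_probability P dhat 1"
  unfolding converges_in_probability_def
proof (intro allI impI)
  fix \<eta> :: real assume \<eta>: "\<eta> > 0"
  let ?Q = "\<lambda>n. {\<omega>\<in>space P. \<bar>dhat n \<omega> - 1\<bar> > \<eta>}"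
  interpret prob_space P by fact
  interpret martingale_differences P \<epsilon> by unfold_locales fact
  define d where "d = d\<^sub>0 - 1"
  have d: "d > 0" "d\<^sub>0 = d + 1" using assms(15) by (auto simp: d_def)
  note model = assms(6)[unfolded fractional_model_def]
  have u: "zero_mean_stationary P u" and sd: "has_spectral_density P u f" using model by auto
  have Xeq: "X t \<omega> = (\<Sum>k<t. frac_coeff (d + 1) k * u (int (t - k)) \<omega>) + X\<^sub>0 \<omega>" if "\<omega> \<in> space P" for t \<omega>
  proof -
    have "X t \<omega> = (\<Sum>k<t. pochhammer d\<^sub>0 k / fact k * u (int t - int k) \<omega>) + X\<^sub>0 \<omega>" using model that by blast
    also have "(\<Sum>k<t. pochhammer d\<^sub>0 k / fact k * u (int t - int k) \<omega>) = (\<Sum>k<t. frac_coeff (d + 1) k * u (int (t - k)) \<omega>)"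
      by (intro sum.cong refl) (simp add: frac_coeff_def d(2) of_nat_diff)
    finally show ?thesis .
  qed
  have um: "u s \<in> borel_measurable P" if "s \<ge> 1" for s using u that by (auto simp: zero_mean_stationary_def)
  obtain F \<delta> B b where F: "spectral_weight P u F" "\<And>\<theta>. F \<theta> \<ge> 0" "\<And>\<theta>. \<theta> \<notin> {-pi..pi} \<Longrightarrow> F \<theta> = 0"
    and \<delta>: "0 < \<delta>" "\<delta> \<le> 1" "\<And>\<theta>. \<bar>\<theta>\<bar> < \<delta> \<Longrightarrow> F \<theta> \<le> B" and b: "0 < b" "\<And>\<theta>. 0 < \<theta> \<Longrightarrow> \<theta> < \<delta> \<Longrightarrow> b \<le> F \<theta>"
    using spectral_weight_exists[OF sd assms(7)] by metis
  obtain C where C: "C > 0" "\<And>n k. 1 \<le> k \<Longrightarrow> k < n \<Longrightarrow> fourier_freq n k \<le> \<delta> / 2 \<Longrightarrow>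
       (LINT \<omega>|P. (\<Sum>j=1..k. (cmod (frac_dft d u n j \<omega>))\<^sup>2)) \<le>
         C * (real k * real n powr (2 * d)) * (real k powr - (d / 2) + real k powr - (1 / 2) + 1 / real n)"
    using frac_dft_second_moment(2)[OF u F \<delta> d(1)] by blast
  note Dint = frac_dft_second_moment(1)[OF u F \<delta> d(1)]

  have bw: "\<And>n. n \<ge> 1 \<Longrightarrow> m n < n" "\<forall>\<^sub>F n in sequentially. 0 < m n"
    "(\<lambda>n. 1 / real (m n) + real (m n) / real n) \<longlonglongrightarrow> 0"
    using assms(12) by (auto simp: bandwidth_def)
  have inv_m: "(\<lambda>n. 1 / real (m n)) \<longlonglongrightarrow> 0"
    by (rule Lim_null_comparison[OF _ bw(3)]) auto
  have ratio: "(\<lambda>n. real (m n) / real n) \<longlonglongrightarrow> 0"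
    by (rule Lim_null_comparison[OF _ bw(3)]) auto
  have m_top: "filterlim m at_top sequentially"
  proof -
    have "filterlim (\<lambda>n. inverse (1 / real (m n))) at_top sequentially"
      by (rule filterlim_inverse_at_top[OF inv_m]) (use bw(2) in \<open>auto elim: eventually_mono\<close>)
    then have "filterlim (\<lambda>n. real (m n)) at_top sequentially" by simp
    then show ?thesis by (simp add: filterlim_sequentially_iff_filterlim_real)
  qed
  have freq0: "(\<lambda>n. fourier_freq n (m n)) \<longlonglongrightarrow> 0"
  proof -
    have "(\<lambda>n. 2 * pi * (real (m n) / real n)) \<longlonglongrightarrow> 2 * pi * 0" by (intro tendsto_intros ratio)
    then show ?thesis by (simp add: fourier_freq_def[abs_def])
  qed

  \<comment> \<open>Keeping \<open>h\<close> below 1/4 makes both \<open>2 * h\<close> and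
    \<open>- 2 * h\<close> exceed -1/2, as \<open>jensen_gap\<close> requires.\<close>
  define h where "h = min \<eta> (1 / 5)"
  have h: "h > 0" "h \<le> \<eta>" "h < 1 / 4" using \<eta> by (auto simp: h_def)
  obtain K1 B1 where K1: "K1 > 1" "B1 > 0" "\<forall>\<^sub>F m in sequentially. K1 * real m \<le> (\<Sum>j=1..m. min (exp (2 * h * centred_ln m j)) B1)"
    using jensen_gap[of "2 * h"] h by auto
  obtain K2 B2 where K2: "K2 > 1" "B2 > 0" "\<forall>\<^sub>F m in sequentially. K2 * real m \<le> (\<Sum>j=1..m. min (exp (- 2 * h * centred_ln m j)) B2)"
    using jensen_gap[of "- 2 * h"] h by auto
  \<comment> \<open>The mean deviation of the weights will be at most
    \<open>4 * \<tau> * (\<zeta> n \<omega>)\<^sup>2\<close>: three parts from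
    \<open>ordinates_close_to_boundary_term\<close>, one from the differenced series. The factor 8
    instead of 4 makes the resulting inequalities strict.\<close>
  define \<tau> where "\<tau> = min 1 (min ((K1 - 1) / (8 * (B1 + 1))) ((K2 - 1) / (8 * (B2 + 1))))"
  have \<tau>: "\<tau> > 0" "\<tau> \<le> 1" "4 * \<tau> * (B1 + 1) < K1 - 1" "4 * \<tau> * (B2 + 1) < K2 - 1"
  proof -
    show "\<tau> > 0" "\<tau> \<le> 1" using K1 K2 by (auto simp: \<tau>_def)
    have "\<tau> \<le> (K1 - 1) / (8 * (B1 + 1))" "\<tau> \<le> (K2 - 1) / (8 * (B2 + 1))" by (auto simp: \<tau>_def)
    then have "\<tau> * (8 * (B1 + 1)) \<le> K1 - 1" "\<tau> * (8 * (B2 + 1)) \<le> K2 - 1"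
      using K1 K2 by (simp_all add: pos_le_divide_eq)
    moreover have "0 < \<tau> * (B1 + 1)" "0 < \<tau> * (B2 + 1)" using \<open>\<tau> > 0\<close> K1 K2 by auto
    moreover have "\<tau> * (8 * (B1 + 1)) = 2 * (4 * \<tau> * (B1 + 1))" "\<tau> * (8 * (B2 + 1)) = 2 * (4 * \<tau> * (B2 + 1))" by auto
    ultimately show "4 * \<tau> * (B1 + 1) < K1 - 1" "4 * \<tau> * (B2 + 1) < K2 - 1" by linarith+
  qed
  \<comment> \<open>Scaled so that the coefficient \<open>2 * (1 + 1 / \<tau>)\<close> of the
    differenced series turns \<open>\<tau>'\<close> back into \<open>\<tau>\<close>.\<close>
  define \<tau>' where "\<tau>' = \<tau> / (2 * (1 + 1 / \<tau>))"
  have \<tau>': "\<tau>' > 0" "2 * (1 + 1 / \<tau>) * \<tau>' = \<tau>"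
  proof -
    have "1 + 1 / \<tau> > 0" using \<tau>(1) by (simp add: add_pos_pos)
    then show "\<tau>' > 0" "2 * (1 + 1 / \<tau>) * \<tau>' = \<tau>" using \<tau>(1) unfolding \<tau>'_def by simp_all
  qed
  obtain x0 where x0: "x0 > 0" "\<And>x. 0 < x \<Longrightarrow> x < x0 \<Longrightarrow> 1 - cis x \<noteq> 0 \<and>
     1 \<le> x\<^sup>2 / (cmod (1 - cis x))\<^sup>2 \<and> x\<^sup>2 / (cmod (1 - cis x))\<^sup>2 \<le> 1 + \<tau>"
    using freq_ratio_bounds[OF \<tau>(1)] by blast

  define \<zeta> where "\<zeta> n \<omega> = frac_sum (d + 1) u n \<omega> / sqrt (2 * pi * real n)" for n \<omega>
  define S where "S n \<omega> = (\<Sum>j=1..m n. (cmod (frac_dft d u n j \<omega>))\<^sup>2)" for n \<omega>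
  \<comment> \<open>The deterministic part: for large \<open>n\<close>, uniformly in the sample
    point, a differenced series that is small in mean against a nonzero boundary term forces the
    minimizer to within \<open>h\<close> of 1. Probability enters only in bounding how often this
    premise fails.\<close>
  have close: "\<forall>\<^sub>F n in sequentially. \<forall>\<omega>\<in>space P. \<zeta> n \<omega> \<noteq> 0 \<longrightarrow> S n \<omega> \<le> real (m n) * (\<tau>' * (\<zeta> n \<omega>)\<^sup>2) \<longrightarrow> \<bar>dhat n \<omega> - 1\<bar> \<le> h"
    using eventually_compose_filterlim[OF K1(3) m_top] eventually_compose_filterlim[OF K2(3) m_top]
      order_tendstoD(2)[OF freq0 x0(1)] bw(2) eventually_ge_at_top[of 1]
  proof eventually_elim
    case (elim n)
    show ?case
    proof (intro ballI impI)
      fix \<omega> assume \<omega>: "\<omega> \<in> space P" and z: "\<zeta> n \<omega> \<noteq> 0" and S: "S n \<omega> \<le> real (m n) * (\<tau>' * (\<zeta> n \<omega>)\<^sup>2)"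
      define W where "W j = (fourier_freq n j)\<^sup>2 * periodogram (\<lambda>t. X t \<omega>) n (fourier_freq n j)" for j
      have Wj: "\<bar>W j - (\<zeta> n \<omega>)\<^sup>2\<bar> \<le> 3 * \<tau> * (\<zeta> n \<omega>)\<^sup>2 + 2 * (1 + 1 / \<tau>) * (cmod (frac_dft d u n j \<omega>))\<^sup>2"
        if j: "j \<in> {1..m n}" for j
      proof -
        define \<nu> where "\<nu> = fourier_freq n j"
        have "\<nu> \<le> fourier_freq n (m n)"
          unfolding \<nu>_def fourier_freq_def using j by (intro divide_right_mono mult_left_mono) auto
        moreover have "\<nu> > 0" using j elim by (simp add: \<nu>_def fourier_freq_def)
        ultimately have nz: "1 - cis \<nu> \<noteq> 0" and psi: "1 \<le> \<nu>\<^sup>2 / (cmod (1 - cis \<nu>))\<^sup>2" "\<nu>\<^sup>2 / (cmod (1 - cis \<nu>))\<^sup>2 \<le> 1 + \<tau>"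
          using x0(2)[of \<nu>] elim(3) by auto
        have id: "(1 - cis \<nu>) * dft (\<lambda>t. X t \<omega>) n \<nu> = frac_dft d u n j \<omega> - complex_of_real (\<zeta> n \<omega>) * cis \<nu>"
          unfolding \<nu>_def \<zeta>_def by (rule dft_boundary_identity) (use Xeq[OF \<omega>] elim in auto)
        have "(cmod (1 - cis \<nu>))\<^sup>2 * periodogram (\<lambda>t. X t \<omega>) n \<nu> = (cmod (frac_dft d u n j \<omega> - complex_of_real (\<zeta> n \<omega>) * cis \<nu>))\<^sup>2"
          unfolding id[symmetric] by (simp add: periodogram_def norm_mult power_mult_distrib)
        then have "W j = (\<nu>\<^sup>2 / (cmod (1 - cis \<nu>))\<^sup>2) * (cmod (frac_dft d u n j \<omega> - complex_of_real (\<zeta> n \<omega>) * cis \<nu>))\<^sup>2"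
          using nz unfolding W_def \<nu>_def[symmetric] by (simp add: field_simps)
        then show ?thesis using ordinates_close_to_boundary_term[OF \<tau>(1,2) _ psi] by simp
      qed
      have sumW: "(\<Sum>j\<in>{1..m n}. \<bar>W j - (\<zeta> n \<omega>)\<^sup>2\<bar>) \<le> (4 * \<tau>) * (\<zeta> n \<omega>)\<^sup>2 * real (card {1..m n})"
      proof -
        have "(\<Sum>j\<in>{1..m n}. \<bar>W j - (\<zeta> n \<omega>)\<^sup>2\<bar>) \<le> (\<Sum>j\<in>{1..m n}. 3 * \<tau> * (\<zeta> n \<omega>)\<^sup>2 + 2 * (1 + 1 / \<tau>) * (cmod (frac_dft d u n j \<omega>))\<^sup>2)"
          by (intro sum_mono Wj)
        also have "\<dots> = real (m n) * (3 * \<tau> * (\<zeta> n \<omega>)\<^sup>2) + 2 * (1 + 1 / \<tau>) * S n \<omega>"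
          unfolding S_def by (simp only: sum.distrib sum_distrib_left[symmetric]) simp
        also have "\<dots> \<le> real (m n) * (3 * \<tau> * (\<zeta> n \<omega>)\<^sup>2) + 2 * (1 + 1 / \<tau>) * (real (m n) * (\<tau>' * (\<zeta> n \<omega>)\<^sup>2))"
          using S \<tau>(1) by (intro add_left_mono mult_left_mono) auto
        also have "2 * (1 + 1 / \<tau>) * (real (m n) * (\<tau>' * (\<zeta> n \<omega>)\<^sup>2)) = real (m n) * ((2 * (1 + 1 / \<tau>) * \<tau>') * (\<zeta> n \<omega>)\<^sup>2)"
          by (simp only: mult_ac)
        finally show ?thesis unfolding \<tau>'(2) by (simp add: algebra_simps)
      qed
      have Wn: "W j \<ge> 0" for j by (simp add: W_def periodogram_def)
      have z2: "(\<zeta> n \<omega>)\<^sup>2 > 0" using z by simp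
      have up: "(\<Sum>j=1..m n. W j) < (\<Sum>j=1..m n. W j * exp (2 * h * centred_ln (m n) j))"
        by (rule weighted_sum_gt[OF _ _ _ _ sumW z2 K1(2) \<tau>(3)]) (use elim Wn in auto)
      have dn: "(\<Sum>j=1..m n. W j) < (\<Sum>j=1..m n. W j * exp (- 2 * h * centred_ln (m n) j))"
        by (rule weighted_sum_gt[OF _ _ _ _ sumW z2 K2(2) \<tau>(4)]) (use elim Wn in auto)
      have am: "is_arg_min (whittle_R (\<lambda>t. X t \<omega>) n (m n)) (\<lambda>d. d \<in> {\<Delta>\<^sub>1..\<Delta>\<^sub>2}) (dhat n \<omega>)"
        using assms(13) elim(4) \<omega> unfolding local_whittle_estimator_def by blast
      \<comment> \<open>The point 1 belongs to the search interval because
        \<open>\<Delta>\<^sub>1 \<le> 1\<close> and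
        \<open>1 < d\<^sub>0 \<le> \<Delta>\<^sub>2\<close>.\<close>
      show "\<bar>dhat n \<omega> - 1\<bar> \<le> h"
        by (rule arg_min_whittle_close[OF am _ _ elim(4) h(1) up[unfolded W_def] dn[unfolded W_def]])
           (use assms(4,5,15) elim(5) in auto)
    qed
  qed

  have dm: "dhat n \<in> borel_measurable P" for n using assms(13) by (simp add: local_whittle_estimator_def)
  have fm[measurable]: "frac_sum (d + 1) u n \<in> borel_measurable P" for n
    unfolding frac_sum_def[abs_def] by (intro borel_measurable_sum borel_measurable_times um) auto
  have Sint: "integrable P (S n)" for n unfolding S_def[abs_def] by (intro Bochner_Integration.integrable_sum Dint)
  then have Sm[measurable]: "S n \<in> borel_measurable P" for n by simp
  show "(\<lambda>n. measure P (?Q n)) \<longlonglongrightarrow> 0"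
  proof (rule LIMSEQ_I)
    let ?E = "\<lambda>n e. {\<omega>\<in>space P. \<bar>frac_sum (d + 1) u n \<omega>\<bar> \<le> e * real n powr (d + 1 / 2)}"
    fix r :: real assume r: "r > 0"
    then have r2: "r / 3 > 0" by simp
    obtain e where e: "e > 0" "\<forall>\<^sub>F n in sequentially. measure P (?E n e) \<le> r / 3"
      using frac_sum_anti_concentration[OF assms(11,9) u F(1,2) \<delta>(1) b d(1) r2] by blast
    \<comment> \<open>Off the event \<open>?E n e\<close> the square of
      \<open>\<zeta> n \<omega>\<close> is at least
      \<open>e\<^sup>2 * real n powr (2 * d) / (2 * pi)\<close>, so \<open>S n \<omega>\<close> has
      to exceed \<open>L n\<close> to violate the premise of \<open>close\<close>.\<close>
    define k where "k = \<tau>' * e\<^sup>2 / (2 * pi)"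
    have k: "k > 0" using e \<tau>' by (simp add: k_def)
    define L where "L n = real (m n) * real n powr (2 * d) * k" for n
    have "(\<lambda>n. C / k * (real (m n) powr - (d / 2) + real (m n) powr - (1 / 2) + 1 / real n)) \<longlonglongrightarrow> C / k * (0 + 0 + 0)"
    proof (intro tendsto_intros lim_1_over_n tendsto_neg_powr)
      show "filterlim (\<lambda>n. real (m n)) at_top sequentially"
        using m_top by (rule filterlim_compose[OF filterlim_real_sequentially])
      then show "filterlim (\<lambda>n. real (m n)) at_top sequentially" .
    qed (use d in auto)
    then have small: "\<forall>\<^sub>F n in sequentially. C / k * (real (m n) powr - (d / 2) + real (m n) powr - (1 / 2) + 1 / real n) < r / 3"
      using r by (intro order_tendstoD(2)) auto
    have "\<forall>\<^sub>F n in sequentially. fourier_freq n (m n) < \<delta> / 2" using \<delta> by (intro order_tendstoD(2)[OF freq0]) auto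
    then have "\<forall>\<^sub>F n in sequentially. measure P (?Q n) < r"
      using close e(2) small bw(2) eventually_ge_at_top[of 1]
    proof eventually_elim
      case (elim n)
      have n: "real n > 0" "real (m n) > 0" using elim by auto
      have Lp: "L n > 0" using n k by (simp add: L_def)
      \<comment> \<open>In Markov's inequality the factor
        \<open>real (m n) * real n powr (2 * d)\<close> cancels; what is left consists of negative
        powers of the bandwidth and \<open>1 / n\<close>, and vanishes because \<open>m n\<close>
        tends to infinity.\<close>
      have mark: "measure P {\<omega>\<in>space P. S n \<omega> \<ge> L n} \<le> r / 3"
      proof -
        have "measure P {\<omega>\<in>space P. S n \<omega> \<ge> L n} \<le> (LINT \<omega>|P. S n \<omega>) / L n"
          by (rule integral_Markov_inequality_measure[OF Sint sets.empty_sets _ Lp]) (auto simp: S_def intro!: sum_nonneg)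
        also have "\<dots> \<le> (C * (real (m n) * real n powr (2 * d)) * (real (m n) powr - (d / 2) + real (m n) powr - (1 / 2) + 1 / real n)) / L n"
          unfolding S_def using elim bw(1)[of n] Lp by (intro divide_right_mono C(2)) auto
        also have "\<dots> = C / k * (real (m n) powr - (d / 2) + real (m n) powr - (1 / 2) + 1 / real n)"
          using n k by (simp add: L_def)
        finally show ?thesis using elim by linarith
      qed
      have "(?Q n) \<subseteq>
          (?E n e) \<union> {\<omega>\<in>space P. S n \<omega> \<ge> L n}"
      proof
        fix \<omega> assume w: "\<omega> \<in> (?Q n)"
        show "\<omega> \<in> (?E n e) \<union> {\<omega>\<in>space P. S n \<omega> \<ge> L n}"
        proof (rule ccontr)
          assume "\<not> ?thesis"
          then have 1: "e * real n powr (d + 1 / 2) < \<bar>frac_sum (d + 1) u n \<omega>\<bar>" and 2: "S n \<omega> < L n" using w by auto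
          have epos: "0 < e * real n powr (d + 1 / 2)" using e n by simp
          have "(e * real n powr (d + 1 / 2))\<^sup>2 \<le> \<bar>frac_sum (d + 1) u n \<omega>\<bar>\<^sup>2"
            using 1 epos by (intro power_mono) auto
          also have "\<dots> = (frac_sum (d + 1) u n \<omega>)\<^sup>2" by simp
          finally have "(e * real n powr (d + 1 / 2))\<^sup>2 / (2 * pi * real n) \<le> (frac_sum (d + 1) u n \<omega>)\<^sup>2 / (2 * pi * real n)"
            by (intro divide_right_mono) auto
          also have "\<dots> = (\<zeta> n \<omega>)\<^sup>2" by (simp add: \<zeta>_def power_divide)
          also have "(e * real n powr (d + 1 / 2))\<^sup>2 / (2 * pi * real n) = e\<^sup>2 * real n powr (2 * d) / (2 * pi)"
          proof -
            have "(real n powr (d + 1 / 2))\<^sup>2 = real n powr (2 * d + 1)" by (simp add: powr_square distrib_left)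
            also have "\<dots> = real n powr (2 * d) * real n powr 1" by (rule powr_add)
            finally show ?thesis using n by (simp add: power_mult_distrib)
          qed
          finally have 3: "e\<^sup>2 * real n powr (2 * d) / (2 * pi) \<le> (\<zeta> n \<omega>)\<^sup>2" .
          have "L n = real (m n) * (\<tau>' * (e\<^sup>2 * real n powr (2 * d) / (2 * pi)))" by (simp add: L_def k_def)
          also have "\<dots> \<le> real (m n) * (\<tau>' * (\<zeta> n \<omega>)\<^sup>2)" using 3 \<tau>'(1) by (intro mult_left_mono) auto
          finally have "S n \<omega> \<le> real (m n) * (\<tau>' * (\<zeta> n \<omega>)\<^sup>2)" using 2 by simp
          moreover have "\<zeta> n \<omega> \<noteq> 0" using 1 epos n by (auto simp: \<zeta>_def)
          ultimately have "\<bar>dhat n \<omega> - 1\<bar> \<le> h" using elim w by auto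
          then show False using w h by auto
        qed
      qed
      then have "measure P (?Q n) \<le>
          measure P ((?E n e) \<union> {\<omega>\<in>space P. S n \<omega> \<ge> L n})"
        by (intro finite_measure_mono) measurable
      also have "\<dots> \<le> measure P (?E n e) + measure P {\<omega>\<in>space P. S n \<omega> \<ge> L n}"
        by (rule measure_Un_le) measurable
      also have "\<dots> \<le> r / 3 + r / 3" using mark elim by (intro add_mono) auto
      also have "\<dots> < r" using r by simp
      finally show ?case .
    qed
    then show "\<exists>no. \<forall>n\<ge>no. norm (measure P (?Q n) - 0) < r"
      by (simp add: eventually_sequentially)
  qed
qed

end
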